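(* Let $M$ be a Lorentz surface, $\iota:M\to E^3_1$ a time-like, conformal and minimal immersion, $\gamma:M\to S^4_2$ its conformal Gauss map, $\mathrm{Reg}(\iota)$ the set of points where the curvature $K^M$ of the induced metric is nonzero, and $F:=\gamma|_{\mathrm{Reg}(\iota)}$. Let $E:=F^*TS^4_2$, with the metric $h$ and the $h$-connection $\nabla$ induced by the metric and the Levi-Civita connection of $S^4_2$, let $\hat\nabla$ be the connection of $\bigwedge^2E$ induced by $\nabla$, and let $\hat F_\pm$ be the lifts of $F$, which are sections of $U_-(\bigwedge^2_\pm E)$. Then the covariant derivatives $\hat\nabla\hat F_+$ and $\hat\nabla\hat F_-$ are fully light-like. In addition, for $\varepsilon\in\{+,-\}$ let $J_\varepsilon$ be the $\varepsilon$-paracomplex structure of $E$ corresponding to $\hat F_\varepsilon$. Then, where $K^M<0$, in terms of the local frame field $(e_1,e_2,e_3,e_4)$ and the functions $\tilde l,\tilde m$ defined in the context, $\nabla J_\varepsilon$ is locally represented as $$\nabla J_\varepsilon=\alpha\otimes N,\qquad \alpha:=-(\varepsilon\tilde l+\tilde m)\,\theta^1,\qquad N:=\theta^1\otimes\xi_2-\theta^2\otimes\xi_1,$$ where $\xi_1:=e_1-\varepsilon e_3$, $\xi_2:=e_2+e_4$, $\theta^1:=e^1+\varepsilon e^3$, $\theta^2:=e^2-e^4$, $(e^1,e^2,e^3,e^4)$ is the dual frame field of $(e_1,e_2,e_3,e_4)$, and in the definition of $\alpha$ the form $\theta^1=e^1+\varepsilon e^3$ is regarded as a $1$-form on the surface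 via the dual frame field $(e^1,e^3)$ of the tangent frame $(e_1,e_3)$.
   Context: Signs $\varepsilon\in\{+,-\}$ are identified with $\pm1$. Conformal Gauss map. $E^5_2$ is $\mathbf R^5$ with $\langle x,x\rangle=(x^1)^2+(x^2)^2+(x^3)^2-(x^4)^2-(x^5)^2$; $L:=\{x\in E^5_2\setminus\{0\}:\langle x,x\rangle=0\}$; $S^4_2:=\{x\in E^5_2:\langle x,x\rangle=1\}$. $E^3_1$ is identified isometrically with $L\cap\{x^5=x^1+1\}$ (coordinates $x^2,x^3,x^4$), so $\iota$ is regarded as $L$-valued. The unit normal vector field $\gamma$ of $\iota$ (determined by the orientations of $M$ and $E^3_1$), regarded as a vector of $E^5_2$ tangent to $L\cap\{x^5=x^1+1\}$, is a map $\gamma:M\to S^4_2$, the conformal Gauss map. With $g^M$ the metric induced by $\iota$ and $K^M$ its curvature, $F=\gamma|_{\mathrm{Reg}(\iota)}$ is a time-like conformal immersion with induced metric $-K^Mg^M$, and $\iota$ is a light-like normal vector field of $F$. Let $\nu$ be the light-like normal vector field of $F$ in $S^4_2$ with $\langle\nu,\iota\rangle=-1$. Local data (where $K^M<0$). Let $w=u+jv$ be a local paracomplex coordinate (compatible with the orientation) and $g^M=e^{2\lambda}dw\,d\overline w=e^{2\lambda}(du^2-dv^2)$. Regarding $\iota$ as $E^3_1$-valued, there are functions $l,m$ with $\iota_{uu}=\lambda_u\iota_u+\lambda_v\iota_v+l\gamma=\iota_{vv}$ and $\iota_{uv}=\lambda_v\iota_u+\lambda_u\iota_v+m\gamma$;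 $K^M<0$ means $l^2>m^2$. Set $$e_1:=\frac{F_u}{\sqrt{-K^M}e^{\lambda}},\quad e_3:=\frac{F_v}{\sqrt{-K^M}e^{\lambda}},\quad \iota=\tfrac1{\sqrt2}(e_4-e_2),\quad \nu=\tfrac1{\sqrt2}(e_4+e_2),$$ so $e_2,e_4$ are normal to $F$ with $\langle e_2,e_2\rangle=1$, $\langle e_4,e_4\rangle=-1$. $S^4_2$ is oriented so that $(e_1,e_2,e_3,e_4)$ is positively oriented. Set $$\tilde l:=\frac{l\,e^{2\lambda}}{\sqrt2(l^2-m^2)},\qquad \tilde m:=\frac{m\,e^{2\lambda}}{\sqrt2(l^2-m^2)}.$$ $(e_1,e_3)$ is also regarded as a frame of the tangent bundle of the surface. Twistor notions. For an oriented rank-$4$ bundle $E$ with neutral metric $h$ (signature $(2,2)$), $\hat h$ is the induced metric on $\bigwedge^2E$. For a positively oriented ordered pseudo-orthonormal local frame $(e_1,e_2,e_3,e_4)$ ($e_1,e_2$ space-like, $e_3,e_4$ time-like) put $$\Omega_{\pm,1}:=\tfrac1{\sqrt2}(e_1\wedge e_2\pm e_3\wedge e_4),\ \ \Omega_{\pm,2}:=\tfrac1{\sqrt2}(e_1\wedge e_3\pm e_4\wedge e_2),\ \ \Omega_{\pm,3}:=\tfrac1{\sqrt2}(e_1\wedge e_4\pm e_2\wedge e_3).$$ $\bigwedge^2_\varepsilon E$ is the rank-$3$ subbundle locally spanned by $\Omega_{-\varepsilon,1},\Omega_{\varepsilon,2},\Omega_{\varepsilon,3}$, and $U_-(\bigwedge^2_\varepsilon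 E):=\{\theta\in\bigwedge^2_\varepsilon E:\hat h(\theta,\theta)=-1\}$ is a time-like twistor space. The lifts of $F$ are $\hat F_\pm=\Omega_{\pm,2}$ for positively oriented frames with $e_1,e_3$ tangent to $F$, $(e_1,e_3)$ positively oriented, and $e_2,e_4$ normal; in particular for the frame above. For a section $\Omega$ of $U_-(\bigwedge^2_\varepsilon E)$, $\hat\nabla\Omega$ is fully light-like if at each point $p$ of the base, $\hat\nabla_v\Omega$ is light-like or zero with respect to $\hat h$ for every tangent vector $v$ at $p$, and is nonzero for some $v$ (so $\hat\nabla\Omega$ determines a light-like line at each point). The $\varepsilon$-paracomplex structure $J$ of $E$ corresponding to $\Omega$ is given, in any positively oriented pseudo-orthonormal local frame with $\Omega=\Omega_{\varepsilon,2}$, by $Je_1=e_3$, $Je_3=e_1$, $Je_2=-\varepsilon e_4$, $Je_4=-\varepsilon e_2$. *)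

theory Defs
  imports "HOL-Analysis.Analysis"
begin

section \<open>Paracomplex charts and Lorentz surfaces\<close>

text \<open>
  A chart is a pair of a coordinate domain and a coordinate map \<open>w = (u, v)\<close>; \<open>u\<close> and \<open>v\<close> are the
  components 1 and 2. Only the values of the coordinate map on the domain matter.
  Maps on the surface are differentiated through a chart, so that
  \<open>deriv_along c a f p\<close> is the derivative of \<open>f\<close> at \<open>p\<close> in the direction of the tangent vector
  \<open>a$1 \<partial>/\<partial>u + a$2 \<partial>/\<partial>v\<close>.
\<close>

type_synonym 'a chart = "'a set \<times> ('a \<Rightarrow> real^2)"

abbreviation param :: "'a chart \<Rightarrow> real^2 \<Rightarrow> 'a" where
  "param c \<equiv> inv_into (fst c) (snd c)"

definition differentiable_in :: "'a chart \<Rightarrow> ('a \<Rightarrow> 'b::real_normed_vector) \<Rightarrow> 'a \<Rightarrow> bool" where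
  "differentiable_in c f p \<longleftrightarrow> (f \<circ> param c) differentiable (at (snd c p))"

definition deriv_along :: "'a chart \<Rightarrow> real^2 \<Rightarrow> ('a \<Rightarrow> 'b::real_normed_vector) \<Rightarrow> 'a \<Rightarrow> 'b" where
  "deriv_along c a f p = frechet_derivative (f \<circ> param c) (at (snd c p)) a"

abbreviation pd :: "'a chart \<Rightarrow> 2 \<Rightarrow> ('a \<Rightarrow> 'b::real_normed_vector) \<Rightarrow> 'a \<Rightarrow> 'b" where
  "pd c i \<equiv> deriv_along c (axis i 1)"

primrec Ck_on :: "nat \<Rightarrow> (real^2) set \<Rightarrow> (real^2 \<Rightarrow> 'b::real_normed_vector) \<Rightarrow> bool" where
  "Ck_on 0 U f \<longleftrightarrow> continuous_on U f"
| "Ck_on (Suc k) U f \<longleftrightarrow> (\<forall>x\<in>U. f differentiable (at x)) \<and>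
     (\<forall>i. Ck_on k U (\<lambda>x. frechet_derivative f (at x) (axis i 1)))"

definition smooth_on :: "(real^2) set \<Rightarrow> (real^2 \<Rightarrow> 'b::real_normed_vector) \<Rightarrow> bool" where
  "smooth_on U f \<longleftrightarrow> (\<forall>k. Ck_on k U f)"

text \<open>Multiplication by \<open>j\<close>, where \<open>j\<^sup>2 = 1\<close>, on \<open>u + jv\<close>.\<close>

definition para_j :: "real^2 \<Rightarrow> real^2" where
  "para_j a = vector [a$2, a$1]"

text \<open>
  A Lorentz surface is a surface with an atlas of paracomplex coordinates. The coordinate changes
  commute with \<open>j\<close> to first order and preserve the orientation; equivalently they preserve
  \<open>du\<^sup>2 - dv\<^sup>2\<close> up to a positive factor, and the orientation.
\<close>

definition lorentz_surface :: "'a::{t2_space, second_countable_topology} chart set \<Rightarrow> bool" where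
  "lorentz_surface A \<longleftrightarrow>
     (\<Union>c\<in>A. fst c) = UNIV \<and>
     (\<forall>c\<in>A. open (fst c) \<and> open (snd c ` fst c) \<and>
        homeomorphism (fst c) (snd c ` fst c) (snd c) (param c)) \<and>
     (\<forall>c\<in>A. \<forall>d\<in>A.
        smooth_on (snd c ` (fst c \<inter> fst d)) (snd d \<circ> param c) \<and>
        (\<forall>x\<in>snd c ` (fst c \<inter> fst d).
           let D = frechet_derivative (snd d \<circ> param c) (at x)
           in (\<forall>a. D (para_j a) = para_j (D a)) \<and> det (matrix D) > 0))"

text \<open>Used for quantities at \<open>p\<close> that do not depend on the choice of the chart.\<close>

definition chart_at :: "'a chart set \<Rightarrow> 'a \<Rightarrow> 'a chart" where
  "chart_at A p = (SOME c. c \<in> A \<and> p \<in> fst c)"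

section \<open>Curvature of a metric in a chart\<close>

definition christoffel :: "'a chart \<Rightarrow> ('a \<Rightarrow> real^2^2) \<Rightarrow> 2 \<Rightarrow> 2 \<Rightarrow> 2 \<Rightarrow> 'a \<Rightarrow> real" where
  "christoffel c g k i j p = (1/2) * (\<Sum>l\<in>UNIV. matrix_inv (g p) $ k $ l *
     (pd c i (\<lambda>q. g q $ l $ j) p + pd c j (\<lambda>q. g q $ l $ i) p - pd c l (\<lambda>q. g q $ i $ j) p))"

text \<open>The \<open>l\<close>-component of \<open>R(\<partial>\<^sub>i, \<partial>\<^sub>j)\<partial>\<^sub>k = \<nabla>\<^sub>i\<nabla>\<^sub>j\<partial>\<^sub>k - \<nabla>\<^sub>j\<nabla>\<^sub>i\<partial>\<^sub>k\<close>.\<close>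

definition riemann :: "'a chart \<Rightarrow> ('a \<Rightarrow> real^2^2) \<Rightarrow> 2 \<Rightarrow> 2 \<Rightarrow> 2 \<Rightarrow> 2 \<Rightarrow> 'a \<Rightarrow> real" where
  "riemann c g l i j k p =
     pd c i (christoffel c g l j k) p - pd c j (christoffel c g l i k) p +
     (\<Sum>m\<in>UNIV. christoffel c g l i m p * christoffel c g m j k p
               - christoffel c g l j m p * christoffel c g m i k p)"

text \<open>\<open>K = \<langle>R(\<partial>\<^sub>1, \<partial>\<^sub>2)\<partial>\<^sub>2, \<partial>\<^sub>1\<rangle> / (g\<^sub>1\<^sub>1 g\<^sub>2\<^sub>2 - g\<^sub>1\<^sub>2\<^sup>2)\<close>.\<close>

definition gauss_curvature :: "'a chart \<Rightarrow> ('a \<Rightarrow> real^2^2) \<Rightarrow> 'a \<Rightarrow> real" where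
  "gauss_curvature c g p = (\<Sum>l\<in>UNIV. g p $ 1 $ l * riemann c g l 1 2 2 p) / det (g p)"

section \<open>Time-like surfaces in Minkowski 3-space\<close>

text \<open>The components 1, 2, 3 are the coordinates \<open>x\<^sup>2, x\<^sup>3, x\<^sup>4\<close> of \<open>E\<^sup>5\<^sub>2\<close>.\<close>

definition h3 :: "real^3 \<Rightarrow> real^3 \<Rightarrow> real" where
  "h3 y z = y$1 * z$1 + y$2 * z$2 - y$3 * z$3"

definition induced_metric :: "'a chart \<Rightarrow> ('a \<Rightarrow> real^3) \<Rightarrow> 'a \<Rightarrow> real^2^2" where
  "induced_metric c \<iota> p = (\<chi> i j. h3 (pd c i \<iota> p) (pd c j \<iota> p))"

text \<open>
  The induced metric is \<open>e\<^sup>2\<^sup>\<lambda>(du\<^sup>2 - dv\<^sup>2)\<close> in each chart; its nondegeneracy makes \<open>\<iota>\<close> an immersion.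
\<close>

definition timelike_conformal_immersion ::
    "'a::{t2_space, second_countable_topology} chart set \<Rightarrow> ('a \<Rightarrow> real^3) \<Rightarrow> bool" where
  "timelike_conformal_immersion A \<iota> \<longleftrightarrow> (\<forall>c\<in>A.
     smooth_on (snd c ` fst c) (\<iota> \<circ> param c) \<and>
     (\<forall>p\<in>fst c. \<exists>r>0. induced_metric c \<iota> p = vector [vector [r, 0], vector [0, -r]]))"

text \<open>
  The orientation of \<open>E\<^sup>3\<^sub>1\<close> is \<open>oE \<in> {1, -1}\<close> times the one given by \<open>(x\<^sup>2, x\<^sup>3, x\<^sup>4)\<close>.
\<close>

definition unit_normal :: "'a chart set \<Rightarrow> real \<Rightarrow> ('a \<Rightarrow> real^3) \<Rightarrow> 'a \<Rightarrow> real^3" where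
  "unit_normal A oE \<iota> p = (THE n. h3 n n = 1 \<and>
     (let c = chart_at A p in
        h3 n (pd c 1 \<iota> p) = 0 \<and> h3 n (pd c 2 \<iota> p) = 0 \<and>
        oE * det (vector [pd c 1 \<iota> p, pd c 2 \<iota> p, n] :: real^3^3) > 0))"

definition mean_curvature :: "'a chart \<Rightarrow> ('a \<Rightarrow> real^3) \<Rightarrow> ('a \<Rightarrow> real^3) \<Rightarrow> 'a \<Rightarrow> real" where
  "mean_curvature c \<iota> n p =
     (1/2) * (\<Sum>i\<in>UNIV. \<Sum>j\<in>UNIV. matrix_inv (induced_metric c \<iota> p) $ i $ j * h3 (pd c i (pd c j \<iota>) p) (n p))"

definition minimal :: "'a chart set \<Rightarrow> real \<Rightarrow> ('a \<Rightarrow> real^3) \<Rightarrow> bool" where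
  "minimal A oE \<iota> \<longleftrightarrow> (\<forall>c\<in>A. \<forall>p\<in>fst c. mean_curvature c \<iota> (unit_normal A oE \<iota>) p = 0)"

definition curvature :: "'a chart set \<Rightarrow> ('a \<Rightarrow> real^3) \<Rightarrow> 'a \<Rightarrow> real" where
  "curvature A \<iota> p = (let c = chart_at A p in gauss_curvature c (induced_metric c \<iota>) p)"

definition Reg :: "'a chart set \<Rightarrow> ('a \<Rightarrow> real^3) \<Rightarrow> 'a set" where
  "Reg A \<iota> = {p. curvature A \<iota> p \<noteq> 0}"

section \<open>The pseudosphere and the conformal Gauss map\<close>

definition sign5 :: "5 \<Rightarrow> real" where
  "sign5 i = (if i = 4 \<or> i = 5 then -1 else 1)"

definition h5 :: "real^5 \<Rightarrow> real^5 \<Rightarrow> real" where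
  "h5 x y = (\<Sum>i\<in>UNIV. sign5 i * x$i * y$i)"

definition light_cone :: "(real^5) set" where
  "light_cone = {x. x \<noteq> 0 \<and> h5 x x = 0}"

text \<open>The tangent space of \<open>S\<^sup>4\<^sub>2 = {x. h5 x x = 1}\<close> at \<open>x\<close>.\<close>

definition tangent_S42 :: "real^5 \<Rightarrow> (real^5) set" where
  "tangent_S42 x = {y. h5 x y = 0}"

text \<open>
  The identification of \<open>E\<^sup>3\<^sub>1\<close> with \<open>L \<inter> {x\<^sup>5 = x\<^sup>1 + 1}\<close>: the two equations determine \<open>x\<^sup>1\<close> and
  \<open>x\<^sup>5\<close> from \<open>x\<^sup>2, x\<^sup>3, x\<^sup>4\<close>.
\<close>

definition emb :: "real^3 \<Rightarrow> real^5" where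
  "emb y = vector [(h3 y y - 1)/2, y$1, y$2, y$3, (h3 y y + 1)/2]"

definition gauss_map :: "'a chart set \<Rightarrow> real \<Rightarrow> ('a \<Rightarrow> real^3) \<Rightarrow> 'a \<Rightarrow> real^5" where
  "gauss_map A oE \<iota> p = frechet_derivative emb (at (\<iota> p)) (unit_normal A oE \<iota> p)"

text \<open>
  The orientation of the (connected) \<open>S\<^sup>4\<^sub>2\<close> is \<open>oS \<in> {1, -1}\<close> times the one for which a frame at \<open>x\<close>
  is positive if, preceded by \<open>x\<close>, it is a positively oriented basis of \<open>R\<^sup>5\<close>.
\<close>

definition pos_oriented :: "real \<Rightarrow> real^5 \<Rightarrow> real^5 \<Rightarrow> real^5 \<Rightarrow> real^5 \<Rightarrow> real^5 \<Rightarrow> bool" where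
  "pos_oriented oS x e1 e2 e3 e4 \<longleftrightarrow> oS * det (vector [x, e1, e2, e3, e4] :: real^5^5) > 0"

definition pos_frame :: "real \<Rightarrow> real^5 \<Rightarrow> real^5 \<Rightarrow> real^5 \<Rightarrow> real^5 \<Rightarrow> real^5 \<Rightarrow> bool" where
  "pos_frame oS x e1 e2 e3 e4 \<longleftrightarrow>
     {e1, e2, e3, e4} \<subseteq> tangent_S42 x \<and>
     h5 e1 e1 = 1 \<and> h5 e2 e2 = 1 \<and> h5 e3 e3 = -1 \<and> h5 e4 e4 = -1 \<and>
     h5 e1 e2 = 0 \<and> h5 e1 e3 = 0 \<and> h5 e1 e4 = 0 \<and> h5 e2 e3 = 0 \<and> h5 e2 e4 = 0 \<and> h5 e3 e4 = 0 \<and>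
     pos_oriented oS x e1 e2 e3 e4"

section \<open>Bivectors, twistor spaces and lifts\<close>

text \<open>Bivectors of \<open>R\<^sup>5\<close> are represented by skew-symmetric matrices.\<close>

definition wedge :: "real^5 \<Rightarrow> real^5 \<Rightarrow> real^5^5" where
  "wedge a b = (\<chi> i j. a$i * b$j - b$i * a$j)"

definition h_hat :: "real^5^5 \<Rightarrow> real^5^5 \<Rightarrow> real" where
  "h_hat S T = (1/2) * (\<Sum>i\<in>UNIV. \<Sum>j\<in>UNIV. sign5 i * sign5 j * S$i$j * T$i$j)"

definition light_like :: "real^5^5 \<Rightarrow> bool" where
  "light_like T \<longleftrightarrow> T \<noteq> 0 \<and> h_hat T T = 0"

definition Omega1 :: "real \<Rightarrow> real^5 \<Rightarrow> real^5 \<Rightarrow> real^5 \<Rightarrow> real^5 \<Rightarrow> real^5^5" where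
  "Omega1 s e1 e2 e3 e4 = (1 / sqrt 2) *\<^sub>R (wedge e1 e2 + s *\<^sub>R wedge e3 e4)"

definition Omega2 :: "real \<Rightarrow> real^5 \<Rightarrow> real^5 \<Rightarrow> real^5 \<Rightarrow> real^5 \<Rightarrow> real^5^5" where
  "Omega2 s e1 e2 e3 e4 = (1 / sqrt 2) *\<^sub>R (wedge e1 e3 + s *\<^sub>R wedge e4 e2)"

definition Omega3 :: "real \<Rightarrow> real^5 \<Rightarrow> real^5 \<Rightarrow> real^5 \<Rightarrow> real^5 \<Rightarrow> real^5^5" where
  "Omega3 s e1 e2 e3 e4 = (1 / sqrt 2) *\<^sub>R (wedge e1 e4 + s *\<^sub>R wedge e2 e3)"

text \<open>
  The fibres, over a point mapped to \<open>x \<in> S\<^sup>4\<^sub>2\<close>, of \<open>\<And>\<^sup>2\<^sub>\<epsilon>E\<close> and of its time-like twistor space.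
  The span is the same for all positively oriented frames.
\<close>

definition wedge2 :: "real \<Rightarrow> real \<Rightarrow> real^5 \<Rightarrow> (real^5^5) set" where
  "wedge2 oS \<epsilon> x = {T. \<exists>e1 e2 e3 e4. pos_frame oS x e1 e2 e3 e4 \<and>
     T \<in> span {Omega1 (-\<epsilon>) e1 e2 e3 e4, Omega2 \<epsilon> e1 e2 e3 e4, Omega3 \<epsilon> e1 e2 e3 e4}}"

definition U_minus :: "real \<Rightarrow> real \<Rightarrow> real^5 \<Rightarrow> (real^5^5) set" where
  "U_minus oS \<epsilon> x = {T \<in> wedge2 oS \<epsilon> x. h_hat T T = -1}"

definition adapted_frame ::
    "'a chart set \<Rightarrow> real \<Rightarrow> ('a \<Rightarrow> real^5) \<Rightarrow> 'a \<Rightarrow> real^5 \<Rightarrow> real^5 \<Rightarrow> real^5 \<Rightarrow> real^5 \<Rightarrow> bool" where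
  "adapted_frame A oS F p e1 e2 e3 e4 \<longleftrightarrow> pos_frame oS (F p) e1 e2 e3 e4 \<and>
     (let c = chart_at A p in
        (\<exists>a b. e1 = deriv_along c a F p \<and> e3 = deriv_along c b F p \<and> det (vector [a, b] :: real^2^2) > 0) \<and>
        (\<forall>a. h5 e2 (deriv_along c a F p) = 0 \<and> h5 e4 (deriv_along c a F p) = 0))"

definition twistor_lift ::
    "'a chart set \<Rightarrow> real \<Rightarrow> ('a \<Rightarrow> real^5) \<Rightarrow> real \<Rightarrow> 'a \<Rightarrow> real^5^5" where
  "twistor_lift A oS F \<epsilon> p =
     (THE T. \<exists>e1 e2 e3 e4. adapted_frame A oS F p e1 e2 e3 e4 \<and> T = Omega2 \<epsilon> e1 e2 e3 e4)"

section \<open>The connections on \<open>E\<close>, on its bivectors and on its endomorphisms\<close>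

text \<open>
  Sections of \<open>E = F\<^sup>*TS\<^sup>4\<^sub>2\<close> are \<open>R\<^sup>5\<close>-valued maps \<open>X\<close> with \<open>X\<close> orthogonal to \<open>F\<close>. The Levi-Civita
  connection of \<open>S\<^sup>4\<^sub>2\<close> is the flat connection of \<open>E\<^sup>5\<^sub>2\<close> followed by the orthogonal projection.
\<close>

definition proj_S42 :: "real^5 \<Rightarrow> real^5 \<Rightarrow> real^5" where
  "proj_S42 x y = y - h5 x y *\<^sub>R x"

definition nabla :: "('a \<Rightarrow> real^5) \<Rightarrow> 'a chart \<Rightarrow> real^2 \<Rightarrow> ('a \<Rightarrow> real^5) \<Rightarrow> 'a \<Rightarrow> real^5" where
  "nabla F c a X p = proj_S42 (F p) (deriv_along c a X p)"

text \<open>On bivectors, the projection is applied to both factors; see \<open>nabla_hat_wedge\<close> below.\<close>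

definition nabla_hat :: "('a \<Rightarrow> real^5) \<Rightarrow> 'a chart \<Rightarrow> real^2 \<Rightarrow> ('a \<Rightarrow> real^5^5) \<Rightarrow> 'a \<Rightarrow> real^5^5" where
  "nabla_hat F c a \<Theta> p =
     matrix (proj_S42 (F p)) ** deriv_along c a \<Theta> p ** transpose (matrix (proj_S42 (F p)))"

definition section_U_minus ::
    "'a chart set \<Rightarrow> real \<Rightarrow> ('a \<Rightarrow> real^5) \<Rightarrow> 'a set \<Rightarrow> real \<Rightarrow> ('a \<Rightarrow> real^5^5) \<Rightarrow> bool" where
  "section_U_minus A oS F W \<epsilon> \<Theta> \<longleftrightarrow> (\<forall>p\<in>W. \<Theta> p \<in> U_minus oS \<epsilon> (F p) \<and>
     (\<forall>c\<in>A. p \<in> fst c \<longrightarrow> differentiable_in c \<Theta> p))"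

definition fully_light_like ::
    "'a chart set \<Rightarrow> real \<Rightarrow> ('a \<Rightarrow> real^5) \<Rightarrow> 'a set \<Rightarrow> real \<Rightarrow> ('a \<Rightarrow> real^5^5) \<Rightarrow> bool" where
  "fully_light_like A oS F W \<epsilon> \<Theta> \<longleftrightarrow> section_U_minus A oS F W \<epsilon> \<Theta> \<and>
     (\<forall>p\<in>W. \<forall>c\<in>A. p \<in> fst c \<longrightarrow>
        (\<forall>a. light_like (nabla_hat F c a \<Theta> p) \<or> nabla_hat F c a \<Theta> p = 0) \<and>
        (\<exists>a. nabla_hat F c a \<Theta> p \<noteq> 0))"

text \<open>The value at \<open>y \<in> T\<^sub>xS\<^sup>4\<^sub>2\<close> of the \<open>\<epsilon>\<close>-paracomplex structure corresponding to \<open>T\<close>.\<close>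

definition para_structure :: "real \<Rightarrow> real \<Rightarrow> real^5 \<Rightarrow> real^5^5 \<Rightarrow> real^5 \<Rightarrow> real^5" where
  "para_structure oS \<epsilon> x T y = (THE z. \<exists>e1 e2 e3 e4 a1 a2 a3 a4.
     pos_frame oS x e1 e2 e3 e4 \<and> T = Omega2 \<epsilon> e1 e2 e3 e4 \<and>
     y = a1 *\<^sub>R e1 + a2 *\<^sub>R e2 + a3 *\<^sub>R e3 + a4 *\<^sub>R e4 \<and>
     z = a1 *\<^sub>R e3 + a2 *\<^sub>R (- \<epsilon> *\<^sub>R e4) + a3 *\<^sub>R e1 + a4 *\<^sub>R (- \<epsilon> *\<^sub>R e2))"

text \<open>
  \<open>has_nabla_endo F c W J p B\<close>: at \<open>p\<close>, the covariant derivative of the field \<open>J\<close> of endomorphisms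
  of \<open>E\<close> over \<open>W\<close> is \<open>B\<close>, that is \<open>(\<nabla>\<^sub>aJ)X = \<nabla>\<^sub>a(JX) - J(\<nabla>\<^sub>aX) = B a X\<close> for all sections \<open>X\<close> of \<open>E\<close>
  and tangent vectors \<open>a\<close>.
\<close>

definition has_nabla_endo ::
    "('a \<Rightarrow> real^5) \<Rightarrow> 'a chart \<Rightarrow> 'a set \<Rightarrow> ('a \<Rightarrow> real^5 \<Rightarrow> real^5) \<Rightarrow> 'a \<Rightarrow>
     (real^2 \<Rightarrow> real^5 \<Rightarrow> real^5) \<Rightarrow> bool" where
  "has_nabla_endo F c W J p B \<longleftrightarrow>
     (\<forall>X. (\<forall>q\<in>fst c \<inter> W. X q \<in> tangent_S42 (F q)) \<and> differentiable_in c X p \<longrightarrow>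
        differentiable_in c (\<lambda>q. J q (X q)) p \<and>
        (\<forall>a. nabla F c a (\<lambda>q. J q (X q)) p - J p (nabla F c a X p) = B a (X p)))"

section \<open>Local data in a paracomplex coordinate\<close>

definition conf_exp :: "('a \<Rightarrow> real^3) \<Rightarrow> 'a chart \<Rightarrow> 'a \<Rightarrow> real" where
  "conf_exp \<iota> c p = ln (induced_metric c \<iota> p $ 1 $ 1) / 2"

definition coeff_l :: "'a chart set \<Rightarrow> real \<Rightarrow> ('a \<Rightarrow> real^3) \<Rightarrow> 'a chart \<Rightarrow> 'a \<Rightarrow> real" where
  "coeff_l A oE \<iota> c p = (THE l.
     pd c 1 (pd c 1 \<iota>) p = pd c 1 (conf_exp \<iota> c) p *\<^sub>R pd c 1 \<iota> p + pd c 2 (conf_exp \<iota> c) p *\<^sub>R pd c 2 \<iota> p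
       + l *\<^sub>R unit_normal A oE \<iota> p)"

definition coeff_m :: "'a chart set \<Rightarrow> real \<Rightarrow> ('a \<Rightarrow> real^3) \<Rightarrow> 'a chart \<Rightarrow> 'a \<Rightarrow> real" where
  "coeff_m A oE \<iota> c p = (THE m.
     pd c 2 (pd c 1 \<iota>) p = pd c 2 (conf_exp \<iota> c) p *\<^sub>R pd c 1 \<iota> p + pd c 1 (conf_exp \<iota> c) p *\<^sub>R pd c 2 \<iota> p
       + m *\<^sub>R unit_normal A oE \<iota> p)"

definition l_tilde :: "'a chart set \<Rightarrow> real \<Rightarrow> ('a \<Rightarrow> real^3) \<Rightarrow> 'a chart \<Rightarrow> 'a \<Rightarrow> real" where
  "l_tilde A oE \<iota> c p = coeff_l A oE \<iota> c p * exp (2 * conf_exp \<iota> c p) /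
     (sqrt 2 * ((coeff_l A oE \<iota> c p)\<^sup>2 - (coeff_m A oE \<iota> c p)\<^sup>2))"

definition m_tilde :: "'a chart set \<Rightarrow> real \<Rightarrow> ('a \<Rightarrow> real^3) \<Rightarrow> 'a chart \<Rightarrow> 'a \<Rightarrow> real" where
  "m_tilde A oE \<iota> c p = coeff_m A oE \<iota> c p * exp (2 * conf_exp \<iota> c p) /
     (sqrt 2 * ((coeff_l A oE \<iota> c p)\<^sup>2 - (coeff_m A oE \<iota> c p)\<^sup>2))"

definition nu :: "'a chart set \<Rightarrow> real \<Rightarrow> ('a \<Rightarrow> real^3) \<Rightarrow> 'a \<Rightarrow> real^5" where
  "nu A oE \<iota> p = (THE n. n \<in> light_cone \<and> n \<in> tangent_S42 (gauss_map A oE \<iota> p) \<and>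
     (\<forall>a. h5 n (deriv_along (chart_at A p) a (gauss_map A oE \<iota>) p) = 0) \<and> h5 n (emb (\<iota> p)) = -1)"

text \<open>
  The frame \<open>(e\<^sub>1, e\<^sub>3)\<close> of the tangent bundle of the surface, in the components of the chart; \<open>F\<close> maps
  it to the vectors \<open>e\<^sub>1, e\<^sub>3\<close> of \<open>E\<close>.
\<close>

definition surf_e1 :: "'a chart set \<Rightarrow> ('a \<Rightarrow> real^3) \<Rightarrow> 'a chart \<Rightarrow> 'a \<Rightarrow> real^2" where
  "surf_e1 A \<iota> c p = (1 / (sqrt (- curvature A \<iota> p) * exp (conf_exp \<iota> c p))) *\<^sub>R axis 1 1"

definition surf_e3 :: "'a chart set \<Rightarrow> ('a \<Rightarrow> real^3) \<Rightarrow> 'a chart \<Rightarrow> 'a \<Rightarrow> real^2" where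
  "surf_e3 A \<iota> c p = (1 / (sqrt (- curvature A \<iota> p) * exp (conf_exp \<iota> c p))) *\<^sub>R axis 2 1"

definition frame_e1 :: "'a chart set \<Rightarrow> real \<Rightarrow> ('a \<Rightarrow> real^3) \<Rightarrow> 'a chart \<Rightarrow> 'a \<Rightarrow> real^5" where
  "frame_e1 A oE \<iota> c p =
     (1 / (sqrt (- curvature A \<iota> p) * exp (conf_exp \<iota> c p))) *\<^sub>R pd c 1 (gauss_map A oE \<iota>) p"

definition frame_e2 :: "'a chart set \<Rightarrow> real \<Rightarrow> ('a \<Rightarrow> real^3) \<Rightarrow> 'a \<Rightarrow> real^5" where
  "frame_e2 A oE \<iota> p = (1 / sqrt 2) *\<^sub>R (nu A oE \<iota> p - emb (\<iota> p))"

definition frame_e3 :: "'a chart set \<Rightarrow> real \<Rightarrow> ('a \<Rightarrow> real^3) \<Rightarrow> 'a chart \<Rightarrow> 'a \<Rightarrow> real^5" where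
  "frame_e3 A oE \<iota> c p =
     (1 / (sqrt (- curvature A \<iota> p) * exp (conf_exp \<iota> c p))) *\<^sub>R pd c 2 (gauss_map A oE \<iota>) p"

definition frame_e4 :: "'a chart set \<Rightarrow> real \<Rightarrow> ('a \<Rightarrow> real^3) \<Rightarrow> 'a \<Rightarrow> real^5" where
  "frame_e4 A oE \<iota> p = (1 / sqrt 2) *\<^sub>R (nu A oE \<iota> p + emb (\<iota> p))"

text \<open>
  \<open>S\<^sup>4\<^sub>2\<close> is oriented so that \<open>(e\<^sub>1, e\<^sub>2, e\<^sub>3, e\<^sub>4)\<close> is positive wherever it is defined. As the frames are
  positive for \<open>oS = -oE\<close>, this means \<open>oS = -oE\<close> unless the curvature is nowhere negative.
\<close>

definition frames_positive :: "'a chart set \<Rightarrow> real \<Rightarrow> real \<Rightarrow> ('a \<Rightarrow> real^3) \<Rightarrow> bool" where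
  "frames_positive A oE oS \<iota> \<longleftrightarrow> (\<forall>c\<in>A. \<forall>p\<in>fst c. curvature A \<iota> p < 0 \<longrightarrow>
     pos_oriented oS (gauss_map A oE \<iota> p)
       (frame_e1 A oE \<iota> c p) (frame_e2 A oE \<iota> p) (frame_e3 A oE \<iota> c p) (frame_e4 A oE \<iota> p))"

section \<open>Consistency of the encodings\<close>

lemma UNIV_5: "(UNIV :: 5 set) = {1, 2, 3, 4, 5}"
proof -
  have "x = 1 \<or> x = 2 \<or> x = 3 \<or> x = 4 \<or> x = 5" for x :: 5
  proof (induct x)
    case (of_int z)
    then have "z = 0 \<or> z = 1 \<or> z = 2 \<or> z = 3 \<or> z = 4" by fastforce
    then show ?case by auto
  qed
  then show ?thesis by auto
qed

lemma sum_5: "sum f (UNIV :: 5 set) = f 1 + f 2 + f 3 + f 4 + f 5"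
  unfolding UNIV_5 by (simp add: ac_simps)

lemma forall_5: "(\<forall>i::5. P i) \<longleftrightarrow> P 1 \<and> P 2 \<and> P 3 \<and> P 4 \<and> P 5"
  by (metis (full_types) UNIV_I UNIV_5 empty_iff insert_iff)

lemma vector_5:
  "(vector [a, b, c, d, e] :: ('b::zero)^5) $ 1 = a"
  "(vector [a, b, c, d, e] :: ('b::zero)^5) $ 2 = b"
  "(vector [a, b, c, d, e] :: ('b::zero)^5) $ 3 = c"
  "(vector [a, b, c, d, e] :: ('b::zero)^5) $ 4 = d"
  "(vector [a, b, c, d, e] :: ('b::zero)^5) $ 5 = e"
  unfolding vector_def by simp_all

lemma h5_explicit: "h5 x y = x$1*y$1 + x$2*y$2 + x$3*y$3 - x$4*y$4 - x$5*y$5"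
  by (simp add: h5_def sum_5 sign5_def)

lemma range_emb: "range emb = {x \<in> light_cone. x$5 = x$1 + 1}"
proof (rule set_eqI, rule iffI)
  fix x assume "x \<in> range emb"
  then obtain y where x: "x = emb y" by blast
  have 1: "x$5 = x$1 + 1" by (simp add: x emb_def vector_5 field_simps)
  then have "x \<noteq> 0" by auto
  moreover have "h5 x x = 0"
    by (simp add: x emb_def h5_explicit vector_5 h3_def field_simps)
  ultimately show "x \<in> {x \<in> light_cone. x$5 = x$1 + 1}"
    using 1 by (simp add: light_cone_def)
next
  fix x assume "x \<in> {x \<in> light_cone. x$5 = x$1 + 1}"
  then have a: "h5 x x = 0" and b: "x$5 = x$1 + 1" by (auto simp: light_cone_def)
  have "x = emb (vector [x$2, x$3, x$4])"
    using a unfolding vec_eq_iff forall_5 h5_explicit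
    by (simp add: emb_def vector_5 h3_def b) (simp add: field_simps)
  then show "x \<in> range emb" by blast
qed

lemma h_hat_wedge: "h_hat (wedge a b) (wedge c d) = h5 a c * h5 b d - h5 a d * h5 b c"
  by (simp add: h_hat_def wedge_def h5_explicit sum_5 sign5_def) (simp add: field_simps)

lemma proj_S42_linear: "linear (proj_S42 x)"
  by (rule linearI)
    (simp_all add: proj_S42_def h5_explicit vec_eq_iff algebra_simps)

lemma wedge_linear_conj:
  assumes "linear f"
  shows "matrix f ** wedge a b ** transpose (matrix f) = wedge (f a) (f b)"
proof -
  have f: "f x = matrix f *v x" for x
    using assms by (simp add: matrix_works)
  have "(M ** wedge a b ** transpose M) $ i $ j = wedge (M *v a) (M *v b) $ i $ j" for M i j
  proof -
    have "(M ** wedge a b ** transpose M) $ i $ j =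
      (\<Sum>k\<in>UNIV. (\<Sum>l\<in>UNIV. M$i$l * (a$l * b$k - b$l * a$k)) * M$j$k)"
      by (simp add: matrix_matrix_mult_def transpose_def wedge_def)
    also have "\<dots> = wedge (M *v a) (M *v b) $ i $ j"
      by (simp add: wedge_def matrix_vector_mult_def sum_5) (simp add: algebra_simps)
    finally show ?thesis .
  qed
  then show ?thesis
    by (simp add: vec_eq_iff f[of a] f[of b])
qed

lemma wedge_bounded_bilinear: "bounded_bilinear wedge"
proof -
  have "bilinear wedge"
    unfolding bilinear_def
    by (auto intro!: linearI simp: wedge_def vec_eq_iff algebra_simps)
  then show ?thesis by (simp add: bilinear_conv_bounded_bilinear)
qed

lemma nabla_hat_wedge:
  assumes "differentiable_in c X p" "differentiable_in c Y p" "p \<in> fst c" "inj_on (snd c) (fst c)"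
    and "X p \<in> tangent_S42 (F p)" "Y p \<in> tangent_S42 (F p)"
  shows "nabla_hat F c a (\<lambda>q. wedge (X q) (Y q)) p =
    wedge (nabla F c a X p) (Y p) + wedge (X p) (nabla F c a Y p)"
proof -
  let ?P = "proj_S42 (F p)" and ?x = "snd c p"
  have D: "deriv_along c a (\<lambda>q. wedge (X q) (Y q)) p =
      wedge (X p) (deriv_along c a Y p) + wedge (deriv_along c a X p) (Y p)"
  proof -
    have "((\<lambda>x. wedge ((X \<circ> param c) x) ((Y \<circ> param c) x)) has_derivative
       (\<lambda>h. wedge ((X \<circ> param c) ?x) (frechet_derivative (Y \<circ> param c) (at ?x) h)
          + wedge (frechet_derivative (X \<circ> param c) (at ?x) h) ((Y \<circ> param c) ?x))) (at ?x)"
      by (rule bounded_bilinear.FDERIV[OF wedge_bounded_bilinear])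
        (use assms(1,2) in \<open>simp_all only: differentiable_in_def frechet_derivative_works\<close>)
    from frechet_derivative_at[OF this]
    have "frechet_derivative ((\<lambda>q. wedge (X q) (Y q)) \<circ> param c) (at ?x) =
       (\<lambda>h. wedge ((X \<circ> param c) ?x) (frechet_derivative (Y \<circ> param c) (at ?x) h)
          + wedge (frechet_derivative (X \<circ> param c) (at ?x) h) ((Y \<circ> param c) ?x))"
      by (simp add: o_def)
    then show ?thesis
      using assms(3,4) by (simp add: deriv_along_def)
  qed
  have id: "?P (X p) = X p" "?P (Y p) = Y p"
    using assms(5,6) by (simp_all add: proj_S42_def tangent_S42_def)
  have distrib: "(S + T) ** M = S ** M + T ** M" for S T M :: "real^5^5"
    by (simp add: vec_eq_iff matrix_matrix_mult_def sum.distrib distrib_right)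
  show ?thesis
    unfolding nabla_hat_def D nabla_def
    by (simp add: matrix_add_ldistrib distrib wedge_linear_conj[OF proj_S42_linear] id add.commute)
qed

end

theory Submission
  imports Defs
begin

text \<open>
  Write \<open>Y\<close> for the immersion with values in the light cone, \<open>r = e\<^sup>2\<^sup>\<lambda>\<close>, and \<open>P = (1, 0, 0, 0, 1)\<close>. The
  vector \<open>P\<close> is light-like, orthogonal to \<open>F\<close> and to \<open>Y\<^sub>u\<close>, \<open>Y\<^sub>v\<close>, and \<open>\<langle>P, Y\<rangle> = -1\<close>. Minimality gives
  \<open>F\<^sub>u = (m Y\<^sub>v - l Y\<^sub>u)/r\<close> and \<open>F\<^sub>v = (l Y\<^sub>v - m Y\<^sub>u)/r\<close>, with \<open>K = (m\<^sup>2 - l\<^sup>2)/r\<^sup>2\<close>. Hence \<open>Y\<^sub>u\<close>, \<open>Y\<^sub>v\<close> span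
  the tangent plane of \<open>F\<close> where \<open>K \<noteq> 0\<close>, so that \<open>\<nu> = P\<close> is constant and the lifts are
  \<open>(sgn K / \<surd>2) (Y\<^sub>u \<and> Y\<^sub>v / r + \<kappa> Y \<and> P)\<close> with a constant sign \<open>\<kappa>\<close>. Differentiating with the Gauss
  formulas, everything cancels except
  \<open>(sgn K / \<surd>2) (du - \<kappa> dv) \<otimes> P \<and> (Y\<^sub>v - \<kappa> Y\<^sub>u)\<close>, a decomposable bivector of two orthogonal
  light-like vectors. The formula for \<open>\<nabla>J\<close> is the same computation, since \<open>J\<close> is \<open>-\<surd>2\<close> times the
  skew endomorphism associated to the lift.
\<close>

section \<open>Frames of neutral signature\<close>

text \<open>The notions refer to an arbitrarily chosen chart (\<open>chart_at\<close>) and to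
  definite descriptions, while derivatives are taken in a given chart. Hence the normal, the
  curvature, \<nu> and the adapted frames have to be carried between charts; for the curvature this
  goes through the identity III = -K I of minimal surfaces, which involves no second derivative of a
  coordinate change. Moreover, nothing can be differentiated before its description is replaced by a
  closed formula on a whole neighbourhood. The lift depends only on the oriented tangent plane of F,
  so it can be written with Y_u and Y_v, which exist everywhere, and the factor sgn K is locally
  constant where K \<noteq> 0. The constant is \<kappa> = \<epsilon> oE oS: comparing a positive
  frame with the basis F, Y_u, Y, Y_v, P brings in both orientations. Where K < 0, the convention on
  the frames forces oS = -oE, hence \<kappa> = -\<epsilon>, and the null vector Y_v + \<epsilon> Y_u
  is proportional to \<open>\<xi>1\<close>.\<close>

lemma det_5:
  "det (A::'a::comm_ring_1^5^5) =
     A$1$1 * ((A$2$2*A$3$3 - A$2$3*A$3$2) * (A$4$4*A$5$5 - A$4$5*A$5$4)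
        - (A$2$2*A$3$4 - A$2$4*A$3$2) * (A$4$3*A$5$5 - A$4$5*A$5$3)
        + (A$2$2*A$3$5 - A$2$5*A$3$2) * (A$4$3*A$5$4 - A$4$4*A$5$3)
        + (A$2$3*A$3$4 - A$2$4*A$3$3) * (A$4$2*A$5$5 - A$4$5*A$5$2)
        - (A$2$3*A$3$5 - A$2$5*A$3$3) * (A$4$2*A$5$4 - A$4$4*A$5$2)
        + (A$2$4*A$3$5 - A$2$5*A$3$4) * (A$4$2*A$5$3 - A$4$3*A$5$2))
     - A$1$2 * ((A$2$1*A$3$3 - A$2$3*A$3$1) * (A$4$4*A$5$5 - A$4$5*A$5$4)
        - (A$2$1*A$3$4 - A$2$4*A$3$1) * (A$4$3*A$5$5 - A$4$5*A$5$3)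
        + (A$2$1*A$3$5 - A$2$5*A$3$1) * (A$4$3*A$5$4 - A$4$4*A$5$3)
        + (A$2$3*A$3$4 - A$2$4*A$3$3) * (A$4$1*A$5$5 - A$4$5*A$5$1)
        - (A$2$3*A$3$5 - A$2$5*A$3$3) * (A$4$1*A$5$4 - A$4$4*A$5$1)
        + (A$2$4*A$3$5 - A$2$5*A$3$4) * (A$4$1*A$5$3 - A$4$3*A$5$1))
     + A$1$3 * ((A$2$1*A$3$2 - A$2$2*A$3$1) * (A$4$4*A$5$5 - A$4$5*A$5$4)
        - (A$2$1*A$3$4 - A$2$4*A$3$1) * (A$4$2*A$5$5 - A$4$5*A$5$2)
        + (A$2$1*A$3$5 - A$2$5*A$3$1) * (A$4$2*A$5$4 - A$4$4*A$5$2)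
        + (A$2$2*A$3$4 - A$2$4*A$3$2) * (A$4$1*A$5$5 - A$4$5*A$5$1)
        - (A$2$2*A$3$5 - A$2$5*A$3$2) * (A$4$1*A$5$4 - A$4$4*A$5$1)
        + (A$2$4*A$3$5 - A$2$5*A$3$4) * (A$4$1*A$5$2 - A$4$2*A$5$1))
     - A$1$4 * ((A$2$1*A$3$2 - A$2$2*A$3$1) * (A$4$3*A$5$5 - A$4$5*A$5$3)
        - (A$2$1*A$3$3 - A$2$3*A$3$1) * (A$4$2*A$5$5 - A$4$5*A$5$2)
        + (A$2$1*A$3$5 - A$2$5*A$3$1) * (A$4$2*A$5$3 - A$4$3*A$5$2)
        + (A$2$2*A$3$3 - A$2$3*A$3$2) * (A$4$1*A$5$5 - A$4$5*A$5$1)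
        - (A$2$2*A$3$5 - A$2$5*A$3$2) * (A$4$1*A$5$3 - A$4$3*A$5$1)
        + (A$2$3*A$3$5 - A$2$5*A$3$3) * (A$4$1*A$5$2 - A$4$2*A$5$1))
     + A$1$5 * ((A$2$1*A$3$2 - A$2$2*A$3$1) * (A$4$3*A$5$4 - A$4$4*A$5$3)
        - (A$2$1*A$3$3 - A$2$3*A$3$1) * (A$4$2*A$5$4 - A$4$4*A$5$2)
        + (A$2$1*A$3$4 - A$2$4*A$3$1) * (A$4$2*A$5$3 - A$4$3*A$5$2)
        + (A$2$2*A$3$3 - A$2$3*A$3$2) * (A$4$1*A$5$4 - A$4$4*A$5$1)
        - (A$2$2*A$3$4 - A$2$4*A$3$2) * (A$4$1*A$5$3 - A$4$3*A$5$1)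
        + (A$2$3*A$3$4 - A$2$4*A$3$3) * (A$4$1*A$5$2 - A$4$2*A$5$1))"
proof -
  have f1: "finite {2::5, 3, 4, 5}" "1 \<notin> {2::5, 3, 4, 5}" by auto
  have f2: "finite {3::5, 4, 5}" "2 \<notin> {3::5, 4, 5}" by auto
  have f3: "finite {4::5, 5}" "3 \<notin> {4::5, 5}" by auto
  have f4: "finite {5::5}" "4 \<notin> {5::5}" by auto
  \<comment> \<open>The sum over permutations is built up one index at a time. The stated form uses
    the cofactors of the first row, each expanded by 2x2 minors of rows 2, 3 and of rows 4,
    5.\<close>
  show ?thesis
    unfolding det_def UNIV_5
    unfolding sum_over_permutations_insert[OF f1]
    unfolding sum_over_permutations_insert[OF f2]
    unfolding sum_over_permutations_insert[OF f3]
    unfolding sum_over_permutations_insert[OF f4]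
    unfolding permutes_sing
    by (simp add: sign_swap_id permutation_swap_id permutation_compose sign_compose sign_id swap_id_eq
        algebra_simps)
qed

section \<open>Bilinear algebra of the two metrics\<close>

lemma det_nonzero_kernel:
  fixes M :: "real^'n^'n"
  assumes "det M \<noteq> 0" "M *v x = 0"
  shows "x = 0"
  using assms by (metis invertible_det_nz invertible_def matrix_left_invertible_ker)

lemma bounded_bilinear_h3: "bounded_bilinear h3"
proof -
  have "bilinear h3"
    unfolding bilinear_def by (auto intro!: linearI simp: h3_def algebra_simps)
  then show ?thesis by (simp add: bilinear_conv_bounded_bilinear)
qed

lemma bounded_bilinear_h5: "bounded_bilinear h5"
proof -
  have "bilinear h5"
    unfolding bilinear_def by (auto intro!: linearI simp: h5_explicit algebra_simps)
  then show ?thesis by (simp add: bilinear_conv_bounded_bilinear)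
qed

lemmas h3_simps =
  bounded_bilinear.add_left[OF bounded_bilinear_h3] bounded_bilinear.add_right[OF bounded_bilinear_h3]
  bounded_bilinear.diff_left[OF bounded_bilinear_h3] bounded_bilinear.diff_right[OF bounded_bilinear_h3]
  bounded_bilinear.minus_left[OF bounded_bilinear_h3] bounded_bilinear.minus_right[OF bounded_bilinear_h3]
  bounded_bilinear.scaleR_left[OF bounded_bilinear_h3] bounded_bilinear.scaleR_right[OF bounded_bilinear_h3]

lemmas h5_simps =
  bounded_bilinear.add_left[OF bounded_bilinear_h5] bounded_bilinear.add_right[OF bounded_bilinear_h5]
  bounded_bilinear.diff_left[OF bounded_bilinear_h5] bounded_bilinear.diff_right[OF bounded_bilinear_h5]
  bounded_bilinear.minus_left[OF bounded_bilinear_h5] bounded_bilinear.minus_right[OF bounded_bilinear_h5]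
  bounded_bilinear.scaleR_left[OF bounded_bilinear_h5] bounded_bilinear.scaleR_right[OF bounded_bilinear_h5]

lemmas wedge_simps =
  bounded_bilinear.add_left[OF wedge_bounded_bilinear] bounded_bilinear.add_right[OF wedge_bounded_bilinear]
  bounded_bilinear.diff_left[OF wedge_bounded_bilinear] bounded_bilinear.diff_right[OF wedge_bounded_bilinear]
  bounded_bilinear.minus_left[OF wedge_bounded_bilinear] bounded_bilinear.minus_right[OF wedge_bounded_bilinear]
  bounded_bilinear.scaleR_left[OF wedge_bounded_bilinear] bounded_bilinear.scaleR_right[OF wedge_bounded_bilinear]

lemma h3_commute: "h3 a b = h3 b a"
  by (simp add: h3_def algebra_simps)

lemma h5_commute: "h5 a b = h5 b a"
  by (simp add: h5_explicit algebra_simps)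

lemma wedge_self [simp]: "wedge a a = 0"
  by (simp add: wedge_def vec_eq_iff)

lemma wedge_swap: "wedge a b = - wedge b a"
  by (simp add: wedge_def vec_eq_iff)

text \<open>Flipping the sign of the time-like coordinate turns the pairings into the product with
  the matrix of rows \<open>a\<close>, \<open>b\<close>, \<open>c\<close>, so a vector orthogonal to
  a basis lies in a trivial kernel.\<close>

lemma h3_eq_0_if_det_nonzero:
  assumes "det (vector [a, b, c] :: real^3^3) \<noteq> 0" "h3 a w = 0" "h3 b w = 0" "h3 c w = 0"
  shows "w = 0"
proof -
  have "(vector [a, b, c] :: real^3^3) *v (vector [w$1, w$2, - w$3]) = 0"
    using assms(2-4)
    by (simp add: vec_eq_iff forall_3 matrix_vector_mult_def sum_3 h3_def)
  from det_nonzero_kernel[OF assms(1) this] show "w = 0"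
    by (simp add: vec_eq_iff forall_3)
qed

text \<open>Index lowering by the metric: a bivector is stored with two upper indices and has to act
  through this map in order to become the skew endomorphism associated to it.\<close>

definition lower5 :: "real^5 \<Rightarrow> real^5" where
  "lower5 y = (\<chi> i. sign5 i * y$i)"

lemma linear_lower5: "linear lower5"
  by (rule linearI) (simp_all add: lower5_def vec_eq_iff algebra_simps)

lemma wedge_lower5: "wedge a b *v lower5 y = h5 b y *\<^sub>R a - h5 a y *\<^sub>R b"
  by (simp add: vec_eq_iff matrix_vector_mult_def wedge_def lower5_def sum_5 h5_explicit forall_5 sign5_def)
    (simp add: algebra_simps)

lemma h5_eq_0_if_det_nonzero:
  assumes "det (vector [a, b, c, d, e] :: real^5^5) \<noteq> 0"
    "h5 a w = 0" "h5 b w = 0" "h5 c w = 0" "h5 d w = 0" "h5 e w = 0"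
  shows "w = 0"
proof -
  have "(vector [a, b, c, d, e] :: real^5^5) *v lower5 w = 0"
    using assms(2-6)
    by (simp add: vec_eq_iff forall_5 matrix_vector_mult_def sum_5 h5_explicit lower5_def sign5_def vector_5)
  from det_nonzero_kernel[OF assms(1) this] show "w = 0"
    by (simp add: vec_eq_iff forall_5 lower5_def sign5_def)
qed

section \<open>Pseudo-orthonormal frames and their dual frames\<close>

text \<open>The frame spans only the tangent space. Together with \<open>x\<close>, to which both
  sides are orthogonal, it is a basis of the whole space, and the difference of the two sides is
  orthogonal to all five vectors.\<close>

lemma pos_frame_expand:
  assumes "pos_frame oS x e1 e2 e3 e4" "y \<in> tangent_S42 x"
  shows "y = h5 e1 y *\<^sub>R e1 + h5 e2 y *\<^sub>R e2 - h5 e3 y *\<^sub>R e3 - h5 e4 y *\<^sub>R e4" (is "y = ?z")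
proof -
  have "det (vector [x, e1, e2, e3, e4] :: real^5^5) \<noteq> 0"
    using assms(1) by (auto simp: pos_frame_def pos_oriented_def)
  then have "y - ?z = 0"
    using assms
    by (rule_tac h5_eq_0_if_det_nonzero[of x e1 e2 e3 e4])
      (auto simp: pos_frame_def tangent_S42_def h5_simps h5_commute)
  then show ?thesis by simp
qed

lemma pos_frame_independent:
  assumes "pos_frame oS x e1 e2 e3 e4"
  shows "independent {e1, e2, e3, e4}" "distinct [e1, e2, e3, e4]"
proof -
  have g: "h5 e1 e1 = 1" "h5 e2 e2 = 1" "h5 e3 e3 = -1" "h5 e4 e4 = -1"
     "h5 e1 e2 = 0" "h5 e1 e3 = 0" "h5 e1 e4 = 0" "h5 e2 e3 = 0" "h5 e2 e4 = 0" "h5 e3 e4 = 0"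
    using assms by (auto simp: pos_frame_def)
  show d: "distinct [e1, e2, e3, e4]"
    using g by (simp, metis zero_neq_neg_one zero_neq_one)
  show "independent {e1, e2, e3, e4}"
  proof (rule independent_if_scalars_zero)
    show "finite {e1, e2, e3, e4}" by simp
  next
    fix f v assume s: "(\<Sum>x\<in>{e1, e2, e3, e4}. f x *\<^sub>R x) = 0" and v: "v \<in> {e1, e2, e3, e4}"
    have e: "f e1 *\<^sub>R e1 + f e2 *\<^sub>R e2 + f e3 *\<^sub>R e3 + f e4 *\<^sub>R e4 = 0" (is "?s = 0")
      using s d by (simp add: add.assoc)
    have "h5 e1 ?s = f e1" "h5 e2 ?s = f e2" "h5 e3 ?s = - f e3" "h5 e4 ?s = - f e4"
      using g by (simp_all add: h5_simps h5_commute)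
    then show "f v = 0"
      using v unfolding e by (auto simp: h5_explicit)
  qed
qed

text \<open>Turns the dual frame into pairings with the metric; the minus signs come from the
  time-like vectors. Through this, \<open>\<theta>1\<close> and \<open>\<theta>2\<close> become the
  metric duals of \<open>\<xi>1\<close> and \<open>\<xi>2\<close>.\<close>

lemma pos_frame_representation:
  assumes fr: "pos_frame oS x e1 e2 e3 e4" and y: "y \<in> tangent_S42 x"
  shows "representation {e1, e2, e3, e4} y e1 = h5 e1 y"
    "representation {e1, e2, e3, e4} y e2 = h5 e2 y"
    "representation {e1, e2, e3, e4} y e3 = - h5 e3 y"
    "representation {e1, e2, e3, e4} y e4 = - h5 e4 y"
proof -
  note i = pos_frame_independent[OF fr]
  let ?c = "\<lambda>v. if v = e1 then h5 e1 y else if v = e2 then h5 e2 y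
      else if v = e3 then - h5 e3 y else if v = e4 then - h5 e4 y else 0"
  have s: "(\<Sum>v\<in>{e1, e2, e3, e4}. ?c v *\<^sub>R v) = y"
  proof -
    have "(\<Sum>v\<in>{e1, e2, e3, e4}. ?c v *\<^sub>R v) =
        h5 e1 y *\<^sub>R e1 + h5 e2 y *\<^sub>R e2 - h5 e3 y *\<^sub>R e3 - h5 e4 y *\<^sub>R e4"
      using i(2) by (auto simp: algebra_simps)
    then show ?thesis using pos_frame_expand[OF fr y] by simp
  qed
  have "representation {e1, e2, e3, e4} y = ?c"
  proof (rule representation_eqI[OF i(1)])
    show "y \<in> span {e1, e2, e3, e4}"
      by (subst s[symmetric]) (intro span_sum span_scale span_base)
    show "\<And>b. ?c b \<noteq> 0 \<Longrightarrow> b \<in> {e1, e2, e3, e4}" by (auto split: if_splits)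
    show "finite {b. ?c b \<noteq> 0}" by (rule finite_subset[of _ "{e1, e2, e3, e4}"]) (auto split: if_splits)
    have "{b. ?c b \<noteq> 0} \<subseteq> {e1, e2, e3, e4}" by (auto split: if_splits)
    then have "(\<Sum>b | ?c b \<noteq> 0. ?c b *\<^sub>R b) = (\<Sum>v\<in>{e1, e2, e3, e4}. ?c v *\<^sub>R v)"
      by (intro sum.mono_neutral_left) auto
    then show "(\<Sum>b | ?c b \<noteq> 0. ?c b *\<^sub>R b) = y" using s by simp
  qed
  then show "representation {e1, e2, e3, e4} y e1 = h5 e1 y"
    "representation {e1, e2, e3, e4} y e2 = h5 e2 y"
    "representation {e1, e2, e3, e4} y e3 = - h5 e3 y"
    "representation {e1, e2, e3, e4} y e4 = - h5 e4 y"
    using i(2) by auto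
qed

lemma h_hat_add: "h_hat (S + T) (S + T) = h_hat S S + 2 * h_hat S T + h_hat T T"
  by (simp add: h_hat_def sum_5 algebra_simps)

lemma h_hat_scale: "h_hat (a *\<^sub>R S) (b *\<^sub>R T) = a * b * h_hat S T"
  by (simp add: h_hat_def sum_distrib_left algebra_simps)

text \<open>The planes of \<open>e1\<close>, \<open>e3\<close> and of \<open>e4\<close>,
  \<open>e2\<close> are orthogonal and of mixed signature, so each wedge has norm -1, and the factor
  \<open>1 / sqrt 2\<close> halves the sum.\<close>

lemma Omega2_U_minus:
  assumes "pos_frame oS x e1 e2 e3 e4" "\<epsilon> \<in> {1, -1}"
  shows "Omega2 \<epsilon> e1 e2 e3 e4 \<in> U_minus oS \<epsilon> x"
proof -
  have "Omega2 \<epsilon> e1 e2 e3 e4 \<in> wedge2 oS \<epsilon> x"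
    unfolding wedge2_def using assms(1) by (fast intro: span_base)
  moreover have "h_hat (Omega2 \<epsilon> e1 e2 e3 e4) (Omega2 \<epsilon> e1 e2 e3 e4) = -1"
  proof -
    have e: "Omega2 \<epsilon> e1 e2 e3 e4 = (1 / sqrt 2) *\<^sub>R (1 *\<^sub>R wedge e1 e3 + \<epsilon> *\<^sub>R wedge e4 e2)"
      by (simp add: Omega2_def)
    show ?thesis
      unfolding e h_hat_scale h_hat_add
      using assms by (auto simp: pos_frame_def h_hat_scale h_hat_wedge h5_commute)
  qed
  ultimately show ?thesis by (simp add: U_minus_def)
qed

text \<open>
  As \<open>(a \<and> b) (lower5 y) = h(b, y) a - h(a, y) b\<close>, the paracomplex structure is, up to a factor, the
  skew endomorphism that the metric associates to the bivector; in particular it does not depend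
  on the frame.
\<close>

lemma para_structure_eq:
  assumes fr: "pos_frame oS x e1 e2 e3 e4" and T: "T = Omega2 \<epsilon> e1 e2 e3 e4"
    and y: "y \<in> tangent_S42 x"
  shows "para_structure oS \<epsilon> x T y = - sqrt 2 *\<^sub>R (T *v lower5 y)"
proof -
  have key: "z = - sqrt 2 *\<^sub>R (T *v lower5 y)"
    if "pos_frame oS x f1 f2 f3 f4" "T = Omega2 \<epsilon> f1 f2 f3 f4"
      "y = a1 *\<^sub>R f1 + a2 *\<^sub>R f2 + a3 *\<^sub>R f3 + a4 *\<^sub>R f4"
      "z = a1 *\<^sub>R f3 + a2 *\<^sub>R (- \<epsilon> *\<^sub>R f4) + a3 *\<^sub>R f1 + a4 *\<^sub>R (- \<epsilon> *\<^sub>R f2)"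
    for z f1 f2 f3 f4 a1 a2 a3 a4
  proof -
    have g: "h5 f1 f1 = 1" "h5 f2 f2 = 1" "h5 f3 f3 = -1" "h5 f4 f4 = -1"
       "h5 f1 f2 = 0" "h5 f1 f3 = 0" "h5 f1 f4 = 0" "h5 f2 f3 = 0" "h5 f2 f4 = 0" "h5 f3 f4 = 0"
      using that(1) by (auto simp: pos_frame_def)
    have "sqrt 2 *\<^sub>R (T *v lower5 y) = (wedge f1 f3 *v lower5 y) + \<epsilon> *\<^sub>R (wedge f4 f2 *v lower5 y)"
      by (simp add: that(2) Omega2_def scaleR_matrix_vector_assoc[symmetric] matrix_vector_mult_add_rdistrib)
    also have "\<dots> = - z"
      using g unfolding wedge_lower5 that(3,4)
      by (simp add: h5_simps h5_commute[of f2 f1] h5_commute[of f3 f1] h5_commute[of f4 f1]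
          h5_commute[of f3 f2] h5_commute[of f4 f2] h5_commute[of f4 f3] algebra_simps)
    finally show ?thesis by simp
  qed
  have "y = h5 e1 y *\<^sub>R e1 + h5 e2 y *\<^sub>R e2 + (- h5 e3 y) *\<^sub>R e3 + (- h5 e4 y) *\<^sub>R e4"
    using pos_frame_expand[OF fr y] by simp
  then have ex: "\<exists>z e1 e2 e3 e4 a1 a2 a3 a4.
     pos_frame oS x e1 e2 e3 e4 \<and> T = Omega2 \<epsilon> e1 e2 e3 e4 \<and>
     y = a1 *\<^sub>R e1 + a2 *\<^sub>R e2 + a3 *\<^sub>R e3 + a4 *\<^sub>R e4 \<and>
     z = a1 *\<^sub>R e3 + a2 *\<^sub>R (- \<epsilon> *\<^sub>R e4) + a3 *\<^sub>R e1 + a4 *\<^sub>R (- \<epsilon> *\<^sub>R e2)"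
    using fr T by blast
  show ?thesis
    unfolding para_structure_def
    apply (rule the1I2)
     apply (rule ex_ex1I[OF ex])
     apply (metis key)
    apply (metis key)
    done
qed

section \<open>Frames with a tangent pair and a null normal pair\<close>

text \<open>The rows are \<open>F\<close>, \<open>V\<close>, \<open>Y\<close>, \<open>W\<close>, \<open>P\<close> of the locale \<open>null_frame\<close> below.\<close>

lemma det_null_frame:
  "det (vector [vector [t, n1, n2, n3, t], vector [x, a1, a2, a3, x],
     vector [(N - 1)/2, y1, y2, y3, (N + 1)/2], vector [y, b1, b2, b3, y], vector [1, 0, 0, 0, 1]] :: real^5^5)
   = - det (vector [vector [a1, a2, a3], vector [b1, b2, b3], vector [n1, n2, n3]] :: real^3^3)"
  unfolding det_5 det_3 vector_5 vector_3 by (simp add: algebra_simps add_divide_distrib diff_divide_distrib)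

text \<open>
  In the application \<open>F\<close> is the conformal Gauss map, \<open>Y\<close> the immersion with values in the light cone,
  \<open>V\<close> and \<open>W\<close> are the derivatives of \<open>Y\<close> in \<open>u\<close> and \<open>v\<close>, and \<open>P\<close> is \<open>\<nu>\<close>. Where \<open>K \<noteq> 0\<close>, the
  vectors \<open>V\<close>, \<open>W\<close> span the same plane as the derivatives of \<open>F\<close>.
\<close>

locale null_frame =
  fixes F V W Y P :: "real^5" and r oE :: real
  assumes r_pos: "r > 0" and oE: "oE \<in> {1, -1}"
    and gram: "h5 F F = 1" "h5 V V = r" "h5 W W = - r" "h5 Y Y = 0" "h5 P P = 0" "h5 Y P = -1"
      "h5 F V = 0" "h5 F W = 0" "h5 F Y = 0" "h5 F P = 0"
      "h5 V W = 0" "h5 V Y = 0" "h5 V P = 0" "h5 W Y = 0" "h5 W P = 0"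
    and det_neg: "oE * det (vector [F, V, Y, W, P] :: real^5^5) < 0"
begin

lemma gram': "h5 V F = 0" "h5 W F = 0" "h5 Y F = 0" "h5 P F = 0"
  "h5 W V = 0" "h5 Y V = 0" "h5 P V = 0" "h5 Y W = 0" "h5 P W = 0" "h5 P Y = -1"
  using gram by (simp_all add: h5_commute)

text \<open>\<open>Y\<close> and \<open>P\<close> are null and pair to -1 with each other, so the
  coefficient of \<open>Y\<close> is read off by \<open>P\<close> and conversely, both with a minus
  sign.\<close>

lemma expand:
  "y = h5 F y *\<^sub>R F + (h5 V y / r) *\<^sub>R V - (h5 W y / r) *\<^sub>R W - h5 P y *\<^sub>R Y - h5 Y y *\<^sub>R P" (is "y = ?z")
proof -
  have "y - ?z = 0"
    using det_neg r_pos
    by (intro h5_eq_0_if_det_nonzero[of F V Y W P]) (auto simp: h5_simps gram gram')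
  then show ?thesis by simp
qed

lemma det_frame:
  "det (vector [F, a1 *\<^sub>R V + a2 *\<^sub>R W, c1 *\<^sub>R Y + c2 *\<^sub>R P, b1 *\<^sub>R V + b2 *\<^sub>R W, d1 *\<^sub>R Y + d2 *\<^sub>R P] :: real^5^5) =
   (a1 * b2 - a2 * b1) * (c1 * d2 - c2 * d1) * det (vector [F, V, Y, W, P] :: real^5^5)"
proof -
  let ?B = "vector [vector [1, 0, 0, 0, 0], vector [0, a1, 0, a2, 0], vector [0, 0, c1, 0, c2],
     vector [0, b1, 0, b2, 0], vector [0, 0, d1, 0, d2]] :: real^5^5"
  have "vector [F, a1 *\<^sub>R V + a2 *\<^sub>R W, c1 *\<^sub>R Y + c2 *\<^sub>R P, b1 *\<^sub>R V + b2 *\<^sub>R W, d1 *\<^sub>R Y + d2 *\<^sub>R P]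
      = ?B ** vector [F, V, Y, W, P]"
    by (simp add: vec_eq_iff forall_5 matrix_matrix_mult_def sum_5 vector_5)
  moreover have "det ?B = (a1 * b2 - a2 * b1) * (c1 * d2 - c2 * d1)"
    unfolding det_5 vector_5 by (simp add: algebra_simps)
  ultimately show ?thesis by (simp add: det_mul)
qed

text \<open>\<open>s\<close> is the orientation of the tangent pair relative to (\<open>V\<close>,
  \<open>W\<close>). The product \<open>oE * oS\<close> is the sign by which a positive frame then
  orients the normal plane relative to (\<open>Y\<close>, \<open>P\<close>).\<close>

definition lift :: "real \<Rightarrow> real \<Rightarrow> real \<Rightarrow> real^5^5" where
  "lift oS \<epsilon> s = (s / sqrt 2) *\<^sub>R ((1 / r) *\<^sub>R wedge V W + (\<epsilon> * oE * oS) *\<^sub>R wedge Y P)"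

text \<open>The wedge of an orthonormal pair is determined by its plane up to sign. For the tangent
  plane \<open>s\<close> prescribes the sign; for the normal plane positivity of the frame then
  fixes it, and no trace of the chosen frame remains.\<close>

lemma Omega2_adapted:
  assumes fr: "pos_frame oS F e1 e2 e3 e4"
    and e1: "e1 = a1 *\<^sub>R V + a2 *\<^sub>R W" and e3: "e3 = b1 *\<^sub>R V + b2 *\<^sub>R W"
    and normal: "h5 V e2 = 0" "h5 W e2 = 0" "h5 V e4 = 0" "h5 W e4 = 0"
    and s: "s \<in> {1, -1}" "s * (a1 * b2 - a2 * b1) > 0" and oS: "oS \<in> {1, -1}"
  shows "Omega2 \<epsilon> e1 e2 e3 e4 = lift oS \<epsilon> s"
proof -
  have tan: "h5 F e2 = 0" "h5 F e4 = 0"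
    using fr by (auto simp: pos_frame_def tangent_S42_def)
  define c1 c2 d1 d2 where "c1 = - h5 P e2" and "c2 = - h5 Y e2" and "d1 = - h5 P e4" and "d2 = - h5 Y e4"
  have e2: "e2 = c1 *\<^sub>R Y + c2 *\<^sub>R P" and e4: "e4 = d1 *\<^sub>R Y + d2 *\<^sub>R P"
    using expand[of e2] expand[of e4] normal tan by (simp_all add: c1_def c2_def d1_def d2_def)
  define D where "D = a1 * b2 - a2 * b1"
  define R where "R = d1 * c2 - d2 * c1"
  have "h5 e1 e1 = 1" "h5 e3 e3 = -1" "h5 e1 e3 = 0" "h5 e2 e2 = 1" "h5 e4 e4 = -1" "h5 e2 e4 = 0"
    using fr by (auto simp: pos_frame_def)
  then have g: "r * (a1 * a1 - a2 * a2) = 1" "r * (b1 * b1 - b2 * b2) = -1" "r * (a1 * b1 - a2 * b2) = 0"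
     "2 * c1 * c2 = -1" "2 * d1 * d2 = 1" "c1 * d2 + c2 * d1 = 0"
    unfolding e1 e2 e3 e4 by (simp_all add: h5_simps gram gram' algebra_simps)
  \<comment> \<open>Lagrange identity: the left side is minus the Gram determinant of
    \<open>e1\<close>, \<open>e3\<close>, which is -1 for an orthonormal pair of mixed
    signature.\<close>
  have "(r * D)\<^sup>2 = (r * (a1 * b1 - a2 * b2))\<^sup>2 - (r * (a1 * a1 - a2 * a2)) * (r * (b1 * b1 - b2 * b2))"
    by (simp add: D_def power2_eq_square algebra_simps)
  then have "(r * D)\<^sup>2 = 1" using g(1-3) by simp
  then have "(r * D) = 1 \<or> r * D = -1" by (simp add: power2_eq_1_iff)
  moreover have "s * (r * D) > 0"
    using s(2) r_pos by (simp add: D_def mult.left_commute)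
  ultimately have "r * D = s" using s(1) by auto
  then have D: "D = s / r" using r_pos by (simp add: field_simps)
  \<comment> \<open>The same identity for the normal pair, in a null basis where the squared norm is
    minus twice the product of the two coefficients.\<close>
  have "R\<^sup>2 = (c1 * d2 + c2 * d1)\<^sup>2 - (2 * c1 * c2) * (2 * d1 * d2)"
    by (simp add: R_def power2_eq_square algebra_simps)
  then have "R\<^sup>2 = 1" using g(4-6) by simp
  then have R1: "R = 1 \<or> R = -1" by (simp add: power2_eq_1_iff)
  \<comment> \<open>The minus sign appears because \<open>R\<close> belongs to the order
    \<open>e4\<close>, \<open>e2\<close>, as in \<open>Omega2\<close>, while the frame has
    \<open>e2\<close> before \<open>e4\<close>.\<close>
  have "oS * (D * (- R) * det (vector [F, V, Y, W, P] :: real^5^5)) > 0"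
  proof -
    have "oS * det (vector [F, e1, e2, e3, e4] :: real^5^5) > 0"
      using fr by (simp add: pos_frame_def pos_oriented_def)
    then show ?thesis
      unfolding e1 e2 e3 e4 det_frame by (simp add: D_def R_def mult.commute)
  qed
  then have R: "R = s * oS * oE"
    using R1 s(1) oS oE det_neg r_pos unfolding D
    by (auto simp: zero_less_mult_iff mult_less_0_iff zero_less_divide_iff divide_less_0_iff)
  have w1: "wedge e1 e3 = D *\<^sub>R wedge V W"
    unfolding e1 e3 D_def by (simp add: wedge_simps wedge_swap[of W V] algebra_simps)
  have w2: "wedge e4 e2 = R *\<^sub>R wedge Y P"
    unfolding e2 e4 R_def by (simp add: wedge_simps wedge_swap[of P Y] algebra_simps)
  show ?thesis
    unfolding Omega2_def lift_def w1 w2 D R by (simp add: algebra_simps)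
qed

text \<open>Serves to show that the description of the lift is not vacuous. The sign
  \<open>s\<close> in the third vector realizes the tangent orientation, and the factor
  \<open>s * oS * oE\<close> in the fourth repairs the orientation of the whole frame.\<close>

lemma ex_pos_frame:
  assumes s: "s \<in> {1, -1}" and oS: "oS \<in> {1, -1}"
  shows "pos_frame oS F ((1 / sqrt r) *\<^sub>R V) ((1 / sqrt 2) *\<^sub>R (P - Y)) ((s / sqrt r) *\<^sub>R W)
     ((s * oS * oE / sqrt 2) *\<^sub>R (P + Y))"
proof -
  have q: "sqrt r * sqrt r = r" using r_pos by simp
  have e2: "(1 / sqrt 2) *\<^sub>R (P - Y) = (- (1 / sqrt 2)) *\<^sub>R Y + (1 / sqrt 2) *\<^sub>R P"
    and e4: "(s * oS * oE / sqrt 2) *\<^sub>R (P + Y) = (s * oS * oE / sqrt 2) *\<^sub>R Y + (s * oS * oE / sqrt 2) *\<^sub>R P"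
    by (simp_all add: algebra_simps)
  have det: "det (vector [F, (1 / sqrt r) *\<^sub>R V, (1 / sqrt 2) *\<^sub>R (P - Y), (s / sqrt r) *\<^sub>R W,
      (s * oS * oE / sqrt 2) *\<^sub>R (P + Y)] :: real^5^5)
    = (1 / sqrt r * (s / sqrt r) - 0) * (- (1 / sqrt 2) * (s * oS * oE / sqrt 2)
       - (1 / sqrt 2) * (s * oS * oE / sqrt 2)) * det (vector [F, V, Y, W, P] :: real^5^5)"
    unfolding e2 e4
    using det_frame[of "1 / sqrt r" 0 "- (1 / sqrt 2)" "1 / sqrt 2" 0 "s / sqrt r"
        "s * oS * oE / sqrt 2" "s * oS * oE / sqrt 2"] by simp
  have "oS * \<dots> = (1 / r) * (- (oE * det (vector [F, V, Y, W, P] :: real^5^5)))"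
    using s oS q r_pos by (auto simp: field_simps)
  also have "\<dots> > 0"
    using det_neg r_pos by (intro mult_pos_pos) auto
  finally have "pos_oriented oS F ((1 / sqrt r) *\<^sub>R V) ((1 / sqrt 2) *\<^sub>R (P - Y)) ((s / sqrt r) *\<^sub>R W)
     ((s * oS * oE / sqrt 2) *\<^sub>R (P + Y))"
    unfolding pos_oriented_def det .
  then show ?thesis
    using s oS oE r_pos q
    by (auto simp: pos_frame_def tangent_S42_def h5_simps gram gram' field_simps)
qed

text \<open>Orthogonality leaves a combination of \<open>Y\<close> and \<open>P\<close>, the product
  with \<open>Y\<close> fixes the coefficient of \<open>P\<close>, and being null then excludes a
  component along \<open>Y\<close>.\<close>

lemma null_normal_unique:
  assumes "h5 F n = 0" "h5 V n = 0" "h5 W n = 0" "h5 n n = 0" "h5 n Y = -1"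
  shows "n = P"
proof -
  have n: "n = (- h5 P n) *\<^sub>R Y + P"
    using expand[of n] assms by (simp add: h5_commute[of Y n])
  have "h5 n n = 2 * h5 P n"
    by (subst (1 2) n) (simp add: h5_simps gram gram')
  then show ?thesis using n assms(4) by simp
qed

end

section \<open>Partial derivatives\<close>

abbreviation partial :: "2 \<Rightarrow> (real^2 \<Rightarrow> 'b::real_normed_vector) \<Rightarrow> real^2 \<Rightarrow> 'b" where
  "partial i g x \<equiv> frechet_derivative g (at x) (axis i 1)"

lemma frechet_derivative_partial:
  fixes g :: "real^2 \<Rightarrow> 'b::real_normed_vector"
  assumes "g differentiable (at x)"
  shows "frechet_derivative g (at x) a = a$1 *\<^sub>R partial 1 g x + a$2 *\<^sub>R partial 2 g x"
proof -
  interpret linear "frechet_derivative g (at x)"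
    using linear_frechet_derivative[OF assms] .
  have "a = a$1 *\<^sub>R axis 1 1 + a$2 *\<^sub>R axis 2 1"
    by (simp add: vec_eq_iff forall_2 axis_def)
  then show ?thesis by (metis add scaleR)
qed

text \<open>No differentiability is involved: \<open>frechet_derivative\<close> chooses among the
  possible derivatives, and these depend only on the germ of the function.\<close>

lemma frechet_derivative_cong_open:
  assumes "open U" "x \<in> U" "\<And>y. y \<in> U \<Longrightarrow> g y = k y"
  shows "frechet_derivative g (at x) = frechet_derivative k (at x)"
proof -
  have "(g has_derivative D) (at x) \<longleftrightarrow> (k has_derivative D) (at x)" for D
    using assms has_derivative_transform_within_open[of _ _ x UNIV U] by metis
  then show ?thesis by (simp add: frechet_derivative_def)
qed

lemma differentiable_cong_open:
  assumes "open U" "x \<in> U" "\<And>y. y \<in> U \<Longrightarrow> g y = k y"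
  shows "g differentiable (at x) \<longleftrightarrow> k differentiable (at x)"
  unfolding differentiable_def
  using assms has_derivative_transform_within_open[of _ _ x UNIV U] by metis

lemma differentiable_bilinear:
  assumes "bounded_bilinear h" "g differentiable (at x)" "k differentiable (at x)"
  shows "(\<lambda>y. h (g y) (k y)) differentiable (at x)"
  using assms bounded_bilinear.FDERIV[OF assms(1)] unfolding differentiable_def by blast

lemma frechet_derivative_bilinear:
  assumes "bounded_bilinear h" "g differentiable (at x)" "k differentiable (at x)"
  shows "frechet_derivative (\<lambda>y. h (g y) (k y)) (at x) a =
    h (g x) (frechet_derivative k (at x) a) + h (frechet_derivative g (at x) a) (k x)"
  using frechet_derivative_at[OF bounded_bilinear.FDERIV[OF assms(1) assms(2,3)[unfolded frechet_derivative_works]]]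
  by metis

lemma frechet_derivative_bounded_linear:
  assumes "bounded_linear L" "g differentiable (at x)"
  shows "frechet_derivative (\<lambda>y. L (g y)) (at x) a = L (frechet_derivative g (at x) a)"
  using frechet_derivative_at[OF bounded_linear.has_derivative[OF assms(1) assms(2)[unfolded frechet_derivative_works]]]
  by metis

lemma frechet_derivative_add:
  assumes "g differentiable (at x)" "k differentiable (at x)"
  shows "frechet_derivative (\<lambda>y. g y + k y) (at x) a = frechet_derivative g (at x) a + frechet_derivative k (at x) a"
  using frechet_derivative_at[OF has_derivative_add[OF assms[unfolded frechet_derivative_works]]] by metis

lemma frechet_derivative_minus:
  assumes "g differentiable (at x)"
  shows "frechet_derivative (\<lambda>y. - g y) (at x) a = - frechet_derivative g (at x) a"
  using frechet_derivative_at[OF has_derivative_minus[OF assms[unfolded frechet_derivative_works]]] by metis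

lemma frechet_derivative_inverse:
  fixes g :: "'b::real_normed_vector \<Rightarrow> real"
  assumes "g differentiable (at x)" "g x \<noteq> 0"
  shows "frechet_derivative (\<lambda>y. 1 / g y) (at x) a = - frechet_derivative g (at x) a / (g x)\<^sup>2"
proof -
  have "((\<lambda>y. inverse (g y)) has_derivative (\<lambda>h. - (inverse (g x) * frechet_derivative g (at x) h * inverse (g x)))) (at x)"
    using Deriv.has_derivative_inverse[of g x "frechet_derivative g (at x)" UNIV] assms
    by (simp add: frechet_derivative_works)
  from frechet_derivative_at[OF this] show ?thesis
    by (simp add: inverse_eq_divide power2_eq_square fun_eq_iff)
qed

section \<open>Symmetry of mixed partial derivatives\<close>

text \<open>The second difference is symmetric in \<open>i\<close> and \<open>j\<close>. The mean
  value theorem in direction \<open>i\<close>, then in direction \<open>j\<close>, turns it into a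
  mixed derivative at a nearby point.\<close>

lemma mixed_difference_mvt:
  fixes f :: "real^2 \<Rightarrow> real"
  assumes diff: "\<And>y. y \<in> ball x (3 * h) \<Longrightarrow> f differentiable (at y)"
    and diff1: "\<And>y. y \<in> ball x (3 * h) \<Longrightarrow> partial i f differentiable (at y)"
    and h: "h > 0"
  obtains z where "z \<in> ball x (3 * h)"
    "f (x + h *\<^sub>R axis i 1 + h *\<^sub>R axis j 1) - f (x + h *\<^sub>R axis i 1) - f (x + h *\<^sub>R axis j 1) + f x
      = h\<^sup>2 * partial j (partial i f) z"
proof -
  let ?i = "axis i 1 :: real^2" and ?j = "axis j 1 :: real^2"
  \<comment> \<open>All points in use are within \<open>2 * h\<close> of \<open>x\<close>; the
    radius \<open>3 * h\<close> leaves room for an open ball.\<close>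
  have B: "x + s *\<^sub>R ?i + t *\<^sub>R ?j \<in> ball x (3 * h)" if "0 \<le> s" "s \<le> h" "0 \<le> t" "t \<le> h" for s t
  proof -
    have "norm (s *\<^sub>R ?i + t *\<^sub>R ?j) \<le> norm (s *\<^sub>R ?i) + norm (t *\<^sub>R ?j)" by (rule norm_triangle_ineq)
    also have "\<dots> \<le> h + h" using that by (simp add: norm_axis_1)
    finally show ?thesis using h by (simp add: dist_norm norm_minus_commute algebra_simps)
  qed
  have line: "((\<lambda>s. g (b + s *\<^sub>R v)) has_real_derivative frechet_derivative g (at (b + s *\<^sub>R v)) v) (at s)"
    if "g differentiable (at (b + s *\<^sub>R v))" for g :: "real^2 \<Rightarrow> real" and b v s
  proof -
    have lin: "linear (frechet_derivative g (at (b + s *\<^sub>R v)))"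
      using linear_frechet_derivative[OF that] .
    have "((\<lambda>s. b + s *\<^sub>R v) has_derivative (\<lambda>t. t *\<^sub>R v)) (at s)"
      by (auto intro!: derivative_eq_intros)
    from has_derivative_compose[OF this] that
    have "((\<lambda>s. g (b + s *\<^sub>R v)) has_derivative (\<lambda>t. frechet_derivative g (at (b + s *\<^sub>R v)) (t *\<^sub>R v))) (at s)"
      by (simp add: frechet_derivative_works)
    then show ?thesis
      by (simp add: has_field_derivative_def linear.scaleR[OF lin] mult.commute[of _ "frechet_derivative g (at (b + s *\<^sub>R v)) v"])
  qed
  let ?\<phi> = "\<lambda>s. f ((x + h *\<^sub>R ?j) + s *\<^sub>R ?i) - f (x + s *\<^sub>R ?i)"
  have "\<exists>\<xi>. 0 < \<xi> \<and> \<xi> < h \<and> ?\<phi> h - ?\<phi> 0 =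
     (h - 0) * (partial i f ((x + h *\<^sub>R ?j) + \<xi> *\<^sub>R ?i) - partial i f (x + \<xi> *\<^sub>R ?i))"
  proof (rule MVT2)
    show "0 < h" by fact
    fix s assume s: "0 \<le> s" "s \<le> h"
    have "f differentiable (at ((x + h *\<^sub>R ?j) + s *\<^sub>R ?i))" "f differentiable (at (x + s *\<^sub>R ?i))"
      using diff[OF B[of s h]] diff[OF B[of s 0]] s h by (simp_all add: algebra_simps)
    then show "(?\<phi> has_real_derivative
       (partial i f ((x + h *\<^sub>R ?j) + s *\<^sub>R ?i) - partial i f (x + s *\<^sub>R ?i))) (at s)"
      by (intro DERIV_diff line)
  qed
  then obtain \<xi> where xi: "0 < \<xi>" "\<xi> < h" "?\<phi> h - ?\<phi> 0 =
     h * (partial i f ((x + h *\<^sub>R ?j) + \<xi> *\<^sub>R ?i) - partial i f (x + \<xi> *\<^sub>R ?i))" by auto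
  have "\<exists>\<eta>. 0 < \<eta> \<and> \<eta> < h \<and> partial i f ((x + \<xi> *\<^sub>R ?i) + h *\<^sub>R ?j) - partial i f ((x + \<xi> *\<^sub>R ?i) + 0 *\<^sub>R ?j) =
     (h - 0) * partial j (partial i f) ((x + \<xi> *\<^sub>R ?i) + \<eta> *\<^sub>R ?j)"
  proof (rule MVT2)
    show "0 < h" by fact
    fix t assume t: "0 \<le> t" "t \<le> h"
    show "((\<lambda>t. partial i f ((x + \<xi> *\<^sub>R ?i) + t *\<^sub>R ?j)) has_real_derivative
       partial j (partial i f) ((x + \<xi> *\<^sub>R ?i) + t *\<^sub>R ?j)) (at t)"
      using diff1[OF B[of \<xi> t]] t xi by (intro line) simp
  qed
  then obtain \<eta> where eta: "0 < \<eta>" "\<eta> < h"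
    "partial i f ((x + \<xi> *\<^sub>R ?i) + h *\<^sub>R ?j) - partial i f (x + \<xi> *\<^sub>R ?i) =
     h * partial j (partial i f) ((x + \<xi> *\<^sub>R ?i) + \<eta> *\<^sub>R ?j)" by auto
  have c: "x + h *\<^sub>R ?j + \<xi> *\<^sub>R ?i = (x + \<xi> *\<^sub>R ?i) + h *\<^sub>R ?j"
    "x + h *\<^sub>R ?j + h *\<^sub>R ?i = x + h *\<^sub>R ?i + h *\<^sub>R ?j"
    by (simp_all add: algebra_simps)
  show thesis
  proof (rule that)
    show "(x + \<xi> *\<^sub>R ?i) + \<eta> *\<^sub>R ?j \<in> ball x (3 * h)" using B xi(1,2) eta(1,2) by simp
    show "f (x + h *\<^sub>R ?i + h *\<^sub>R ?j) - f (x + h *\<^sub>R ?i) - f (x + h *\<^sub>R ?j) + f x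
      = h\<^sup>2 * partial j (partial i f) ((x + \<xi> *\<^sub>R ?i) + \<eta> *\<^sub>R ?j)"
      using xi(3) eta(3) unfolding c by (simp add: power2_eq_square)
  qed
qed

text \<open>Evaluating the same second difference in both orders gives a common value of the two
  mixed derivatives at two points near \<open>x\<close>. By continuity it is closer than half of the
  supposed gap to either value at \<open>x\<close>, which is impossible.\<close>

lemma partial_commute_real:
  fixes f :: "real^2 \<Rightarrow> real"
  assumes U: "open U" "x \<in> U" and C2: "Ck_on 2 U f"
  shows "partial i (partial j f) x = partial j (partial i f) x"
proof (rule ccontr)
  assume ne: "partial i (partial j f) x \<noteq> partial j (partial i f) x"
  define e where "e = \<bar>partial i (partial j f) x - partial j (partial i f) x\<bar> / 2"
  have e: "e > 0" using ne by (simp add: e_def)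
  have C2': "Ck_on (Suc (Suc 0)) U f" using C2 by (simp only: numeral_2_eq_2)
  then have diff: "f differentiable (at y)" "partial k f differentiable (at y)" if "y \<in> U" for y k
    using that by auto
  have cont: "continuous_on U (partial k (partial k' f))" for k k'
    using C2' by simp
  obtain d0 where d0: "d0 > 0" "ball x d0 \<subseteq> U"
    using U openE by blast
  have "isCont (partial k (partial k' f)) x" for k k'
    using cont U by (simp add: continuous_on_eq_continuous_at)
  then have "\<exists>d>0. \<forall>y. dist y x < d \<longrightarrow> dist (partial k (partial k' f) y) (partial k (partial k' f) x) < e" for k k'
    using e unfolding continuous_at by (simp add: tendsto_iff eventually_at) (metis dist_self)
  then obtain d1 d2 where
    d1: "d1 > 0" "\<And>y. dist y x < d1 \<Longrightarrow> dist (partial i (partial j f) y) (partial i (partial j f) x) < e" and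
    d2: "d2 > 0" "\<And>y. dist y x < d2 \<Longrightarrow> dist (partial j (partial i f) y) (partial j (partial i f) x) < e"
    by meson
  define h where "h = Min {d0, d1, d2} / 3"
  have h: "h > 0" "3 * h \<le> d0" "3 * h \<le> d1" "3 * h \<le> d2"
    using d0 d1 d2 by (auto simp: h_def)
  have B: "y \<in> U" if "y \<in> ball x (3 * h)" for y
    using that d0(2) h(2) by auto
  obtain z where z: "z \<in> ball x (3 * h)"
    "f (x + h *\<^sub>R axis i 1 + h *\<^sub>R axis j 1) - f (x + h *\<^sub>R axis i 1) - f (x + h *\<^sub>R axis j 1) + f x
      = h\<^sup>2 * partial j (partial i f) z"
    using mixed_difference_mvt[of x h f i j] diff B h(1) by metis
  obtain z' where z': "z' \<in> ball x (3 * h)"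
    "f (x + h *\<^sub>R axis j 1 + h *\<^sub>R axis i 1) - f (x + h *\<^sub>R axis j 1) - f (x + h *\<^sub>R axis i 1) + f x
      = h\<^sup>2 * partial i (partial j f) z'"
    using mixed_difference_mvt[of x h f j i] diff B h(1) by metis
  have "h\<^sup>2 * partial j (partial i f) z = h\<^sup>2 * partial i (partial j f) z'"
    using z(2) z'(2) by (simp add: algebra_simps)
  then have eq: "partial j (partial i f) z = partial i (partial j f) z'" using h(1) by simp
  have "dist (partial j (partial i f) z) (partial j (partial i f) x) < e"
    using z(1) h(4) by (intro d2(2)) (simp add: dist_commute)
  moreover have "dist (partial i (partial j f) z') (partial i (partial j f) x) < e"
    using z'(1) h(3) by (intro d1(2)) (simp add: dist_commute)
  moreover have "False" if "dist c b < \<bar>a - b\<bar> / 2" "dist c a < \<bar>a - b\<bar> / 2" for a b c :: real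
    using that unfolding dist_real_def by argo
  ultimately show False
    unfolding eq e_def by blast
qed

lemma Ck_on_cong:
  assumes "open U" "\<And>x. x \<in> U \<Longrightarrow> g x = k x"
  shows "Ck_on n U g \<longleftrightarrow> Ck_on n U k"
  using assms(2)
proof (induction n arbitrary: g k)
  case 0
  then show ?case by (simp cong: continuous_on_cong)
next
  case (Suc n)
  have "Ck_on n U (partial i g) \<longleftrightarrow> Ck_on n U (partial i k)" for i
  proof (rule Suc.IH)
    fix x assume "x \<in> U"
    from frechet_derivative_cong_open[OF assms(1) this Suc.prems]
    show "partial i g x = partial i k x" by simp
  qed
  moreover have "g differentiable (at x) \<longleftrightarrow> k differentiable (at x)" if "x \<in> U" for x
    using differentiable_cong_open[OF assms(1) that] Suc.prems by blast
  ultimately show ?case by simp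
qed

lemma Ck_on_bounded_linear:
  assumes "bounded_linear L" "open U"
  shows "Ck_on n U g \<Longrightarrow> Ck_on n U (\<lambda>x. L (g x))"
proof (induction n arbitrary: g)
  case 0
  then show ?case
    by (simp add: bounded_linear.continuous_on[OF assms(1)])
next
  case (Suc n)
  have "Ck_on n U (partial i (\<lambda>x. L (g x)))" for i
  proof -
    have "Ck_on n U (\<lambda>x. L (partial i g x))" using Suc by simp
    moreover have "L (partial i g x) = partial i (\<lambda>x. L (g x)) x" if "x \<in> U" for x
      using Suc.prems that by (simp add: frechet_derivative_bounded_linear[OF assms(1)])
    ultimately show ?thesis
      using Ck_on_cong[OF assms(2), of "\<lambda>x. L (partial i g x)" "partial i (\<lambda>x. L (g x))" n] by blast
  qed
  moreover have "(\<lambda>x. L (g x)) differentiable (at x)" if "x \<in> U" for x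
  proof -
    have "g differentiable (at x)" using Suc.prems that by simp
    then obtain D where "(g has_derivative D) (at x)" by (auto simp: differentiable_def)
    from bounded_linear.has_derivative[OF assms(1) this] show ?thesis by (auto simp: differentiable_def)
  qed
  ultimately show ?case by simp
qed

lemma partial_commute:
  fixes f :: "real^2 \<Rightarrow> real^'n"
  assumes U: "open U" "x \<in> U" and C2: "Ck_on 2 U f"
  shows "partial i (partial j f) x = partial j (partial i f) x"
proof -
  have C2': "Ck_on (Suc (Suc 0)) U f" using C2 by (simp only: numeral_2_eq_2)
  then have diff: "f differentiable (at y)" "partial k f differentiable (at y)" if "y \<in> U" for y k
    using that by auto
  have nth: "bounded_linear (\<lambda>v::real^'n. v $ k)" for k by (rule bounded_linear_vec_nth)
  have c: "partial a (partial b f) x $ k = partial a (partial b (\<lambda>y. f y $ k)) x" for a b k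
  proof -
    have "frechet_derivative (partial b (\<lambda>y. f y $ k)) (at x) = frechet_derivative (\<lambda>y. partial b f y $ k) (at x)"
    proof (rule frechet_derivative_cong_open[OF U])
      fix y assume "y \<in> U"
      from frechet_derivative_bounded_linear[OF nth diff(1)[OF this], of k "axis b 1"]
      show "partial b (\<lambda>y. f y $ k) y = partial b f y $ k" .
    qed
    then show ?thesis
      by (metis frechet_derivative_bounded_linear[OF nth diff(2)[OF U(2)], of _ _ "axis a 1"])
  qed
  have "partial i (partial j (\<lambda>y. f y $ k)) x = partial j (partial i (\<lambda>y. f y $ k)) x" for k
    by (rule partial_commute_real[OF U Ck_on_bounded_linear[OF nth U(1) C2]])
  then show ?thesis unfolding vec_eq_iff c by blast
qed

section \<open>Minimal surfaces in a coordinate domain\<close>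

text \<open>The Euclidean cross product with its last component negated, so that pairing it with a
  vector by \<open>h3\<close> gives the determinant.\<close>

definition lorentz_cross :: "real^3 \<Rightarrow> real^3 \<Rightarrow> real^3" where
  "lorentz_cross a b = vector [a$2 * b$3 - a$3 * b$2, a$3 * b$1 - a$1 * b$3, a$2 * b$1 - a$1 * b$2]"

lemma h3_lorentz_cross: "h3 (lorentz_cross a b) v = det (vector [a, b, v] :: real^3^3)"
  by (simp add: h3_def lorentz_cross_def det_3 algebra_simps)

lemma h3_lorentz_cross_self:
  "h3 (lorentz_cross a b) (lorentz_cross a b) = (h3 a b)\<^sup>2 - h3 a a * h3 b b"
  by (simp add: h3_def lorentz_cross_def power2_eq_square algebra_simps)

lemma bounded_bilinear_lorentz_cross: "bounded_bilinear lorentz_cross"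
proof -
  have "bilinear lorentz_cross"
    unfolding bilinear_def
    by (auto intro!: linearI simp: lorentz_cross_def vec_eq_iff forall_3 algebra_simps)
  then show ?thesis by (simp add: bilinear_conv_bounded_bilinear)
qed

text \<open>By the Lorentzian Lagrange identity, the cross product of a conformal pair has squared
  norm \<open>(h3 a a)\<^sup>2\<close>, which explains the denominator. An explicit formula is
  wanted because the normal has to be differentiated.\<close>

definition normal3 :: "real \<Rightarrow> real^3 \<Rightarrow> real^3 \<Rightarrow> real^3" where
  "normal3 oE a b = (oE / h3 a a) *\<^sub>R lorentz_cross a b"

context
  fixes a b :: "real^3" and oE :: real
  assumes pos: "h3 a a > 0" and conf: "h3 b b = - h3 a a" "h3 a b = 0" and oE: "oE \<in> {1, -1}"
begin

lemma normal3_gram: "h3 (normal3 oE a b) (normal3 oE a b) = 1" "h3 a (normal3 oE a b) = 0" "h3 b (normal3 oE a b) = 0"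
proof -
  show "h3 (normal3 oE a b) (normal3 oE a b) = 1"
    using pos conf oE by (auto simp: normal3_def h3_simps h3_lorentz_cross_self)
  have "h3 a (lorentz_cross a b) = 0" "h3 b (lorentz_cross a b) = 0"
    by (simp_all add: h3_def lorentz_cross_def algebra_simps)
  then show "h3 a (normal3 oE a b) = 0" "h3 b (normal3 oE a b) = 0"
    by (simp_all add: normal3_def h3_simps)
qed

lemma normal3_det: "oE * det (vector [a, b, normal3 oE a b] :: real^3^3) = h3 a a"
proof -
  have "lorentz_cross a b = (oE * h3 a a) *\<^sub>R normal3 oE a b"
    using pos oE by (auto simp: normal3_def)
  then have "h3 (lorentz_cross a b) (normal3 oE a b) = oE * h3 a a"
    by (simp add: h3_simps normal3_gram)
  then show ?thesis
    using oE by (auto simp: h3_lorentz_cross)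
qed

lemma normal3_expand:
  "v = (h3 a v / h3 a a) *\<^sub>R a - (h3 b v / h3 a a) *\<^sub>R b + h3 (normal3 oE a b) v *\<^sub>R normal3 oE a b" (is "v = ?z")
proof -
  let ?n = "normal3 oE a b"
  have "h3 b a = 0" "h3 ?n a = 0" "h3 ?n b = 0"
    using conf(2) normal3_gram by (simp_all add: h3_commute)
  then have "v - ?z = 0"
    using normal3_det pos conf normal3_gram
    by (intro h3_eq_0_if_det_nonzero[of a b ?n]) (auto simp: h3_simps)
  then show ?thesis by simp
qed

text \<open>Orthogonality leaves a multiple of the normal, the norm leaves a sign, and the
  orientation decides it.\<close>

lemma normal3_unique:
  assumes n: "h3 n n = 1" "h3 n a = 0" "h3 n b = 0" "oE * det (vector [a, b, n] :: real^3^3) > 0"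
  shows "n = normal3 oE a b"
proof -
  define c where "c = h3 (normal3 oE a b) n"
  have e: "n = c *\<^sub>R normal3 oE a b"
    using normal3_expand[of n] n(2,3) by (simp add: c_def h3_commute[of _ n])
  have "h3 n n = c * c"
    by (subst (1 2) e) (simp add: h3_simps normal3_gram)
  then have "c * c = 1" using n(1) by simp
  then have "c = 1 \<or> c = -1" by (simp add: square_eq_1_iff)
  moreover have "oE * det (vector [a, b, n] :: real^3^3) = c * h3 a a"
    using normal3_det by (subst e) (simp add: h3_lorentz_cross[symmetric] h3_simps mult.left_commute)
  then have "c > 0" using n(4) pos by (simp add: zero_less_mult_iff)
  ultimately show ?thesis using e by auto
qed

end

section \<open>The light cone model and its derivative\<close>

text \<open>
  The point at infinity of the light cone model of \<open>E\<^sup>3\<^sub>1\<close>; the light-like normal vector field \<open>\<nu>\<close>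
  turns out to be constant and equal to it.
\<close>

definition infinity_pt :: "real^5" where
  "infinity_pt = vector [1, 0, 0, 0, 1]"

definition incl5 :: "real^3 \<Rightarrow> real^5" where
  "incl5 v = vector [0, v$1, v$2, v$3, 0]"

text \<open>\<open>emb\<close> is an affine map plus \<open>h3 y y / 2\<close> times
  \<open>infinity_pt\<close>; the quadratic term alone makes the derivative depend on the base
  point.\<close>

definition emb_deriv :: "real^3 \<Rightarrow> real^3 \<Rightarrow> real^5" where
  "emb_deriv y v = h3 y v *\<^sub>R infinity_pt + incl5 v"

lemma bounded_linear_incl5: "bounded_linear incl5"
  by (rule linear_conv_bounded_linear[THEN iffD1])
    (auto intro!: linearI simp: incl5_def vec_eq_iff forall_5 vector_5)

lemma has_derivative_emb: "(emb has_derivative emb_deriv y) (at y)"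
proof -
  have e: "emb = (\<lambda>y. (h3 y y / 2) *\<^sub>R infinity_pt + incl5 y + vector [- 1 / 2, 0, 0, 0, 1 / 2])"
    by (rule ext) (simp add: emb_def infinity_pt_def incl5_def vec_eq_iff forall_5 vector_5 field_simps)
  have "((\<lambda>y. (h3 y y / 2) *\<^sub>R infinity_pt + incl5 y + vector [- 1 / 2, 0, 0, 0, 1 / 2])
     has_derivative (\<lambda>v. ((h3 y v + h3 v y) / 2) *\<^sub>R infinity_pt + incl5 v + 0)) (at y)"
    by (intro has_derivative_add has_derivative_const has_derivative_scaleR_left
        bounded_linear.has_derivative[OF bounded_linear_incl5] has_derivative_ident
        bounded_linear.has_derivative[OF bounded_linear_divide]
        bounded_bilinear.FDERIV[OF bounded_bilinear_h3])
  moreover have "(\<lambda>v. ((h3 y v + h3 v y) / 2) *\<^sub>R infinity_pt + incl5 v + 0) = emb_deriv y"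
    by (rule ext) (simp add: emb_deriv_def h3_commute)
  ultimately show ?thesis unfolding e by simp
qed

lemma emb_deriv_linear: "linear (emb_deriv y)"
  using has_derivative_emb has_derivative_linear by blast

lemmas emb_deriv_simps =
  linear_add[OF emb_deriv_linear] linear_diff[OF emb_deriv_linear] linear_scale[OF emb_deriv_linear]
  linear_neg[OF emb_deriv_linear]

lemma emb_deriv_gram:
  "h5 (emb_deriv y v) (emb_deriv y w) = h3 v w" "h5 (emb_deriv y v) (emb y) = 0" "h5 (emb y) (emb_deriv y v) = 0"
  "h5 (emb y) (emb y) = 0" "h5 infinity_pt (emb y) = -1" "h5 (emb y) infinity_pt = -1"
  "h5 infinity_pt (emb_deriv y v) = 0" "h5 (emb_deriv y v) infinity_pt = 0" "h5 infinity_pt infinity_pt = 0"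
  by (simp_all add: h5_explicit emb_deriv_def emb_def infinity_pt_def incl5_def vector_5 h3_def field_simps)

lemma differentiable_emb_deriv:
  assumes "f differentiable (at x)" "v differentiable (at x)"
  shows "(\<lambda>x. emb_deriv (f x) (v x)) differentiable (at x)"
proof -
  have "(\<lambda>x. h3 (f x) (v x) *\<^sub>R infinity_pt) differentiable (at x)"
    using differentiable_bilinear[OF bounded_bilinear_h3 assms] by (rule differentiable_scaleR) simp
  moreover have "(\<lambda>x. incl5 (v x)) differentiable (at x)"
    using assms(2) bounded_linear.has_derivative[OF bounded_linear_incl5] unfolding differentiable_def by blast
  ultimately show ?thesis unfolding emb_deriv_def by simp
qed

text \<open>The moving base point contributes a multiple of \<open>infinity_pt\<close>. This is the
  source of the \<open>infinity_pt\<close> terms in the derivatives of \<open>V\<close> and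
  \<open>W\<close>.\<close>

lemma frechet_derivative_emb_deriv:
  assumes "f differentiable (at x)" "v differentiable (at x)"
  shows "frechet_derivative (\<lambda>x. emb_deriv (f x) (v x)) (at x) a =
    emb_deriv (f x) (frechet_derivative v (at x) a) + h3 (frechet_derivative f (at x) a) (v x) *\<^sub>R infinity_pt"
proof -
  have h: "(\<lambda>x. h3 (f x) (v x)) differentiable (at x)"
    using differentiable_bilinear[OF bounded_bilinear_h3 assms] .
  have d: "(\<lambda>x. h3 (f x) (v x) *\<^sub>R infinity_pt) differentiable (at x)"
    using h by (rule differentiable_scaleR) simp
  have i: "(\<lambda>x. incl5 (v x)) differentiable (at x)"
    using assms(2) bounded_linear.has_derivative[OF bounded_linear_incl5] unfolding differentiable_def by blast
  have "bounded_linear (\<lambda>c. c *\<^sub>R infinity_pt)" by (rule bounded_linear_scaleR_left)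
  then show ?thesis
    unfolding emb_deriv_def frechet_derivative_add[OF d i]
    by (simp add: frechet_derivative_bounded_linear[of "\<lambda>c. c *\<^sub>R infinity_pt", OF _ h]
        frechet_derivative_bounded_linear[OF bounded_linear_incl5 assms(2)]
        frechet_derivative_bilinear[OF bounded_bilinear_h3 assms] scaleR_add_left)
qed

lemma frechet_derivative_emb:
  assumes "f differentiable (at x)"
  shows "frechet_derivative (\<lambda>x. emb (f x)) (at x) a = emb_deriv (f x) (frechet_derivative f (at x) a)"
    "(\<lambda>x. emb (f x)) differentiable (at x)"
proof -
  have "((\<lambda>x. emb (f x)) has_derivative (\<lambda>a. emb_deriv (f x) (frechet_derivative f (at x) a))) (at x)"
    using has_derivative_compose[OF _ has_derivative_emb] assms by (simp add: frechet_derivative_works)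
  then show "frechet_derivative (\<lambda>x. emb (f x)) (at x) a = emb_deriv (f x) (frechet_derivative f (at x) a)"
    "(\<lambda>x. emb (f x)) differentiable (at x)"
    using frechet_derivative_at differentiable_def by metis+
qed

section \<open>Gauss and Weingarten formulas and the Gauss equation\<close>

text \<open>The analysis in one coordinate domain, free of charts. The last assumption is vanishing
  mean curvature: for a metric proportional to du^2 - dv^2 the trace is a difference.\<close>

locale minimal_patch =
  fixes U :: "(real^2) set" and f :: "real^2 \<Rightarrow> real^3" and oE :: real
  assumes open_U: "open U" and smooth: "smooth_on U f" and oE: "oE \<in> {1, -1}"
    and metric_pos: "x \<in> U \<Longrightarrow> h3 (partial 1 f x) (partial 1 f x) > 0"
    and metric_conf: "x \<in> U \<Longrightarrow> h3 (partial 2 f x) (partial 2 f x) = - h3 (partial 1 f x) (partial 1 f x)"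
      "x \<in> U \<Longrightarrow> h3 (partial 1 f x) (partial 2 f x) = 0"
    and minimal: "x \<in> U \<Longrightarrow> h3 (partial 1 (partial 1 f) x) (normal3 oE (partial 1 f x) (partial 2 f x)) =
       h3 (partial 2 (partial 2 f) x) (normal3 oE (partial 1 f x) (partial 2 f x))"
begin

abbreviation f1 where "f1 \<equiv> partial 1 f"
abbreviation f2 where "f2 \<equiv> partial 2 f"

definition r :: "real^2 \<Rightarrow> real" where "r x = h3 (f1 x) (f1 x)"
definition n :: "real^2 \<Rightarrow> real^3" where "n x = normal3 oE (f1 x) (f2 x)"
text \<open>With \<open>r = exp (2 * \<lambda>)\<close>, this and \<open>gv\<close> are the partial
  derivatives of \<lambda>, written without a logarithm and grouped as a product for the product
  rule.\<close>

definition gu :: "real^2 \<Rightarrow> real" where "gu x = (1 / r x) * (partial 1 r x / 2)"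
definition gv :: "real^2 \<Rightarrow> real" where "gv x = (1 / r x) * (partial 2 r x / 2)"
definition l :: "real^2 \<Rightarrow> real" where "l x = h3 (n x) (partial 1 f1 x)"
definition m :: "real^2 \<Rightarrow> real" where "m x = h3 (n x) (partial 2 f1 x)"

lemma Ck: "Ck_on k U f"
  using smooth by (simp add: smooth_on_def)

lemma diff:
  assumes "x \<in> U"
  shows "f differentiable (at x)" "partial i f differentiable (at x)" "partial i (partial j f) differentiable (at x)"
  using Ck[of "Suc (Suc (Suc 0))"] assms by auto

lemma r_pos: "x \<in> U \<Longrightarrow> r x > 0"
  using metric_pos by (simp add: r_def)

lemma conf:
  assumes "x \<in> U"
  shows "h3 (f1 x) (f1 x) = r x" "h3 (f2 x) (f2 x) = - r x" "h3 (f1 x) (f2 x) = 0" "h3 (f2 x) (f1 x) = 0"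
  using metric_conf[OF assms] by (simp_all add: r_def h3_commute)

lemma n_gram:
  assumes "x \<in> U"
  shows "h3 (n x) (n x) = 1" "h3 (f1 x) (n x) = 0" "h3 (f2 x) (n x) = 0" "h3 (n x) (f1 x) = 0" "h3 (n x) (f2 x) = 0"
  using normal3_gram[OF metric_pos metric_conf oE] assms by (simp_all add: n_def h3_commute)

lemma expand:
  assumes "x \<in> U"
  shows "v = (h3 (f1 x) v / r x) *\<^sub>R f1 x - (h3 (f2 x) v / r x) *\<^sub>R f2 x + h3 (n x) v *\<^sub>R n x"
  using normal3_expand[OF metric_pos metric_conf oE] assms by (simp add: n_def r_def)

lemma n_det: "x \<in> U \<Longrightarrow> oE * det (vector [f1 x, f2 x, n x] :: real^3^3) = r x"
  using normal3_det[OF metric_pos metric_conf oE] by (simp add: n_def r_def)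

lemma mixed: "x \<in> U \<Longrightarrow> partial 1 f2 x = partial 2 f1 x"
  by (rule partial_commute[OF open_U _ Ck])

lemma mixed3: "x \<in> U \<Longrightarrow> partial 1 (partial 2 f2) x = partial 2 (partial 2 f1) x"
proof -
  assume x: "x \<in> U"
  have "Ck_on (Suc (Suc (Suc 0))) U f" by (rule Ck)
  then have "Ck_on 2 U f2" by (simp only: Ck_on.simps(2)[of "Suc (Suc 0)"] numeral_2_eq_2)
  from partial_commute[OF open_U x this, of 2 1]
  have "partial 1 (partial 2 f2) x = partial 2 (partial 1 f2) x" .
  also have "\<dots> = partial 2 (partial 2 f1) x"
    using frechet_derivative_cong_open[OF open_U x mixed] by simp
  finally show ?thesis .
qed

lemma diff_h3:
  assumes "g differentiable (at x)" "k differentiable (at x)"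
  shows "(\<lambda>x. h3 (g x) (k x)) differentiable (at x)"
  using differentiable_bilinear[OF bounded_bilinear_h3 assms] .

lemma partial_h3:
  assumes "g differentiable (at x)" "k differentiable (at x)"
  shows "partial i (\<lambda>x. h3 (g x) (k x)) x = h3 (g x) (partial i k x) + h3 (partial i g x) (k x)"
  using frechet_derivative_bilinear[OF bounded_bilinear_h3 assms] .

lemma partial_h3_const:
  assumes x: "x \<in> U" and d: "g differentiable (at x)" "k differentiable (at x)"
    and e: "\<And>y. y \<in> U \<Longrightarrow> h3 (g y) (k y) = R y"
  shows "h3 (g x) (partial i k x) + h3 (partial i g x) (k x) = partial i R x"
  using frechet_derivative_cong_open[OF open_U x, of "\<lambda>y. h3 (g y) (k y)" R] e partial_h3[OF d] by simp

lemma r_diff: "x \<in> U \<Longrightarrow> r differentiable (at x)"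
  unfolding r_def[abs_def] by (intro diff_h3 diff)

lemma partial_r: "x \<in> U \<Longrightarrow> partial i r x = 2 * h3 (f1 x) (partial i f1 x)"
  unfolding r_def[abs_def] by (simp add: partial_h3 diff h3_commute)

lemma partial_r_diff: "x \<in> U \<Longrightarrow> partial i r differentiable (at x)"
proof -
  assume x: "x \<in> U"
  have "(\<lambda>x. 2 * h3 (f1 x) (partial i f1 x)) differentiable (at x)"
    using x by (intro differentiable_mult diff_h3 diff) simp_all
  then show ?thesis
    using differentiable_cong_open[OF open_U x, of "partial i r" "\<lambda>x. 2 * h3 (f1 x) (partial i f1 x)"] partial_r
    by blast
qed

lemma partial2_r: "x \<in> U \<Longrightarrow>
    partial i (partial j r) x = 2 * (h3 (f1 x) (partial i (partial j f1) x) + h3 (partial i f1 x) (partial j f1 x))"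
proof -
  assume x: "x \<in> U"
  have "partial i (partial j r) x = partial i (\<lambda>x. 2 * h3 (f1 x) (partial j f1 x)) x"
    using frechet_derivative_cong_open[OF open_U x, of "partial j r" "\<lambda>x. 2 * h3 (f1 x) (partial j f1 x)"] partial_r
    by simp
  also have "\<dots> = 2 * partial i (\<lambda>x. h3 (f1 x) (partial j f1 x)) x"
    using x by (intro frechet_derivative_bounded_linear bounded_linear_mult_right diff_h3 diff)
  finally show ?thesis using x by (simp add: partial_h3 diff)
qed

text \<open>As in the Koszul formula, all tangential components come from differentiating the
  conformality relations.\<close>

lemma h3_second:
  assumes x: "x \<in> U"
  shows "h3 (f1 x) (partial 1 f1 x) = r x * gu x" "h3 (f1 x) (partial 2 f1 x) = r x * gv x"
    "h3 (f2 x) (partial 2 f1 x) = - r x * gu x" "h3 (f2 x) (partial 1 f1 x) = - r x * gv x"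
    "h3 (f2 x) (partial 2 f2 x) = - r x * gv x" "h3 (f1 x) (partial 2 f2 x) = r x * gu x"
proof -
  have r0: "r x \<noteq> 0" using r_pos[OF x] by simp
  have mr: "partial i (\<lambda>y. - r y) x = - partial i r x" for i
    using frechet_derivative_minus[OF r_diff[OF x]] .
  show a: "h3 (f1 x) (partial 1 f1 x) = r x * gu x" "h3 (f1 x) (partial 2 f1 x) = r x * gv x"
    using r0 by (simp_all add: gu_def gv_def partial_r[OF x])
  have "h3 (f2 x) (partial i f2 x) + h3 (partial i f2 x) (f2 x) = - partial i r x" for i
    using partial_h3_const[OF x, of f2 f2 "\<lambda>y. - r y" i] conf diff x mr by simp
  then have b: "h3 (f2 x) (partial i f2 x) = - partial i r x / 2" for i
    by (simp add: h3_commute[of _ "f2 x"] field_simps)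
  show "h3 (f2 x) (partial 2 f1 x) = - r x * gu x" "h3 (f2 x) (partial 2 f2 x) = - r x * gv x"
    using b[of 1] b[of 2] r0 mixed[OF x] by (simp_all add: gu_def gv_def)
  have c: "h3 (f1 x) (partial i f2 x) + h3 (f2 x) (partial i f1 x) = 0" for i
    using partial_h3_const[OF x, of f1 f2 "\<lambda>y. 0" i] conf diff x by (simp add: h3_commute)
  show "h3 (f2 x) (partial 1 f1 x) = - r x * gv x" "h3 (f1 x) (partial 2 f2 x) = r x * gu x"
    using c[of 1] c[of 2] a mixed[OF x] \<open>h3 (f2 x) (partial 2 f1 x) = - r x * gu x\<close> by simp_all
qed

text \<open>The first and third derivatives agree: their tangential parts because the metric is
  conformal, their normal parts because the surface is minimal.\<close>

lemma second_fundamental: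
  assumes x: "x \<in> U"
  shows "partial 1 f1 x = gu x *\<^sub>R f1 x + gv x *\<^sub>R f2 x + l x *\<^sub>R n x"
    "partial 2 f1 x = gv x *\<^sub>R f1 x + gu x *\<^sub>R f2 x + m x *\<^sub>R n x"
    "partial 2 f2 x = gu x *\<^sub>R f1 x + gv x *\<^sub>R f2 x + l x *\<^sub>R n x"
proof -
  have r0: "r x \<noteq> 0" using r_pos[OF x] by simp
  have l: "h3 (n x) (partial 2 f2 x) = l x"
    using minimal[OF x] by (simp add: l_def n_def h3_commute)
  show "partial 1 f1 x = gu x *\<^sub>R f1 x + gv x *\<^sub>R f2 x + l x *\<^sub>R n x"
    using expand[OF x, of "partial 1 f1 x"] r0 by (simp add: h3_second[OF x] l_def)
  show "partial 2 f1 x = gv x *\<^sub>R f1 x + gu x *\<^sub>R f2 x + m x *\<^sub>R n x"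
    using expand[OF x, of "partial 2 f1 x"] r0 by (simp add: h3_second[OF x] m_def)
  show "partial 2 f2 x = gu x *\<^sub>R f1 x + gv x *\<^sub>R f2 x + l x *\<^sub>R n x"
    using expand[OF x, of "partial 2 f2 x"] r0 by (simp add: h3_second[OF x] l)
qed

text \<open>The point is to get rid of the third derivatives of the immersion. They enter through
  the second derivatives of \<open>r\<close> and cancel in the difference once both are brought to
  the same form.\<close>

lemma gauss_equation:
  assumes x: "x \<in> U"
  shows "partial 1 gu x - partial 2 gv x = ((l x)\<^sup>2 - (m x)\<^sup>2) / r x"
proof -
  have r0: "r x \<noteq> 0" using r_pos[OF x] by simp
  have inv: "(\<lambda>x. 1 / r x) differentiable (at x)"
    using r_diff[OF x] r0 by (intro differentiable_divide) simp_all
  have half: "(\<lambda>x. partial i r x / 2) differentiable (at x)"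
    "partial j (\<lambda>x. partial i r x / 2) x = partial j (partial i r) x / 2" for i j
    using partial_r_diff[OF x] differentiable_divide[of "partial i r" x UNIV "\<lambda>_. 2"]
      frechet_derivative_bounded_linear[OF bounded_linear_divide, of "partial i r" x 2]
    by simp_all
  have gv: "partial j (\<lambda>x. (1 / r x) * (partial i r x / 2)) x =
      (1 / r x) * (partial j (partial i r) x / 2) - (partial j r x / (r x)\<^sup>2) * (partial i r x / 2)" for i j
    unfolding frechet_derivative_bilinear[OF bounded_bilinear_mult inv half(1)] half(2)
        frechet_derivative_inverse[OF r_diff[OF x] r0] by simp
  have "partial 1 gu x - partial 2 gv x = (partial 1 (partial 1 r) x - partial 2 (partial 2 r) x) / (2 * r x)
      - ((partial 1 r x)\<^sup>2 - (partial 2 r x)\<^sup>2) / (2 * (r x)\<^sup>2)"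
    unfolding gu_def[abs_def] gv_def[abs_def] gv
    using r0 by (simp add: field_simps power2_eq_square)
  moreover have pr: "partial 1 r x = 2 * r x * gu x" "partial 2 r x = 2 * r x * gv x"
    using r0 by (simp_all add: gu_def gv_def)
  moreover have "partial 1 (partial 1 r) x - partial 2 (partial 2 r) x = 4 * r x * ((gu x)\<^sup>2 - (gv x)\<^sup>2) + 2 * ((l x)\<^sup>2 - (m x)\<^sup>2)"
  proof -
    have ii: "h3 (partial 2 f1 x) (partial 2 f1 x) = r x * (gv x)\<^sup>2 - r x * (gu x)\<^sup>2 + (m x)\<^sup>2"
      "h3 (partial 1 f1 x) (partial 1 f1 x) = r x * (gu x)\<^sup>2 - r x * (gv x)\<^sup>2 + (l x)\<^sup>2"
      "h3 (partial 1 f1 x) (partial 2 f2 x) = r x * (gu x)\<^sup>2 - r x * (gv x)\<^sup>2 + (l x)\<^sup>2"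
      unfolding second_fundamental[OF x]
      by (simp_all add: h3_simps conf[OF x] n_gram[OF x] power2_eq_square)
    \<comment> \<open>Writing the first derivative of \<open>r\<close> with
      \<open>partial 2 f2\<close> instead of \<open>partial 1 f1\<close> makes \<open>mixed3\<close>
      applicable, so that both second derivatives of \<open>r\<close> contain the same third
      derivative.\<close>
    have e: "2 * h3 (f1 y) (partial 2 f2 y) = partial 1 r y" if "y \<in> U" for y
      using h3_second(1,6)[OF that] partial_r[OF that] by simp
    have "partial 1 (partial 1 r) x = partial 1 (\<lambda>y. 2 * h3 (f1 y) (partial 2 f2 y)) x"
      using frechet_derivative_cong_open[OF open_U x e] by simp
    also have "\<dots> = 2 * partial 1 (\<lambda>y. h3 (f1 y) (partial 2 f2 y)) x"
      using x by (intro frechet_derivative_bounded_linear bounded_linear_mult_right diff_h3 diff)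
    also have "\<dots> = 2 * (h3 (f1 x) (partial 1 (partial 2 f2) x) + h3 (partial 1 f1 x) (partial 2 f2 x))"
      using x by (simp add: partial_h3 diff)
    finally show ?thesis
      unfolding partial2_r[OF x] mixed3[OF x] ii by (simp add: algebra_simps)
  qed
  ultimately have "partial 1 gu x - partial 2 gv x =
      (4 * r x * ((gu x)\<^sup>2 - (gv x)\<^sup>2) + 2 * ((l x)\<^sup>2 - (m x)\<^sup>2)) / (2 * r x)
      - ((2 * r x * gu x)\<^sup>2 - (2 * r x * gv x)\<^sup>2) / (2 * (r x)\<^sup>2)"
    by (simp only:)
  also have "\<dots> = ((l x)\<^sup>2 - (m x)\<^sup>2) / r x"
    using r0 by (simp add: field_simps power2_eq_square)
  finally show ?thesis .
qed

lemma n_diff: "x \<in> U \<Longrightarrow> n differentiable (at x)"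
proof -
  assume x: "x \<in> U"
  have "(\<lambda>x. oE / r x) differentiable (at x)"
    using r_diff[OF x] r_pos[OF x] by (intro differentiable_divide) simp_all
  moreover have "(\<lambda>x. lorentz_cross (f1 x) (f2 x)) differentiable (at x)"
    using x by (intro differentiable_bilinear[OF bounded_bilinear_lorentz_cross] diff)
  moreover have "n = (\<lambda>x. (oE / r x) *\<^sub>R lorentz_cross (f1 x) (f2 x))"
    by (simp add: n_def[abs_def] normal3_def r_def)
  ultimately show ?thesis by (simp add: differentiable_scaleR)
qed

text \<open>Differentiating the orthogonality relations moves the derivative from \<open>n\<close>
  to the tangent vectors; by minimality only \<open>l\<close> and \<open>m\<close> can
  occur.\<close>

lemma weingarten:
  assumes x: "x \<in> U"
  shows "partial 1 n x = (1 / r x) *\<^sub>R (m x *\<^sub>R f2 x - l x *\<^sub>R f1 x)"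
    "partial 2 n x = (1 / r x) *\<^sub>R (l x *\<^sub>R f2 x - m x *\<^sub>R f1 x)"
proof -
  have c: "h3 (partial j f x) (partial i n x) = - h3 (n x) (partial i (partial j f) x)" if "j = 1 \<or> j = 2" for i j
    using partial_h3_const[OF x, of "partial j f" n "\<lambda>y. 0" i] that n_gram diff n_diff x
    by (auto simp: h3_commute)
  have z: "h3 (n x) (partial i n x) = 0" for i
    using partial_h3_const[OF x, of n n "\<lambda>y. 1" i] n_gram n_diff x by (simp add: h3_commute[of _ "n x"])
  have "h3 (f1 x) (partial 1 n x) = - l x" "h3 (f1 x) (partial 2 n x) = - m x"
    "h3 (f2 x) (partial 1 n x) = - m x" "h3 (f2 x) (partial 2 n x) = - l x"
    using c[of 1 1] c[of 1 2] c[of 2 1] c[of 2 2] mixed[OF x] second_fundamental(3)[OF x] n_gram[OF x]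
    by (simp_all add: l_def m_def h3_simps)
  then show "partial 1 n x = (1 / r x) *\<^sub>R (m x *\<^sub>R f2 x - l x *\<^sub>R f1 x)"
    "partial 2 n x = (1 / r x) *\<^sub>R (l x *\<^sub>R f2 x - m x *\<^sub>R f1 x)"
    using expand[OF x, of "partial 1 n x"] expand[OF x, of "partial 2 n x"] z
    by (simp_all add: algebra_simps)
qed

section \<open>The light cone frame of a minimal patch and the derivative of its lifts\<close>

definition F :: "real^2 \<Rightarrow> real^5" where "F x = emb_deriv (f x) (n x)"
definition Y :: "real^2 \<Rightarrow> real^5" where "Y x = emb (f x)"
definition V :: "real^2 \<Rightarrow> real^5" where "V x = emb_deriv (f x) (f1 x)"
definition W :: "real^2 \<Rightarrow> real^5" where "W x = emb_deriv (f x) (f2 x)"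

text \<open>The 5x5 determinant is minus the determinant of the frame in Minkowski space, to which
  \<open>oE\<close> gives a positive sign; hence the negative sign required in the locale.\<close>

lemma null_frame:
  assumes x: "x \<in> U"
  shows "null_frame (F x) (V x) (W x) (Y x) infinity_pt (r x) oE"
proof
  show "r x > 0" "oE \<in> {1, -1}" using r_pos[OF x] oE by auto
  have "det (vector [F x, V x, Y x, W x, infinity_pt] :: real^5^5) = - det (vector [f1 x, f2 x, n x] :: real^3^3)"
  proof -
    have e: "emb_deriv y v = vector [h3 y v, v$1, v$2, v$3, h3 y v]" for y v
      by (simp add: emb_deriv_def infinity_pt_def incl5_def vec_eq_iff forall_5 vector_5)
    have v: "v = vector [v$1, v$2, v$3]" for v :: "real^3" by (simp add: vec_eq_iff forall_3)
    show ?thesis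
      unfolding F_def V_def W_def Y_def e emb_def infinity_pt_def det_null_frame
      by (simp add: v[symmetric])
  qed
  then show "oE * det (vector [F x, V x, Y x, W x, infinity_pt] :: real^5^5) < 0"
    using n_det[OF x] r_pos[OF x] by simp
qed (simp_all add: F_def V_def W_def Y_def emb_deriv_gram conf[OF x] n_gram[OF x])

lemma diff_FY:
  assumes x: "x \<in> U"
  shows "F differentiable (at x)" "Y differentiable (at x)" "V differentiable (at x)" "W differentiable (at x)"
  unfolding F_def[abs_def] Y_def[abs_def] V_def[abs_def] W_def[abs_def]
  using x by (auto intro!: differentiable_emb_deriv frechet_derivative_emb diff n_diff)

text \<open>The multiples of \<open>infinity_pt\<close> are the entries of the first fundamental
  form. They are absent from the mixed derivatives and from those of \<open>F\<close> because the
  corresponding pairs are orthogonal.\<close>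

lemma partial_FY:
  assumes x: "x \<in> U"
  shows "partial 1 F x = (1 / r x) *\<^sub>R (m x *\<^sub>R W x - l x *\<^sub>R V x)"
    "partial 2 F x = (1 / r x) *\<^sub>R (l x *\<^sub>R W x - m x *\<^sub>R V x)"
    "partial 1 Y x = V x" "partial 2 Y x = W x"
    "partial 1 V x = gu x *\<^sub>R V x + gv x *\<^sub>R W x + l x *\<^sub>R F x + r x *\<^sub>R infinity_pt"
    "partial 2 V x = gv x *\<^sub>R V x + gu x *\<^sub>R W x + m x *\<^sub>R F x"
    "partial 1 W x = gv x *\<^sub>R V x + gu x *\<^sub>R W x + m x *\<^sub>R F x"
    "partial 2 W x = gu x *\<^sub>R V x + gv x *\<^sub>R W x + l x *\<^sub>R F x - r x *\<^sub>R infinity_pt"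
  unfolding F_def[abs_def] Y_def[abs_def] V_def[abs_def] W_def[abs_def]
  by (simp_all add: frechet_derivative_emb_deriv frechet_derivative_emb diff[OF x] n_diff[OF x]
      weingarten[OF x] second_fundamental[OF x] mixed[OF x] n_gram[OF x] conf[OF x] emb_deriv_simps)

text \<open>
  Up to the sign of the curvature, the twistor lifts are the bivectors \<open>T \<kappa>\<close> with \<open>\<kappa> \<in> {1, -1}\<close>.
\<close>

definition T :: "real \<Rightarrow> real^2 \<Rightarrow> real^5^5" where
  "T \<kappa> x = (1 / r x) *\<^sub>R wedge (V x) (W x) + \<kappa> *\<^sub>R wedge (Y x) infinity_pt"

lemma wedge_diff:
  assumes "g differentiable (at x)" "k differentiable (at x)"
  shows "(\<lambda>x. wedge (g x) (k x)) differentiable (at x)"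
  using differentiable_bilinear[OF wedge_bounded_bilinear assms] .

text \<open>\<open>1 / r\<close> normalises the area bivector, so its derivative cancels the
  \<open>gu\<close> and \<open>gv\<close> terms. The remaining wedges with \<open>F\<close> are
  removed later by projecting to the sphere.\<close>

lemma T_derivative:
  assumes x: "x \<in> U"
  shows "T \<kappa> differentiable (at x)"
    "partial 1 (T \<kappa>) x = wedge infinity_pt (W x - \<kappa> *\<^sub>R V x) + wedge (F x) ((1 / r x) *\<^sub>R (l x *\<^sub>R W x - m x *\<^sub>R V x))"
    "partial 2 (T \<kappa>) x = wedge infinity_pt (V x - \<kappa> *\<^sub>R W x) + wedge (F x) ((1 / r x) *\<^sub>R (m x *\<^sub>R W x - l x *\<^sub>R V x))"
proof -
  have r0: "r x \<noteq> 0" using r_pos[OF x] by simp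
  have inv: "(\<lambda>x. 1 / r x) differentiable (at x)"
    using r_diff[OF x] r0 by (intro differentiable_divide) simp_all
  note VW = wedge_diff[OF diff_FY(3,4)[OF x]]
  have YP: "(\<lambda>x. wedge (Y x) infinity_pt) differentiable (at x)"
    using diff_FY(2)[OF x] by (intro wedge_diff) simp_all
  have d1: "(\<lambda>x. (1 / r x) *\<^sub>R wedge (V x) (W x)) differentiable (at x)"
    using inv VW by (rule differentiable_scaleR)
  have d2: "(\<lambda>x. \<kappa> *\<^sub>R wedge (Y x) infinity_pt) differentiable (at x)"
    using YP by (intro differentiable_scaleR) simp_all
  show "T \<kappa> differentiable (at x)"
    unfolding T_def[abs_def] using d1 d2 by (rule differentiable_add)
  \<comment> \<open>Split into equal halves, one to cancel the term from the derivative of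
    \<open>V\<close>, the other the term from \<open>W\<close>.\<close>
  have pr: "partial 1 r x / (r x)\<^sup>2 = gu x / r x + gu x / r x" "partial 2 r x / (r x)\<^sup>2 = gv x / r x + gv x / r x"
    using r0 by (simp_all add: gu_def gv_def power2_eq_square)
  have e: "partial i (T \<kappa>) x = (1 / r x) *\<^sub>R (wedge (V x) (partial i W x) + wedge (partial i V x) (W x))
     - (partial i r x / (r x)\<^sup>2) *\<^sub>R wedge (V x) (W x) + \<kappa> *\<^sub>R wedge (partial i Y x) infinity_pt" for i
    unfolding T_def[abs_def] frechet_derivative_add[OF d1 d2]
      frechet_derivative_bilinear[OF bounded_bilinear_scaleR inv VW]
      frechet_derivative_bounded_linear[OF bounded_linear_scaleR_right YP]
      frechet_derivative_inverse[OF r_diff[OF x] r0]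
      frechet_derivative_bilinear[OF wedge_bounded_bilinear diff_FY(3,4)[OF x]]
      frechet_derivative_bilinear[OF wedge_bounded_bilinear diff_FY(2)[OF x] differentiable_const]
    by (simp add: wedge_simps bounded_bilinear.zero_right[OF wedge_bounded_bilinear])
  have two: "(a / b) *\<^sub>R (2 * Z) = (2 * a / b) *\<^sub>R Z" for a b :: real and Z :: "real^5^5"
    by (simp only: mult_2 scaleR_add_right add_divide_distrib scaleR_add_left)
  show "partial 1 (T \<kappa>) x = wedge infinity_pt (W x - \<kappa> *\<^sub>R V x) + wedge (F x) ((1 / r x) *\<^sub>R (l x *\<^sub>R W x - m x *\<^sub>R V x))"
    unfolding e partial_FY[OF x] pr using r0
    by (simp add: wedge_simps wedge_swap[of "V x" "F x"] wedge_swap[of "V x" infinity_pt] wedge_swap[of "W x" infinity_pt]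
        wedge_swap[of "W x" "V x"] algebra_simps two)
  show "partial 2 (T \<kappa>) x = wedge infinity_pt (V x - \<kappa> *\<^sub>R W x) + wedge (F x) ((1 / r x) *\<^sub>R (m x *\<^sub>R W x - l x *\<^sub>R V x))"
    unfolding e partial_FY[OF x] pr using r0
    by (simp add: wedge_simps wedge_swap[of "V x" "F x"] wedge_swap[of "V x" infinity_pt] wedge_swap[of "W x" infinity_pt]
        wedge_swap[of "W x" "V x"] algebra_simps two)
qed

text \<open>As \<open>\<kappa>\<close> squares to 1, the null vectors in the two partial derivatives
  are proportional. Hence all directions give multiples of one bivector, up to a wedge with
  \<open>F\<close>.\<close>

lemma frechet_derivative_T:
  assumes x: "x \<in> U" and \<kappa>: "\<kappa> \<in> {1, -1}"
  obtains Z where "frechet_derivative (T \<kappa>) (at x) a =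
    (a$1 - \<kappa> * a$2) *\<^sub>R wedge infinity_pt (W x - \<kappa> *\<^sub>R V x) + wedge (F x) Z"
proof
  have e: "V x - \<kappa> *\<^sub>R W x = (- \<kappa>) *\<^sub>R (W x - \<kappa> *\<^sub>R V x)"
    using \<kappa> by (auto simp: algebra_simps)
  show "frechet_derivative (T \<kappa>) (at x) a =
    (a$1 - \<kappa> * a$2) *\<^sub>R wedge infinity_pt (W x - \<kappa> *\<^sub>R V x) +
    wedge (F x) (a$1 *\<^sub>R (1 / r x) *\<^sub>R (l x *\<^sub>R W x - m x *\<^sub>R V x) + a$2 *\<^sub>R (1 / r x) *\<^sub>R (m x *\<^sub>R W x - l x *\<^sub>R V x))"
    unfolding frechet_derivative_partial[OF T_derivative(1)[OF x], of \<kappa> a] T_derivative(2,3)[OF x] e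
    unfolding wedge_simps(8)[of infinity_pt "- \<kappa>"] wedge_simps(2)[of "F x"] wedge_simps(8)[of "F x" "a $ _"]
    by (simp add: scaleR_add_right scaleR_diff_left scaleR_diff_right mult.commute)
qed

lemma proj_frame:
  assumes x: "x \<in> U"
  shows "proj_S42 (F x) (F x) = 0" "proj_S42 (F x) (V x) = V x" "proj_S42 (F x) (W x) = W x"
    "proj_S42 (F x) (Y x) = Y x" "proj_S42 (F x) infinity_pt = infinity_pt"
proof -
  interpret null_frame "F x" "V x" "W x" "Y x" infinity_pt "r x" oE by (rule null_frame[OF x])
  show "proj_S42 (F x) (F x) = 0" "proj_S42 (F x) (V x) = V x" "proj_S42 (F x) (W x) = W x"
    "proj_S42 (F x) (Y x) = Y x" "proj_S42 (F x) infinity_pt = infinity_pt"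
    by (simp_all add: proj_S42_def gram)
qed

lemma proj_T_derivative:
  assumes x: "x \<in> U" and \<kappa>: "\<kappa> \<in> {1, -1}"
  shows "matrix (proj_S42 (F x)) ** frechet_derivative (T \<kappa>) (at x) a ** transpose (matrix (proj_S42 (F x))) =
    (a$1 - \<kappa> * a$2) *\<^sub>R wedge infinity_pt (W x - \<kappa> *\<^sub>R V x)"
proof -
  obtain Z where Z: "frechet_derivative (T \<kappa>) (at x) a =
    (a$1 - \<kappa> * a$2) *\<^sub>R wedge infinity_pt (W x - \<kappa> *\<^sub>R V x) + wedge (F x) Z"
    using frechet_derivative_T[OF assms] by blast
  have wz: "wedge 0 Z' = 0" for Z' by (simp add: wedge_def vec_eq_iff)
  have e: "proj_S42 (F x) (W x - \<kappa> *\<^sub>R V x) = W x - \<kappa> *\<^sub>R V x"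
    by (simp add: linear_diff[OF proj_S42_linear] linear_scale[OF proj_S42_linear] proj_frame[OF x])
  have "(a$1 - \<kappa> * a$2) *\<^sub>R wedge infinity_pt (W x - \<kappa> *\<^sub>R V x) =
     wedge infinity_pt ((a$1 - \<kappa> * a$2) *\<^sub>R (W x - \<kappa> *\<^sub>R V x))"
    by (simp add: wedge_simps)
  moreover have "(S + T) ** M = S ** M + T ** M" for S T M :: "real^5^5"
    by (simp add: vec_eq_iff matrix_matrix_mult_def sum.distrib distrib_right)
  ultimately show ?thesis
    unfolding Z by (simp add: matrix_add_ldistrib wedge_linear_conj[OF proj_S42_linear]
        linear_scale[OF proj_S42_linear] e proj_frame[OF x] wz)
qed

lemma proj_T_derivative_lower5:
  assumes x: "x \<in> U" and \<kappa>: "\<kappa> \<in> {1, -1}" and y: "h5 (F x) y = 0"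
  shows "proj_S42 (F x) (frechet_derivative (T \<kappa>) (at x) a *v lower5 y) =
    (a$1 - \<kappa> * a$2) *\<^sub>R (h5 (W x - \<kappa> *\<^sub>R V x) y *\<^sub>R infinity_pt - h5 infinity_pt y *\<^sub>R (W x - \<kappa> *\<^sub>R V x))"
proof -
  obtain Z where Z: "frechet_derivative (T \<kappa>) (at x) a =
    (a$1 - \<kappa> * a$2) *\<^sub>R wedge infinity_pt (W x - \<kappa> *\<^sub>R V x) + wedge (F x) Z"
    using frechet_derivative_T[OF x \<kappa>] by blast
  show ?thesis
    unfolding Z by (simp add: matrix_vector_mult_add_rdistrib scaleR_matrix_vector_assoc[symmetric] wedge_lower5 y
        linear_diff[OF proj_S42_linear] linear_add[OF proj_S42_linear] linear_scale[OF proj_S42_linear] proj_frame[OF x])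
qed

text \<open>\<open>T\<close> is a bivector of the orthogonal complement of \<open>F\<close>, so
  projecting to the sphere before or after applying its endomorphism changes nothing.\<close>

lemma T_lower5:
  assumes x: "x \<in> U"
  shows "T \<kappa> x *v lower5 (F x) = 0" "h5 (F x) (T \<kappa> x *v lower5 y) = 0"
proof -
  interpret null_frame "F x" "V x" "W x" "Y x" infinity_pt "r x" oE by (rule null_frame[OF x])
  show "T \<kappa> x *v lower5 (F x) = 0" "h5 (F x) (T \<kappa> x *v lower5 y) = 0"
    by (simp_all add: T_def matrix_vector_mult_add_rdistrib scaleR_matrix_vector_assoc[symmetric] wedge_lower5
        gram gram' h5_simps)
qed

text \<open>The two factors span a totally null plane: in the norm of
  \<open>W x - \<kappa> *\<^sub>R V x\<close> the contributions \<open>- r x\<close> and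
  \<open>r x\<close> cancel.\<close>

lemma T_derivative_null:
  assumes x: "x \<in> U" and \<kappa>: "\<kappa> \<in> {1, -1}"
  shows "light_like (wedge infinity_pt (W x - \<kappa> *\<^sub>R V x))"
proof -
  interpret null_frame "F x" "V x" "W x" "Y x" infinity_pt "r x" oE by (rule null_frame[OF x])
  let ?z = "wedge infinity_pt (W x - \<kappa> *\<^sub>R V x)"
  \<comment> \<open>\<open>Y\<close> pairs nontrivially with \<open>infinity_pt\<close>, so
    evaluating there recovers the second factor; that factor is nonzero because its product with
    \<open>W x\<close> is.\<close>
  have "?z *v lower5 (Y x) = W x - \<kappa> *\<^sub>R V x"
    by (simp add: wedge_lower5 h5_simps gram gram')
  moreover have "h5 (W x) (W x - \<kappa> *\<^sub>R V x) \<noteq> 0"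
    using r_pos by (simp add: h5_simps gram gram')
  ultimately have "?z \<noteq> 0"
    by (auto simp: h5_explicit)
  moreover have "h_hat ?z ?z = 0"
    by (simp add: h_hat_wedge h5_simps gram gram')
  ultimately show ?thesis by (simp add: light_like_def)
qed

lemma l_m_continuous: "continuous_on U (\<lambda>x. (m x)\<^sup>2 - (l x)\<^sup>2)"
proof -
  have "l differentiable (at x)" "m differentiable (at x)" if "x \<in> U" for x
    using that unfolding l_def[abs_def] m_def[abs_def] by (auto intro!: diff_h3 diff n_diff)
  then have "continuous_on U l" "continuous_on U m"
    by (simp_all add: continuous_at_imp_continuous_on differentiable_imp_continuous_within)
  then show ?thesis by (intro continuous_intros)
qed

end

section \<open>Surfaces with an atlas\<close>

lemma chart_param:
  fixes A :: "'a::{t2_space, second_countable_topology} chart set"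
  assumes "lorentz_surface A" "c \<in> A"
  shows "open (fst c)" "open (snd c ` fst c)" "inj_on (snd c) (fst c)"
    "q \<in> fst c \<Longrightarrow> param c (snd c q) = q"
    "x \<in> snd c ` fst c \<Longrightarrow> param c x \<in> fst c" "x \<in> snd c ` fst c \<Longrightarrow> snd c (param c x) = x"
proof -
  have h: "homeomorphism (fst c) (snd c ` fst c) (snd c) (param c)"
    using assms by (auto simp: lorentz_surface_def)
  show "open (fst c)" "open (snd c ` fst c)"
    using assms by (auto simp: lorentz_surface_def)
  have "param c (snd c q) = q" if "q \<in> fst c" for q
    using h that by (simp add: homeomorphism_def)
  then show "inj_on (snd c) (fst c)" "q \<in> fst c \<Longrightarrow> param c (snd c q) = q"
    by (metis inj_onI, blast)
  show "x \<in> snd c ` fst c \<Longrightarrow> param c x \<in> fst c" "x \<in> snd c ` fst c \<Longrightarrow> snd c (param c x) = x"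
    by (simp_all add: inv_into_into f_inv_into_f)
qed

lemma chart_at_mem:
  fixes A :: "'a::{t2_space, second_countable_topology} chart set"
  assumes "lorentz_surface A"
  shows "chart_at A q \<in> A" "q \<in> fst (chart_at A q)"
proof -
  have "q \<in> (\<Union>c\<in>A. fst c)"
    using assms by (simp add: lorentz_surface_def)
  then have "\<exists>c. c \<in> A \<and> q \<in> fst c" by blast
  then show "chart_at A q \<in> A" "q \<in> fst (chart_at A q)"
    unfolding chart_at_def by (metis (mono_tags, lifting) someI_ex)+
qed

text \<open>Chain rule for the coordinate change. One \<open>D\<close> serves all maps and all
  directions, and its positive determinant carries the orientation.\<close>

lemma chart_change:
  fixes A :: "'a::{t2_space, second_countable_topology} chart set"
  assumes A: "lorentz_surface A" and c: "c \<in> A" "q \<in> fst c" and d: "d \<in> A" "q \<in> fst d"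
  obtains D where "linear D" "det (matrix D) > 0"
    "\<And>(g :: 'a \<Rightarrow> 'b::real_normed_vector) a.
       differentiable_in d g q \<Longrightarrow> deriv_along c a g q = deriv_along d (D a) g q"
proof
  let ?O = "snd c ` (fst c \<inter> fst d)" and ?\<tau> = "snd d \<circ> param c"
  let ?D = "frechet_derivative ?\<tau> (at (snd c q))"
  have x: "snd c q \<in> ?O" using c d by blast
  have "homeomorphism (fst c) (snd c ` fst c) (snd c) (param c)"
    using A c by (auto simp: lorentz_surface_def)
  \<comment> \<open>The overlap has an open image because the coordinate map is a homeomorphism onto
    an open set; only then do germs on the overlap determine the derivative.\<close>
  moreover have "openin (top_of_set (fst c)) (fst c \<inter> fst d)"
    using chart_param(1)[OF A c(1)] chart_param(1)[OF A d(1)] by (simp add: openin_open_Int)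
  ultimately have "openin (top_of_set (snd c ` fst c)) ?O"
    by (rule homeomorphism_imp_open_map)
  then have O: "open ?O"
    using chart_param(2)[OF A c(1)] openin_open_trans by blast
  have "smooth_on ?O ?\<tau>"
    using A c d by (auto simp: lorentz_surface_def)
  then have "Ck_on (Suc 0) ?O ?\<tau>" unfolding smooth_on_def by blast
  then have diff: "?\<tau> differentiable (at (snd c q))"
    using x unfolding Ck_on.simps by blast
  then show "linear ?D" by (rule linear_frechet_derivative)
  show "det (matrix ?D) > 0"
    using A c d x by (auto simp: lorentz_surface_def Let_def)
  fix g :: "'a \<Rightarrow> 'b" and a
  assume g: "differentiable_in d g q"
  have \<tau>x: "?\<tau> (snd c q) = snd d q"
    using chart_param(4)[OF A c] by simp
  have e: "(g \<circ> param c) y = ((g \<circ> param d) \<circ> ?\<tau>) y" if y: "y \<in> ?O" for y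
  proof -
    obtain q' where "q' \<in> fst c" "q' \<in> fst d" "y = snd c q'" using y by blast
    then show ?thesis using chart_param(4)[OF A c(1)] chart_param(4)[OF A d(1)] by simp
  qed
  have "frechet_derivative (g \<circ> param c) (at (snd c q)) = frechet_derivative ((g \<circ> param d) \<circ> ?\<tau>) (at (snd c q))"
    by (rule frechet_derivative_cong_open[OF O x e])
  also have "\<dots> = frechet_derivative (g \<circ> param d) (at (snd d q)) \<circ> ?D"
    using frechet_derivative_compose[OF diff, of "g \<circ> param d"] g unfolding \<tau>x differentiable_in_def by simp
  finally show "deriv_along c a g q = deriv_along d (?D a) g q"
    by (simp add: deriv_along_def)
qed

lemma det_linear_pair:
  assumes "linear (D :: real^2 \<Rightarrow> real^2)"
  shows "det (vector [D a, D b] :: real^2^2) = det (matrix D) * det (vector [a, b] :: real^2^2)"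
proof -
  have D: "D x = matrix D *v x" for x
    using assms by (simp add: matrix_works)
  have "vector [D a, D b] = (vector [a, b] :: real^2^2) ** transpose (matrix D)"
    unfolding D[of a] D[of b]
    by (simp add: vec_eq_iff forall_2 matrix_matrix_mult_def matrix_vector_mult_def transpose_def sum_2 mult.commute)
  then show ?thesis by (simp add: det_mul mult.commute)
qed

section \<open>Normal, Gauss map and curvature in an arbitrary chart\<close>

locale timelike_minimal_surface =
  fixes A :: "'a::{t2_space, second_countable_topology} chart set" and \<iota> :: "'a \<Rightarrow> real^3" and oE :: real
  assumes lorentz: "lorentz_surface A" and immersion: "timelike_conformal_immersion A \<iota>"
    and oE: "oE \<in> {1, -1}" and min: "minimal A oE \<iota>"
begin

lemma differentiable_immersion:
  assumes "c \<in> A" "x \<in> snd c ` fst c"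
  shows "(\<iota> \<circ> param c) differentiable (at x)"
proof -
  have "smooth_on (snd c ` fst c) (\<iota> \<circ> param c)"
    using immersion assms by (simp add: timelike_conformal_immersion_def)
  then have "Ck_on (Suc 0) (snd c ` fst c) (\<iota> \<circ> param c)" unfolding smooth_on_def by blast
  then show ?thesis using assms unfolding Ck_on.simps by blast
qed

lemma conformal:
  assumes "c \<in> A" "q \<in> fst c"
  shows "h3 (pd c 1 \<iota> q) (pd c 1 \<iota> q) > 0" "h3 (pd c 2 \<iota> q) (pd c 2 \<iota> q) = - h3 (pd c 1 \<iota> q) (pd c 1 \<iota> q)"
    "h3 (pd c 1 \<iota> q) (pd c 2 \<iota> q) = 0"
proof -
  obtain r where r: "r > 0" "induced_metric c \<iota> q = vector [vector [r, 0], vector [0, -r]]"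
    using immersion assms by (auto simp: timelike_conformal_immersion_def)
  have "h3 (pd c i \<iota> q) (pd c j \<iota> q) = vector [vector [r, 0], vector [0, -r]] $ i $ j" for i j
    unfolding r(2)[symmetric] by (simp add: induced_metric_def)
  from this[of 1 1] this[of 1 2] this[of 2 2] r(1)
  show "h3 (pd c 1 \<iota> q) (pd c 1 \<iota> q) > 0" "h3 (pd c 2 \<iota> q) (pd c 2 \<iota> q) = - h3 (pd c 1 \<iota> q) (pd c 1 \<iota> q)"
    "h3 (pd c 1 \<iota> q) (pd c 2 \<iota> q) = 0"
    by simp_all
qed

text \<open>The normal computed in \<open>c\<close> meets the defining conditions in the reference
  chart too, since the two tangent frames differ by a matrix of positive determinant.\<close>

lemma unit_normal_eq:
  assumes c: "c \<in> A" "q \<in> fst c"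
  shows "unit_normal A oE \<iota> q = normal3 oE (pd c 1 \<iota> q) (pd c 2 \<iota> q)"
proof -
  let ?d = "chart_at A q"
  have d: "?d \<in> A" "q \<in> fst ?d" using chart_at_mem[OF lorentz] by auto
  let ?n = "normal3 oE (pd c 1 \<iota> q) (pd c 2 \<iota> q)"
  note g = normal3_gram[OF conformal[OF c] oE] and dt = normal3_det[OF conformal[OF c] oE]
  obtain D where D: "linear D" "det (matrix D) > 0"
    "\<And>a. differentiable_in c \<iota> q \<Longrightarrow> deriv_along ?d a \<iota> q = deriv_along c (D a) \<iota> q"
    using chart_change[OF lorentz d c, where ?'b = "real^3"] by metis
  have diff: "(\<iota> \<circ> param c) differentiable (at (snd c q))"
    using differentiable_immersion c by blast
  have e: "pd ?d i \<iota> q = D (axis i 1) $ 1 *\<^sub>R pd c 1 \<iota> q + D (axis i 1) $ 2 *\<^sub>R pd c 2 \<iota> q" for i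
    using D(3)[of "axis i 1"] frechet_derivative_partial[OF diff, of "D (axis i 1)"] diff
    by (simp add: differentiable_in_def deriv_along_def)
  have "oE * det (vector [pd ?d 1 \<iota> q, pd ?d 2 \<iota> q, ?n] :: real^3^3) =
      det (matrix D) * (oE * det (vector [pd c 1 \<iota> q, pd c 2 \<iota> q, ?n] :: real^3^3))"
    unfolding e by (simp add: det_2 det_3 matrix_def algebra_simps)
  then have "oE * det (vector [pd ?d 1 \<iota> q, pd ?d 2 \<iota> q, ?n] :: real^3^3) > 0"
    using dt D(2) conformal(1)[OF c] by simp
  moreover have n: "h3 ?n (pd ?d i \<iota> q) = 0" for i
    unfolding e using g by (simp add: h3_simps h3_commute)
  ultimately have n_eq: "?n = normal3 oE (pd ?d 1 \<iota> q) (pd ?d 2 \<iota> q)"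
    using normal3_unique[OF conformal[OF d] oE g(1)] by blast
  have P: "h3 ?n ?n = 1 \<and> (let c = ?d in h3 ?n (pd c 1 \<iota> q) = 0 \<and> h3 ?n (pd c 2 \<iota> q) = 0 \<and>
        oE * det (vector [pd c 1 \<iota> q, pd c 2 \<iota> q, ?n] :: real^3^3) > 0)"
    using n \<open>oE * det (vector [pd ?d 1 \<iota> q, pd ?d 2 \<iota> q, ?n] :: real^3^3) > 0\<close> g(1) by (simp add: Let_def)
  show ?thesis
    unfolding unit_normal_def
  proof (rule the_equality, rule P)
    fix n
    assume "h3 n n = 1 \<and> (let c = ?d in h3 n (pd c 1 \<iota> q) = 0 \<and> h3 n (pd c 2 \<iota> q) = 0 \<and>
        oE * det (vector [pd c 1 \<iota> q, pd c 2 \<iota> q, n] :: real^3^3) > 0)"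
    then show "n = ?n"
      unfolding n_eq using normal3_unique[OF conformal[OF d] oE, of n] by (simp add: Let_def)
  qed
qed

end

lemma matrix_inv_diag2:
  assumes "r \<noteq> 0"
  shows "matrix_inv (vector [vector [r, 0], vector [0, - r]] :: real^2^2) = vector [vector [1 / r, 0], vector [0, - 1 / r]]"
    (is "matrix_inv ?M = ?N")
proof -
  have MN: "?M ** ?N = mat 1" "?N ** ?M = mat 1"
    using assms by (simp_all add: vec_eq_iff forall_2 matrix_matrix_mult_def mat_def sum_2)
  then have "invertible ?M" by (auto simp: invertible_def)
  then have "matrix_inv ?M ** ?M = mat 1" by (simp add: invertible_def matrix_inv_def) (metis (mono_tags, lifting) someI_ex)
  then have "matrix_inv ?M ** (?M ** ?N) = ?N" by (simp add: matrix_mul_assoc)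
  then show ?thesis unfolding MN(1) by (simp only: matrix_mul_rid)
qed

locale surface_chart = timelike_minimal_surface A \<iota> oE
  for A :: "'a::{t2_space, second_countable_topology} chart set" and \<iota> oE +
  fixes c :: "'a chart"
  assumes c: "c \<in> A"
begin

lemmas param = chart_param[OF lorentz c]

lemma pd_eq:
  assumes "q \<in> fst c" "\<And>y. y \<in> snd c ` fst c \<Longrightarrow> g (param c y) = G y"
  shows "deriv_along c a g q = frechet_derivative G (at (snd c q)) a"
  unfolding deriv_along_def
  using frechet_derivative_cong_open[OF param(2), of "snd c q" "g \<circ> param c" G] assms by simp

lemma pd_immersion: "q \<in> fst c \<Longrightarrow> pd c i \<iota> q = partial i (\<iota> \<circ> param c) (snd c q)"
  by (rule pd_eq) simp_all

lemma pd_pd_immersion: "q \<in> fst c \<Longrightarrow> pd c i (pd c j \<iota>) q = partial i (partial j (\<iota> \<circ> param c)) (snd c q)"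
  by (rule pd_eq) (simp_all add: pd_immersion param)

lemma induced_metric_eq:
  assumes "q \<in> fst c"
  defines "r \<equiv> h3 (pd c 1 \<iota> q) (pd c 1 \<iota> q)"
  shows "induced_metric c \<iota> q = vector [vector [r, 0], vector [0, - r]]"
  using conformal[OF c assms(1)]
  by (simp add: induced_metric_def vec_eq_iff forall_2 r_def h3_commute)

sublocale minimal_patch "snd c ` fst c" "\<iota> \<circ> param c" oE
proof
  show "open (snd c ` fst c)" by (rule param)
  show "smooth_on (snd c ` fst c) (\<iota> \<circ> param c)"
    using immersion c by (simp add: timelike_conformal_immersion_def)
  show "oE \<in> {1, -1}" by (rule oE)
  fix x assume "x \<in> snd c ` fst c"
  then obtain q where q: "q \<in> fst c" "x = snd c q" by blast
  note cf = conformal[OF c q(1)]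
  show "h3 (partial 1 (\<iota> \<circ> param c) x) (partial 1 (\<iota> \<circ> param c) x) > 0"
    "h3 (partial 2 (\<iota> \<circ> param c) x) (partial 2 (\<iota> \<circ> param c) x) =
      - h3 (partial 1 (\<iota> \<circ> param c) x) (partial 1 (\<iota> \<circ> param c) x)"
    "h3 (partial 1 (\<iota> \<circ> param c) x) (partial 2 (\<iota> \<circ> param c) x) = 0"
    using cf by (simp_all add: pd_immersion q)
  let ?r = "h3 (pd c 1 \<iota> q) (pd c 1 \<iota> q)" and ?n = "normal3 oE (pd c 1 \<iota> q) (pd c 2 \<iota> q)"
  have "mean_curvature c \<iota> (unit_normal A oE \<iota>) q = 0"
    using min c q by (simp add: minimal_def)
  then have "(1 / ?r) * h3 (pd c 1 (pd c 1 \<iota>) q) ?n - (1 / ?r) * h3 (pd c 2 (pd c 2 \<iota>) q) ?n = 0"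
    using cf(1) unfolding mean_curvature_def induced_metric_eq[OF q(1)] unit_normal_eq[OF c q(1)]
    by (simp add: matrix_inv_diag2 sum_2)
  then have "h3 (pd c 1 (pd c 1 \<iota>) q) ?n = h3 (pd c 2 (pd c 2 \<iota>) q) ?n"
    using cf(1) by (simp add: field_simps)
  then show "h3 (partial 1 (partial 1 (\<iota> \<circ> param c)) x)
      (normal3 oE (partial 1 (\<iota> \<circ> param c) x) (partial 2 (\<iota> \<circ> param c) x)) =
     h3 (partial 2 (partial 2 (\<iota> \<circ> param c)) x)
      (normal3 oE (partial 1 (\<iota> \<circ> param c) x) (partial 2 (\<iota> \<circ> param c) x))"
    by (simp add: pd_immersion pd_pd_immersion q)
qed

end

context surface_chart
begin

lemma unit_normal_chart: "q \<in> fst c \<Longrightarrow> unit_normal A oE \<iota> q = n (snd c q)"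
  by (simp add: unit_normal_eq[OF c] n_def pd_immersion)

lemma gauss_map_chart: "q \<in> fst c \<Longrightarrow> gauss_map A oE \<iota> q = F (snd c q)"
  using frechet_derivative_at[OF has_derivative_emb, of "\<iota> q"]
  by (simp add: gauss_map_def F_def unit_normal_chart param)

lemma emb_chart: "q \<in> fst c \<Longrightarrow> emb (\<iota> q) = Y (snd c q)"
  by (simp add: Y_def param)

lemma deriv_gauss_map: "q \<in> fst c \<Longrightarrow>
    deriv_along c a (gauss_map A oE \<iota>) q = frechet_derivative F (at (snd c q)) a"
  by (rule pd_eq) (simp_all add: gauss_map_chart param)

lemma deriv_unit_normal: "q \<in> fst c \<Longrightarrow>
    deriv_along c a (unit_normal A oE \<iota>) q = frechet_derivative n (at (snd c q)) a"
  by (rule pd_eq) (simp_all add: unit_normal_chart param)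

lemma deriv_immersion: "deriv_along c a \<iota> q = frechet_derivative (\<iota> \<circ> param c) (at (snd c q)) a"
  by (simp add: deriv_along_def)

lemma metric_chart: "q \<in> fst c \<Longrightarrow>
    induced_metric c \<iota> q = vector [vector [r (snd c q), 0], vector [0, - r (snd c q)]]"
  by (simp add: induced_metric_eq r_def pd_immersion)

lemma pd_metric:
  assumes "q \<in> fst c"
  shows "pd c i (\<lambda>q. induced_metric c \<iota> q $ 1 $ 1) q = partial i r (snd c q)"
    "pd c i (\<lambda>q. induced_metric c \<iota> q $ 1 $ 2) q = 0"
    "pd c i (\<lambda>q. induced_metric c \<iota> q $ 2 $ 1) q = 0"
    "pd c i (\<lambda>q. induced_metric c \<iota> q $ 2 $ 2) q = - partial i r (snd c q)"
proof -
  have x: "snd c q \<in> snd c ` fst c" using assms by blast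
  show "pd c i (\<lambda>q. induced_metric c \<iota> q $ 1 $ 1) q = partial i r (snd c q)"
    by (rule pd_eq[OF assms]) (simp add: metric_chart param)
  have "pd c i (\<lambda>q. induced_metric c \<iota> q $ 1 $ 2) q = partial i (\<lambda>y. 0 :: real) (snd c q)"
    "pd c i (\<lambda>q. induced_metric c \<iota> q $ 2 $ 1) q = partial i (\<lambda>y. 0 :: real) (snd c q)"
    by (rule pd_eq[OF assms], simp add: metric_chart param)+
  then show "pd c i (\<lambda>q. induced_metric c \<iota> q $ 1 $ 2) q = 0" "pd c i (\<lambda>q. induced_metric c \<iota> q $ 2 $ 1) q = 0"
    by simp_all
  have "pd c i (\<lambda>q. induced_metric c \<iota> q $ 2 $ 2) q = partial i (\<lambda>y. - r y) (snd c q)"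
    by (rule pd_eq[OF assms]) (simp add: metric_chart param)
  then show "pd c i (\<lambda>q. induced_metric c \<iota> q $ 2 $ 2) q = - partial i r (snd c q)"
    using frechet_derivative_minus[OF r_diff[OF x]] by simp
qed

text \<open>These are the symbols that occur in \<open>riemann\<close> with indices 1, 1, 2, 2, the
  only component that a diagonal metric leaves in the curvature.\<close>

lemma christoffel_chart:
  assumes q: "q \<in> fst c"
  shows "christoffel c (induced_metric c \<iota>) 1 1 1 q = gu (snd c q)" "christoffel c (induced_metric c \<iota>) 1 1 2 q = gv (snd c q)"
    "christoffel c (induced_metric c \<iota>) 1 2 1 q = gv (snd c q)" "christoffel c (induced_metric c \<iota>) 1 2 2 q = gu (snd c q)"
    "christoffel c (induced_metric c \<iota>) 2 1 2 q = gu (snd c q)" "christoffel c (induced_metric c \<iota>) 2 2 2 q = gv (snd c q)"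
proof -
  have "r (snd c q) \<noteq> 0" using r_pos[of "snd c q"] q by fastforce
  note i = matrix_inv_diag2[OF this]
  show "christoffel c (induced_metric c \<iota>) 1 1 1 q = gu (snd c q)" "christoffel c (induced_metric c \<iota>) 1 1 2 q = gv (snd c q)"
    "christoffel c (induced_metric c \<iota>) 1 2 1 q = gv (snd c q)" "christoffel c (induced_metric c \<iota>) 1 2 2 q = gu (snd c q)"
    "christoffel c (induced_metric c \<iota>) 2 1 2 q = gu (snd c q)" "christoffel c (induced_metric c \<iota>) 2 2 2 q = gv (snd c q)"
    unfolding christoffel_def metric_chart[OF q] i
    by (simp_all add: sum_2 pd_metric[OF q] gu_def gv_def)
qed

definition K :: "real^2 \<Rightarrow> real" where "K x = ((m x)\<^sup>2 - (l x)\<^sup>2) / (r x)\<^sup>2"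

lemma gauss_curvature_chart:
  assumes q: "q \<in> fst c"
  shows "gauss_curvature c (induced_metric c \<iota>) q = K (snd c q)"
proof -
  have x: "snd c q \<in> snd c ` fst c" using q by blast
  have r: "r (snd c q) \<noteq> 0" using r_pos[OF x] by simp
  have "pd c 1 (christoffel c (induced_metric c \<iota>) 1 2 2) q = partial 1 gu (snd c q)"
    "pd c 2 (christoffel c (induced_metric c \<iota>) 1 1 2) q = partial 2 gv (snd c q)"
    by (rule pd_eq[OF q], simp add: christoffel_chart param)+
  \<comment> \<open>The quadratic terms in the Christoffel symbols cancel, which leaves the left
    side of \<open>gauss_equation\<close>.\<close>
  then have "riemann c (induced_metric c \<iota>) 1 1 2 2 q = ((l (snd c q))\<^sup>2 - (m (snd c q))\<^sup>2) / r (snd c q)"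
    using gauss_equation[OF x] by (simp add: riemann_def sum_2 christoffel_chart[OF q])
  then show ?thesis
    using r by (simp add: gauss_curvature_def sum_2 metric_chart[OF q] det_2 K_def field_simps power2_eq_square)
qed

text \<open>A characterization of \<open>K\<close> by two quadratic forms that do not depend on
  coordinates. It holds because the surface is minimal.\<close>

lemma third_fundamental_form:
  assumes q: "q \<in> fst c"
  shows "h3 (deriv_along c a (unit_normal A oE \<iota>) q) (deriv_along c a (unit_normal A oE \<iota>) q) =
    - K (snd c q) * h3 (deriv_along c a \<iota> q) (deriv_along c a \<iota> q)"
proof -
  have x: "snd c q \<in> snd c ` fst c" using q by blast
  have r: "r (snd c q) \<noteq> 0" using r_pos[OF x] by simp
  let ?x = "snd c q"
  define s t where "s = a$1 * m ?x + a$2 * l ?x" and "t = a$1 * l ?x + a$2 * m ?x"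
  have e: "deriv_along c a (unit_normal A oE \<iota>) q = (1 / r ?x) *\<^sub>R (s *\<^sub>R f2 ?x - t *\<^sub>R f1 ?x)"
    unfolding deriv_unit_normal[OF q] frechet_derivative_partial[OF n_diff[OF x], of a] weingarten[OF x]
    by (simp add: s_def t_def algebra_simps)
  have "h3 (deriv_along c a (unit_normal A oE \<iota>) q) (deriv_along c a (unit_normal A oE \<iota>) q) = (t\<^sup>2 - s\<^sup>2) / r ?x"
    unfolding e using r by (simp add: h3_simps conf[OF x] power2_eq_square diff_divide_distrib)
  moreover have "t\<^sup>2 - s\<^sup>2 = ((l ?x)\<^sup>2 - (m ?x)\<^sup>2) * ((a$1)\<^sup>2 - (a$2)\<^sup>2)"
    by (simp add: s_def t_def power2_eq_square algebra_simps)
  moreover have "h3 (deriv_along c a \<iota> q) (deriv_along c a \<iota> q) = r ?x * ((a$1)\<^sup>2 - (a$2)\<^sup>2)"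
    unfolding deriv_immersion frechet_derivative_partial[OF diff(1)[OF x], of a]
    by (simp add: h3_simps conf[OF x] power2_eq_square algebra_simps)
  moreover have "((l ?x)\<^sup>2 - (m ?x)\<^sup>2) * B / r ?x = - K ?x * (r ?x * B)" for B
  proof -
    have "- K ?x * (r ?x * B) = (((l ?x)\<^sup>2 - (m ?x)\<^sup>2) * B / r ?x) * (r ?x * r ?x / (r ?x)\<^sup>2)"
      by (simp add: K_def minus_divide_left)
    then show ?thesis using r by (simp add: power2_eq_square)
  qed
  ultimately show ?thesis by simp
qed

lemma differentiable_chart:
  assumes q: "q \<in> fst c"
  shows "differentiable_in c \<iota> q" "differentiable_in c (unit_normal A oE \<iota>) q"
    "differentiable_in c (gauss_map A oE \<iota>) q"
proof -
  have x: "snd c q \<in> snd c ` fst c" using q by blast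
  show "differentiable_in c \<iota> q"
    using diff(1)[OF x] by (simp add: differentiable_in_def)
  show "differentiable_in c (unit_normal A oE \<iota>) q"
    using differentiable_cong_open[OF param(2) x, of "unit_normal A oE \<iota> \<circ> param c" n] n_diff[OF x]
    by (simp add: differentiable_in_def unit_normal_chart param)
  show "differentiable_in c (gauss_map A oE \<iota>) q"
    using differentiable_cong_open[OF param(2) x, of "gauss_map A oE \<iota> \<circ> param c" F] diff_FY(1)[OF x]
    by (simp add: differentiable_in_def gauss_map_chart param)
qed

text \<open>Comparing the ratio of the third and first fundamental forms on one tangent vector seen
  in both charts replaces the transformation law of the curvature tensor. The vector is space-like,
  so the first form does not vanish on it.\<close>

lemma curvature_chart:
  assumes q: "q \<in> fst c"
  shows "curvature A \<iota> q = K (snd c q)"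
proof -
  let ?d = "chart_at A q"
  have d: "?d \<in> A" "q \<in> fst ?d" using chart_at_mem[OF lorentz] by auto
  interpret d: surface_chart A \<iota> oE ?d by unfold_locales (rule d)
  obtain D where D: "\<And>(g :: 'a \<Rightarrow> real^3) a. differentiable_in c g q \<Longrightarrow> deriv_along ?d a g q = deriv_along c (D a) g q"
    using chart_change[OF lorentz d c q, where ?'b = "real^3"] by metis
  have "d.K (snd ?d q) * h3 (pd ?d 1 \<iota> q) (pd ?d 1 \<iota> q) = K (snd c q) * h3 (pd ?d 1 \<iota> q) (pd ?d 1 \<iota> q)"
    using third_fundamental_form[OF q, of "D (axis 1 1)"] d.third_fundamental_form[OF d(2), of "axis 1 1"]
    by (auto simp: D differentiable_chart[OF q])
  then have "d.K (snd ?d q) = K (snd c q)"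
    using conformal(1)[OF d] by simp
  then show ?thesis
    using d.gauss_curvature_chart[OF d(2)] by (simp add: curvature_def Let_def)
qed

end

section \<open>Adapted frames and twistor lifts\<close>

text \<open>\<open>adapted_frame\<close> with the chart as a parameter, in order to pass from the
  reference chart to any other.\<close>

definition adapted_in ::
    "'a chart \<Rightarrow> real \<Rightarrow> ('a \<Rightarrow> real^5) \<Rightarrow> 'a \<Rightarrow> real^5 \<Rightarrow> real^5 \<Rightarrow> real^5 \<Rightarrow> real^5 \<Rightarrow> bool" where
  "adapted_in c oS G q e1 e2 e3 e4 \<longleftrightarrow> pos_frame oS (G q) e1 e2 e3 e4 \<and>
     (\<exists>a b. e1 = deriv_along c a G q \<and> e3 = deriv_along c b G q \<and> det (vector [a, b] :: real^2^2) > 0) \<and>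
     (\<forall>a. h5 e2 (deriv_along c a G q) = 0 \<and> h5 e4 (deriv_along c a G q) = 0)"

lemma adapted_in_change:
  fixes A :: "'a::{t2_space, second_countable_topology} chart set"
  assumes A: "lorentz_surface A" and c: "c \<in> A" "q \<in> fst c" and d: "d \<in> A" "q \<in> fst d"
    and diff: "differentiable_in d G q" and ad: "adapted_in c oS G q e1 e2 e3 e4"
  shows "adapted_in d oS G q e1 e2 e3 e4"
proof -
  obtain D where D: "linear D" "det (matrix D) > 0" "\<And>a. deriv_along c a G q = deriv_along d (D a) G q"
    using chart_change[OF A c d, where ?'b = "real^5"] diff by metis
  \<comment> \<open>Surjectivity of \<open>D\<close> is what transfers the normality condition,
    which ranges over all directions of the second chart.\<close>
  have "inj D" using D(1,2) det_nz_iff_inj by fastforce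
  then have surj: "surj D" using D(1) linear_injective_imp_surjective by blast
  obtain a b where ab: "e1 = deriv_along c a G q" "e3 = deriv_along c b G q" "det (vector [a, b] :: real^2^2) > 0"
    using ad by (auto simp: adapted_in_def)
  have "det (vector [D a, D b] :: real^2^2) > 0"
    using ab(3) D(2) by (simp add: det_linear_pair[OF D(1)])
  moreover have "h5 e2 (deriv_along d a G q) = 0 \<and> h5 e4 (deriv_along d a G q) = 0" for a
  proof -
    obtain a' where "a = D a'" using surj by auto
    then show ?thesis using ad D(3)[of a'] unfolding adapted_in_def by metis
  qed
  ultimately show ?thesis
    using ab(1,2) ad D(3) unfolding adapted_in_def by metis
qed

context surface_chart
begin

lemma null_frame_chart: "q \<in> fst c \<Longrightarrow>
    null_frame (F (snd c q)) (V (snd c q)) (W (snd c q)) (Y (snd c q)) infinity_pt (r (snd c q)) oE"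
  by (rule null_frame) blast

lemma deriv_gauss_map_frame:
  assumes q: "q \<in> fst c"
  shows "deriv_along c a (gauss_map A oE \<iota>) q =
    (- (l (snd c q) * a$1 + m (snd c q) * a$2) / r (snd c q)) *\<^sub>R V (snd c q) +
    ((m (snd c q) * a$1 + l (snd c q) * a$2) / r (snd c q)) *\<^sub>R W (snd c q)"
proof -
  have x: "snd c q \<in> snd c ` fst c" using q by blast
  show ?thesis
    unfolding deriv_gauss_map[OF q] frechet_derivative_partial[OF diff_FY(1)[OF x], of a] partial_FY[OF x]
    by (simp add: algebra_simps add_divide_distrib diff_divide_distrib)
qed

lemma K_nonzero: "q \<in> fst c \<Longrightarrow> K (snd c q) \<noteq> 0 \<longleftrightarrow> (m (snd c q))\<^sup>2 - (l (snd c q))\<^sup>2 \<noteq> 0"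
  using r_pos[of "snd c q"] by (fastforce simp: K_def)

text \<open>In the basis \<open>V\<close>, \<open>W\<close> the derivative of \<open>F\<close> has
  determinant \<open>K\<close>; where this is nonzero, \<open>F\<close> and \<open>Y\<close> have
  the same tangent plane.\<close>

lemma normal_iff:
  assumes q: "q \<in> fst c" and K: "K (snd c q) \<noteq> 0"
  shows "(\<forall>a. h5 v (deriv_along c a (gauss_map A oE \<iota>) q) = 0) \<longleftrightarrow> h5 (V (snd c q)) v = 0 \<and> h5 (W (snd c q)) v = 0"
proof
  let ?x = "snd c q"
  have r: "r ?x > 0" using q r_pos by blast
  have D: "(m ?x)\<^sup>2 - (l ?x)\<^sup>2 \<noteq> 0" using K K_nonzero[OF q] by blast
  assume "\<forall>a. h5 v (deriv_along c a (gauss_map A oE \<iota>) q) = 0"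
  then have "h5 v (deriv_along c (axis 1 1) (gauss_map A oE \<iota>) q) = 0"
    "h5 v (deriv_along c (axis 2 1) (gauss_map A oE \<iota>) q) = 0" by blast+
  then have e: "m ?x * h5 v (W ?x) = l ?x * h5 v (V ?x)" "l ?x * h5 v (W ?x) = m ?x * h5 v (V ?x)"
    unfolding deriv_gauss_map_frame[OF q] using r by (simp_all add: h5_simps axis_def field_simps)
  have "((m ?x)\<^sup>2 - (l ?x)\<^sup>2) * h5 v (V ?x) = m ?x * (m ?x * h5 v (V ?x)) - l ?x * (l ?x * h5 v (V ?x))"
    "((m ?x)\<^sup>2 - (l ?x)\<^sup>2) * h5 v (W ?x) = m ?x * (m ?x * h5 v (W ?x)) - l ?x * (l ?x * h5 v (W ?x))"
    by (simp_all add: power2_eq_square algebra_simps)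
  moreover have "m ?x * (m ?x * h5 v (V ?x)) - l ?x * (l ?x * h5 v (V ?x)) = 0"
    "m ?x * (m ?x * h5 v (W ?x)) - l ?x * (l ?x * h5 v (W ?x)) = 0"
    unfolding e[symmetric] by simp (simp add: e)
  ultimately show "h5 (V ?x) v = 0 \<and> h5 (W ?x) v = 0"
    using D by (simp add: h5_commute)
next
  assume "h5 (V (snd c q)) v = 0 \<and> h5 (W (snd c q)) v = 0"
  then show "\<forall>a. h5 v (deriv_along c a (gauss_map A oE \<iota>) q) = 0"
    by (simp add: deriv_gauss_map_frame[OF q] h5_simps h5_commute[of v])
qed

lemma adapted_frame_iff:
  assumes q: "q \<in> fst c"
  shows "adapted_frame A oS (gauss_map A oE \<iota>) q e1 e2 e3 e4 \<longleftrightarrow> adapted_in c oS (gauss_map A oE \<iota>) q e1 e2 e3 e4"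
proof -
  let ?d = "chart_at A q"
  have d: "?d \<in> A" "q \<in> fst ?d" using chart_at_mem[OF lorentz] by auto
  interpret d: surface_chart A \<iota> oE ?d by unfold_locales (rule d)
  have "adapted_frame A oS (gauss_map A oE \<iota>) q e1 e2 e3 e4 \<longleftrightarrow> adapted_in ?d oS (gauss_map A oE \<iota>) q e1 e2 e3 e4"
    by (simp add: adapted_frame_def adapted_in_def Let_def)
  then show ?thesis
    using adapted_in_change[OF lorentz c q d d.differentiable_chart(3)[OF d(2)]]
      adapted_in_change[OF lorentz d c q differentiable_chart(3)[OF q]] by blast
qed

text \<open>Adapted frames are positively oriented in the chart. Since the derivative of
  \<open>F\<close> has determinant \<open>K\<close> in the basis \<open>V\<close>, \<open>W\<close>,
  their orientation relative to that basis is the sign of \<open>K\<close>.\<close>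

lemma Omega2_chart:
  assumes q: "q \<in> fst c" and K: "K (snd c q) \<noteq> 0" and oS: "oS \<in> {1, -1}"
    and ad: "adapted_in c oS (gauss_map A oE \<iota>) q e1 e2 e3 e4"
  shows "Omega2 \<epsilon> e1 e2 e3 e4 = (sgn (K (snd c q)) / sqrt 2) *\<^sub>R T (\<epsilon> * oE * oS) (snd c q)"
proof -
  let ?x = "snd c q"
  interpret nf: null_frame "F ?x" "V ?x" "W ?x" "Y ?x" infinity_pt "r ?x" oE by (rule null_frame_chart[OF q])
  obtain a b where ab: "e1 = deriv_along c a (gauss_map A oE \<iota>) q" "e3 = deriv_along c b (gauss_map A oE \<iota>) q"
    "det (vector [a, b] :: real^2^2) > 0"
    using ad by (auto simp: adapted_in_def)
  have fr: "pos_frame oS (F ?x) e1 e2 e3 e4"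
    using ad gauss_map_chart[OF q] by (simp add: adapted_in_def)
  have n: "h5 (V ?x) e2 = 0 \<and> h5 (W ?x) e2 = 0" "h5 (V ?x) e4 = 0 \<and> h5 (W ?x) e4 = 0"
    using ad normal_iff[OF q K] by (auto simp: adapted_in_def)
  have s: "sgn (K ?x) \<in> {1, -1}" using K by (simp add: sgn_if)
  have alg: "- X / R * (Y / R) - Z / R * (- X' / R) = (X' * Z - X * Y) / R\<^sup>2" for X Y Z X' R :: real
    by (simp add: power2_eq_square diff_divide_distrib mult.commute)
  have "- (l ?x * a$1 + m ?x * a$2) / r ?x * ((m ?x * b$1 + l ?x * b$2) / r ?x) -
      (m ?x * a$1 + l ?x * a$2) / r ?x * (- (l ?x * b$1 + m ?x * b$2) / r ?x)
    = ((l ?x * b$1 + m ?x * b$2) * (m ?x * a$1 + l ?x * a$2)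
        - (l ?x * a$1 + m ?x * a$2) * (m ?x * b$1 + l ?x * b$2)) / (r ?x)\<^sup>2"
    by (rule alg)
  also have "(l ?x * b$1 + m ?x * b$2) * (m ?x * a$1 + l ?x * a$2)
        - (l ?x * a$1 + m ?x * a$2) * (m ?x * b$1 + l ?x * b$2) =
      ((m ?x)\<^sup>2 - (l ?x)\<^sup>2) * (a$1 * b$2 - a$2 * b$1)"
    by (simp add: power2_eq_square algebra_simps)
  finally have d: "- (l ?x * a$1 + m ?x * a$2) / r ?x * ((m ?x * b$1 + l ?x * b$2) / r ?x) -
      (m ?x * a$1 + l ?x * a$2) / r ?x * (- (l ?x * b$1 + m ?x * b$2) / r ?x) = K ?x * (a$1 * b$2 - a$2 * b$1)"
    by (simp only: K_def times_divide_eq_left)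
  have "a$1 * b$2 - a$2 * b$1 > 0" using ab(3) by (simp add: det_2)
  then have "sgn (K ?x) * (K ?x * (a$1 * b$2 - a$2 * b$1)) > 0"
    using K by (simp add: sgn_if zero_less_mult_iff mult_less_0_iff)
  then have pos: "sgn (K ?x) * (- (l ?x * a$1 + m ?x * a$2) / r ?x * ((m ?x * b$1 + l ?x * b$2) / r ?x) -
      (m ?x * a$1 + l ?x * a$2) / r ?x * (- (l ?x * b$1 + m ?x * b$2) / r ?x)) > 0"
    by (simp only: d)
  have "Omega2 \<epsilon> e1 e2 e3 e4 = nf.lift oS \<epsilon> (sgn (K ?x))"
    using nf.Omega2_adapted[OF fr ab(1)[unfolded deriv_gauss_map_frame[OF q]] ab(2)[unfolded deriv_gauss_map_frame[OF q]]
        _ _ _ _ s pos oS] n by blast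
  then show ?thesis by (simp add: nf.lift_def T_def)
qed

lemma ex_adapted:
  assumes q: "q \<in> fst c" and K: "K (snd c q) \<noteq> 0" and oS: "oS \<in> {1, -1}"
  shows "\<exists>e1 e2 e3 e4. adapted_in c oS (gauss_map A oE \<iota>) q e1 e2 e3 e4"
proof -
  let ?x = "snd c q"
  interpret nf: null_frame "F ?x" "V ?x" "W ?x" "Y ?x" infinity_pt "r ?x" oE by (rule null_frame_chart[OF q])
  define s where "s = sgn (K ?x)"
  define k where "k = r ?x / ((l ?x)\<^sup>2 - (m ?x)\<^sup>2)"
  have D: "(l ?x)\<^sup>2 - (m ?x)\<^sup>2 \<noteq> 0" using K K_nonzero[OF q] by simp
  have s: "s \<in> {1, -1}" using K by (simp add: s_def sgn_if)
  \<comment> \<open>Preimages, under the derivative of \<open>F\<close>, of unit vectors along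
    \<open>V\<close> and \<open>W\<close>: up to scale, the columns of the inverse matrix, with its
    determinant absorbed in \<open>k\<close>. The sign \<open>s\<close> keeps the pair positively
    oriented in the chart.\<close>
  let ?a = "(k / sqrt (r ?x)) *\<^sub>R vector [- l ?x, m ?x] :: real^2"
  let ?b = "(s * k / sqrt (r ?x)) *\<^sub>R vector [- m ?x, l ?x] :: real^2"
  have kk: "k * ((l ?x)\<^sup>2 - (m ?x)\<^sup>2) / r ?x = 1"
    using D nf.r_pos by (simp add: k_def)
  have "deriv_along c ?a (gauss_map A oE \<iota>) q = (k * ((l ?x)\<^sup>2 - (m ?x)\<^sup>2) / r ?x / sqrt (r ?x)) *\<^sub>R V ?x"
    "deriv_along c ?b (gauss_map A oE \<iota>) q = (k * ((l ?x)\<^sup>2 - (m ?x)\<^sup>2) / r ?x * s / sqrt (r ?x)) *\<^sub>R W ?x"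
    unfolding deriv_gauss_map_frame[OF q] by (simp_all add: power2_eq_square algebra_simps diff_divide_distrib)
  then have ab: "deriv_along c ?a (gauss_map A oE \<iota>) q = (1 / sqrt (r ?x)) *\<^sub>R V ?x"
    "deriv_along c ?b (gauss_map A oE \<iota>) q = (s / sqrt (r ?x)) *\<^sub>R W ?x"
    by (simp_all only: kk mult_1_left)
  have "det (vector [?a, ?b] :: real^2^2) = (k / sqrt (r ?x))\<^sup>2 * (r ?x)\<^sup>2 * (s * K ?x)"
    using nf.r_pos by (simp add: det_2 K_def power2_eq_square diff_divide_distrib algebra_simps)
  moreover have "s * K ?x > 0" using K by (simp add: s_def sgn_if)
  moreover have "k \<noteq> 0" using kk by auto
  ultimately have det: "det (vector [?a, ?b] :: real^2^2) > 0"
    using nf.r_pos by simp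
  have "h5 (V ?x) (k *\<^sub>R (infinity_pt + j *\<^sub>R Y ?x)) = 0 \<and> h5 (W ?x) (k *\<^sub>R (infinity_pt + j *\<^sub>R Y ?x)) = 0" for k j
    by (simp add: h5_simps nf.gram)
  from this[of _ "-1"] this[of _ 1]
  have n: "h5 (V ?x) (k *\<^sub>R (infinity_pt - Y ?x)) = 0 \<and> h5 (W ?x) (k *\<^sub>R (infinity_pt - Y ?x)) = 0"
    "h5 (V ?x) (k *\<^sub>R (infinity_pt + Y ?x)) = 0 \<and> h5 (W ?x) (k *\<^sub>R (infinity_pt + Y ?x)) = 0" for k
    by simp_all
  have "adapted_in c oS (gauss_map A oE \<iota>) q ((1 / sqrt (r ?x)) *\<^sub>R V ?x) ((1 / sqrt 2) *\<^sub>R (infinity_pt - Y ?x))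
      ((s / sqrt (r ?x)) *\<^sub>R W ?x) ((s * oS * oE / sqrt 2) *\<^sub>R (infinity_pt + Y ?x))"
    unfolding adapted_in_def gauss_map_chart[OF q]
    using nf.ex_pos_frame[OF s oS] ab[symmetric] det n normal_iff[OF q K] by blast
  then show ?thesis by blast
qed

lemma twistor_lift_chart:
  assumes q: "q \<in> fst c" and K: "K (snd c q) \<noteq> 0" and oS: "oS \<in> {1, -1}"
  shows "twistor_lift A oS (gauss_map A oE \<iota>) \<epsilon> q = (sgn (K (snd c q)) / sqrt 2) *\<^sub>R T (\<epsilon> * oE * oS) (snd c q)"
    and "\<exists>e1 e2 e3 e4. pos_frame oS (gauss_map A oE \<iota> q) e1 e2 e3 e4 \<and>
      twistor_lift A oS (gauss_map A oE \<iota>) \<epsilon> q = Omega2 \<epsilon> e1 e2 e3 e4"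
proof -
  obtain e1 e2 e3 e4 where e: "adapted_in c oS (gauss_map A oE \<iota>) q e1 e2 e3 e4"
    using ex_adapted[OF assms] by blast
  note O = Omega2_chart[OF q K oS]
  show t: "twistor_lift A oS (gauss_map A oE \<iota>) \<epsilon> q = (sgn (K (snd c q)) / sqrt 2) *\<^sub>R T (\<epsilon> * oE * oS) (snd c q)"
    unfolding twistor_lift_def adapted_frame_iff[OF q]
  proof (rule the_equality)
    show "\<exists>e1 e2 e3 e4. adapted_in c oS (gauss_map A oE \<iota>) q e1 e2 e3 e4 \<and>
        (sgn (K (snd c q)) / sqrt 2) *\<^sub>R T (\<epsilon> * oE * oS) (snd c q) = Omega2 \<epsilon> e1 e2 e3 e4"
      using e O[OF e, of \<epsilon>] by metis
    fix S assume "\<exists>e1 e2 e3 e4. adapted_in c oS (gauss_map A oE \<iota>) q e1 e2 e3 e4 \<and> S = Omega2 \<epsilon> e1 e2 e3 e4"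
    then show "S = (sgn (K (snd c q)) / sqrt 2) *\<^sub>R T (\<epsilon> * oE * oS) (snd c q)"
      using O by blast
  qed
  show "\<exists>e1 e2 e3 e4. pos_frame oS (gauss_map A oE \<iota> q) e1 e2 e3 e4 \<and>
      twistor_lift A oS (gauss_map A oE \<iota>) \<epsilon> q = Omega2 \<epsilon> e1 e2 e3 e4"
    unfolding t using e O[OF e, of \<epsilon>] unfolding adapted_in_def by metis
qed

text \<open>Makes the prefactor \<open>sgn (K y)\<close> of the lift constant near the point, so
  that it does not contribute to derivatives.\<close>

lemma K_sgn_open:
  assumes q: "q \<in> fst c" and K: "K (snd c q) \<noteq> 0"
  obtains N where "open N" "snd c q \<in> N" "N \<subseteq> snd c ` fst c" "\<And>y. y \<in> N \<Longrightarrow> sgn (K y) = sgn (K (snd c q))"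
proof
  let ?s = "sgn (K (snd c q))" and ?U = "snd c ` fst c"
  let ?N = "?U \<inter> (\<lambda>y. ?s * ((m y)\<^sup>2 - (l y)\<^sup>2)) -` {0<..}"
  have K_sgn: "sgn (K y) = sgn ((m y)\<^sup>2 - (l y)\<^sup>2)" if "y \<in> ?U" for y
    using r_pos[OF that] by (simp add: K_def sgn_divide)
  have x: "snd c q \<in> ?U" using q by blast
  show "open ?N"
    using param(2) by (intro continuous_open_preimage continuous_on_mult[OF continuous_on_const l_m_continuous]) auto
  show "snd c q \<in> ?N"
    using x K K_sgn[OF x] by (simp add: sgn_if split: if_splits)
  show "?N \<subseteq> ?U" by blast
  fix y assume y: "y \<in> ?N"
  then have "?s * ((m y)\<^sup>2 - (l y)\<^sup>2) > 0" "y \<in> ?U" by auto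
  moreover have "?s = 1 \<or> ?s = -1" using K by (simp add: sgn_if)
  ultimately show "sgn (K y) = ?s"
    using K_sgn[of y] by auto
qed

lemma twistor_lift_derivative:
  assumes q: "q \<in> fst c" and K: "K (snd c q) \<noteq> 0" and oS: "oS \<in> {1, -1}"
  shows "differentiable_in c (twistor_lift A oS (gauss_map A oE \<iota>) \<epsilon>) q"
    "deriv_along c a (twistor_lift A oS (gauss_map A oE \<iota>) \<epsilon>) q =
      (sgn (K (snd c q)) / sqrt 2) *\<^sub>R frechet_derivative (T (\<epsilon> * oE * oS)) (at (snd c q)) a"
proof -
  let ?s = "sgn (K (snd c q))" and ?L = "twistor_lift A oS (gauss_map A oE \<iota>) \<epsilon>" and ?T = "T (\<epsilon> * oE * oS)"
  have x: "snd c q \<in> snd c ` fst c" using q by blast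
  obtain N where N: "open N" "snd c q \<in> N" "N \<subseteq> snd c ` fst c" "\<And>y. y \<in> N \<Longrightarrow> sgn (K y) = ?s"
    using K_sgn_open[OF q K] by blast
  have e: "(?L \<circ> param c) y = (?s / sqrt 2) *\<^sub>R ?T y" if "y \<in> N" for y
  proof -
    have y: "y \<in> snd c ` fst c" using that N by blast
    have "K y \<noteq> 0" using N(4)[OF that] K by (auto simp: sgn_if split: if_splits)
    then show ?thesis
      using twistor_lift_chart(1)[of "param c y" oS \<epsilon>] param(5,6)[OF y] oS N(4)[OF that] by simp
  qed
  have d: "?T differentiable (at (snd c q))" by (rule T_derivative(1)[OF x])
  have b: "bounded_linear (\<lambda>S :: real^5^5. (?s / sqrt 2) *\<^sub>R S)" by (rule bounded_linear_scaleR_right)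
  have "(\<lambda>y. (?s / sqrt 2) *\<^sub>R ?T y) differentiable (at (snd c q))"
    using d by (intro differentiable_scaleR) simp_all
  then show "differentiable_in c ?L q"
    unfolding differentiable_in_def
    using differentiable_cong_open[OF N(1,2), of "?L \<circ> param c" "\<lambda>y. (?s / sqrt 2) *\<^sub>R ?T y"] e by blast
  have "frechet_derivative (?L \<circ> param c) (at (snd c q)) = frechet_derivative (\<lambda>y. (?s / sqrt 2) *\<^sub>R ?T y) (at (snd c q))"
    by (rule frechet_derivative_cong_open[OF N(1,2) e])
  then show "deriv_along c a ?L q = (?s / sqrt 2) *\<^sub>R frechet_derivative ?T (at (snd c q)) a"
    unfolding deriv_along_def using frechet_derivative_bounded_linear[OF b d, of a] by simp
qed

lemma nabla_hat_twistor_lift: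
  assumes q: "q \<in> fst c" and K: "K (snd c q) \<noteq> 0" and oS: "oS \<in> {1, -1}" and \<epsilon>: "\<epsilon> \<in> {1, -1}"
  shows "nabla_hat (gauss_map A oE \<iota>) c a (twistor_lift A oS (gauss_map A oE \<iota>) \<epsilon>) q =
    (sgn (K (snd c q)) / sqrt 2 * (a$1 - (\<epsilon> * oE * oS) * a$2)) *\<^sub>R
      wedge infinity_pt (W (snd c q) - (\<epsilon> * oE * oS) *\<^sub>R V (snd c q))"
proof -
  have x: "snd c q \<in> snd c ` fst c" using q by blast
  have \<kappa>: "\<epsilon> * oE * oS \<in> {1, -1}" using oE oS \<epsilon> by auto
  have sc: "M ** (k *\<^sub>R S) ** M' = k *\<^sub>R (M ** S ** M')" for M S M' :: "real^5^5" and k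
    by (simp add: vec_eq_iff matrix_matrix_mult_def sum_5 algebra_simps)
  show ?thesis
    unfolding nabla_hat_def gauss_map_chart[OF q] twistor_lift_derivative(2)[OF q K oS] sc proj_T_derivative[OF x \<kappa>]
    by simp
qed

end

lemma (in timelike_minimal_surface) fully_light_like_lift:
  assumes oS: "oS \<in> {1, -1}" and \<epsilon>: "\<epsilon> \<in> {1, -1}"
  shows "fully_light_like A oS (gauss_map A oE \<iota>) (Reg A \<iota>) \<epsilon> (twistor_lift A oS (gauss_map A oE \<iota>) \<epsilon>)"
proof -
  let ?F = "gauss_map A oE \<iota>" and ?L = "twistor_lift A oS (gauss_map A oE \<iota>) \<epsilon>"
  have main: "?L q \<in> U_minus oS \<epsilon> (?F q)" "differentiable_in c ?L q"
    "\<forall>a. light_like (nabla_hat ?F c a ?L q) \<or> nabla_hat ?F c a ?L q = 0" "\<exists>a. nabla_hat ?F c a ?L q \<noteq> 0"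
    if qc: "q \<in> Reg A \<iota>" "c \<in> A" "q \<in> fst c" for q c
  proof -
    interpret surface_chart A \<iota> oE c by unfold_locales (rule qc)
    have K: "K (snd c q) \<noteq> 0" using qc curvature_chart[of q] by (simp add: Reg_def)
    have x: "snd c q \<in> snd c ` fst c" using qc by blast
    let ?\<kappa> = "\<epsilon> * oE * oS"
    have \<kappa>: "?\<kappa> \<in> {1, -1}" using oE oS \<epsilon> by auto
    show "?L q \<in> U_minus oS \<epsilon> (?F q)"
      using twistor_lift_chart(2)[OF qc(3) K oS, of \<epsilon>] Omega2_U_minus[OF _ \<epsilon>] by metis
    show "differentiable_in c ?L q" by (rule twistor_lift_derivative(1)[OF qc(3) K oS])
    let ?Z = "wedge infinity_pt (W (snd c q) - ?\<kappa> *\<^sub>R V (snd c q))"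
    note nh = nabla_hat_twistor_lift[OF qc(3) K oS \<epsilon>]
    have Z: "light_like ?Z" by (rule T_derivative_null[OF x \<kappa>])
    then show "\<forall>a. light_like (nabla_hat ?F c a ?L q) \<or> nabla_hat ?F c a ?L q = 0"
      unfolding nh by (auto simp: light_like_def h_hat_scale)
    \<comment> \<open>In this direction the factor \<open>a$1 - ?\<kappa> * a$2\<close> equals
      1.\<close>
    have "nabla_hat ?F c (axis 1 1) ?L q \<noteq> 0"
      unfolding nh using Z K by (simp add: light_like_def axis_def sgn_if)
    then show "\<exists>a. nabla_hat ?F c a ?L q \<noteq> 0" by blast
  qed
  then have "?L q \<in> U_minus oS \<epsilon> (?F q)" if "q \<in> Reg A \<iota>" for q
    using that chart_at_mem[OF lorentz, of q] by blast
  then show ?thesis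
    unfolding fully_light_like_def section_U_minus_def using main by blast
qed

section \<open>The covariant derivative of the paracomplex structure\<close>

text \<open>The product to which the Leibniz rule is applied when the paracomplex structure acts on
  a section.\<close>

lemma bounded_bilinear_lower5: "bounded_bilinear (\<lambda>(M :: real^5^5) v. M *v lower5 v)"
proof -
  have "bilinear (\<lambda>(M :: real^5^5) v. M *v lower5 v)"
    unfolding bilinear_def
    by (auto intro!: linearI simp: linear_add[OF linear_lower5] linear_scale[OF linear_lower5]
        matrix_vector_mult_add_rdistrib matrix_vector_right_distrib scaleR_matrix_vector_assoc[symmetric]
        matrix_vector_mult_scaleR)
  then show ?thesis by (simp add: bilinear_conv_bounded_bilinear)
qed

lemma representation_axes:
  fixes a :: "real^2"
  assumes "k \<noteq> 0"
  defines "s1 \<equiv> k *\<^sub>R axis 1 1 :: real^2" and "s2 \<equiv> k *\<^sub>R axis 2 1 :: real^2"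
  shows "representation {s1, s2} a s1 = a$1 / k" "representation {s1, s2} a s2 = a$2 / k"
proof -
  have ne: "s1 \<noteq> s2"
    using assms(1) by (simp add: s1_def s2_def vec_eq_iff forall_2 axis_def)
  have c: "s1$1 = k" "s1$2 = 0" "s2$1 = 0" "s2$2 = k"
    by (simp_all add: s1_def s2_def axis_def)
  have ind: "independent {s1, s2}"
  proof (rule independent_if_scalars_zero)
    show "finite {s1, s2}" by simp
    fix f v assume "(\<Sum>x\<in>{s1, s2}. f x *\<^sub>R x) = 0" and v: "v \<in> {s1, s2}"
    then have "f s1 *\<^sub>R s1 + f s2 *\<^sub>R s2 = 0" using ne by simp
    then have "f s1 = 0" "f s2 = 0"
      using assms(1) by (simp_all add: vec_eq_iff[of "f s1 *\<^sub>R s1 + f s2 *\<^sub>R s2"] forall_2 c)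
    then show "f v = 0" using v by auto
  qed
  let ?c = "\<lambda>v. if v = s1 then a$1 / k else if v = s2 then a$2 / k else 0"
  have s: "(\<Sum>v\<in>{s1, s2}. ?c v *\<^sub>R v) = a"
  proof -
    have "(\<Sum>v\<in>{s1, s2}. ?c v *\<^sub>R v) = (a$1 / k) *\<^sub>R s1 + (a$2 / k) *\<^sub>R s2" using ne by auto
    then show ?thesis using assms(1) by (simp add: vec_eq_iff[of _ a] forall_2 c)
  qed
  have "representation {s1, s2} a = ?c"
  proof (rule representation_eqI[OF ind])
    show "a \<in> span {s1, s2}"
      by (subst s[symmetric]) (intro span_sum span_scale span_base)
    show "\<And>b. ?c b \<noteq> 0 \<Longrightarrow> b \<in> {s1, s2}" by (auto split: if_splits)
    have sub: "{b. ?c b \<noteq> 0} \<subseteq> {s1, s2}" by (auto split: if_splits)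
    then show "finite {b. ?c b \<noteq> 0}" by (rule finite_subset) simp
    have "(\<Sum>b | ?c b \<noteq> 0. ?c b *\<^sub>R b) = (\<Sum>v\<in>{s1, s2}. ?c v *\<^sub>R v)"
      using sub by (intro sum.mono_neutral_left) auto
    then show "(\<Sum>b | ?c b \<noteq> 0. ?c b *\<^sub>R b) = a" using s by simp
  qed
  then show "representation {s1, s2} a s1 = a$1 / k" "representation {s1, s2} a s2 = a$2 / k"
    using ne by auto
qed

context surface_chart
begin

text \<open>The description of \<nu> refers to the reference chart, so the null frame is taken
  there; uniqueness is \<open>null_normal_unique\<close>.\<close>

lemma nu_chart:
  assumes q: "q \<in> fst c" and K: "K (snd c q) \<noteq> 0"
  shows "nu A oE \<iota> q = infinity_pt"
proof -
  let ?d = "chart_at A q"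
  have d: "?d \<in> A" "q \<in> fst ?d" using chart_at_mem[OF lorentz] by auto
  interpret d: surface_chart A \<iota> oE ?d by unfold_locales (rule d)
  let ?x = "snd ?d q"
  interpret nf: null_frame "d.F ?x" "d.V ?x" "d.W ?x" "d.Y ?x" infinity_pt "d.r ?x" oE
    by (rule d.null_frame_chart[OF d(2)])
  have Kd: "d.K ?x \<noteq> 0"
    using K curvature_chart[OF q] d.curvature_chart[OF d(2)] by simp
  show ?thesis
    unfolding nu_def d.gauss_map_chart[OF d(2)] d.emb_chart[OF d(2)] d.normal_iff[OF d(2) Kd]
  proof (rule the_equality)
    have "infinity_pt \<noteq> 0" by (simp add: infinity_pt_def vec_eq_iff forall_5 vector_5)
    then show "infinity_pt \<in> light_cone \<and> infinity_pt \<in> tangent_S42 (d.F ?x) \<and>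
        (h5 (d.V ?x) infinity_pt = 0 \<and> h5 (d.W ?x) infinity_pt = 0) \<and> h5 infinity_pt (d.Y ?x) = -1"
      by (simp add: light_cone_def tangent_S42_def nf.gram nf.gram')
    fix v assume "v \<in> light_cone \<and> v \<in> tangent_S42 (d.F ?x) \<and>
        (h5 (d.V ?x) v = 0 \<and> h5 (d.W ?x) v = 0) \<and> h5 v (d.Y ?x) = -1"
    then show "v = infinity_pt"
      by (intro nf.null_normal_unique) (auto simp: light_cone_def tangent_S42_def)
  qed
qed

lemma conf_exp_chart:
  assumes q: "q \<in> fst c"
  shows "conf_exp \<iota> c q = ln (r (snd c q)) / 2" "pd c 1 (conf_exp \<iota> c) q = gu (snd c q)"
    "pd c 2 (conf_exp \<iota> c) q = gv (snd c q)"
proof -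
  let ?x = "snd c q"
  have x: "?x \<in> snd c ` fst c" using q by blast
  show "conf_exp \<iota> c q = ln (r ?x) / 2"
    by (simp add: conf_exp_def metric_chart[OF q])
  have "((\<lambda>y. ln (r y) / 2) has_derivative (\<lambda>v. frechet_derivative r (at ?x) v * inverse (r ?x) / 2)) (at ?x)"
    using r_diff[OF x] r_pos[OF x]
    by (intro bounded_linear.has_derivative[OF bounded_linear_divide] has_derivative_ln)
      (simp_all add: frechet_derivative_works)
  from frechet_derivative_at[OF this]
  have "partial i (\<lambda>y. ln (r y) / 2) ?x = partial i r ?x * inverse (r ?x) / 2" for i
    by (rule fun_cong[OF sym])
  moreover have "pd c i (conf_exp \<iota> c) q = partial i (\<lambda>y. ln (r y) / 2) ?x" for i
    by (rule pd_eq[OF q]) (simp add: conf_exp_def metric_chart param)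
  ultimately show "pd c 1 (conf_exp \<iota> c) q = gu ?x" "pd c 2 (conf_exp \<iota> c) q = gv ?x"
    by (simp_all add: gu_def gv_def inverse_eq_divide)
qed

lemma exp_conf_exp:
  assumes q: "q \<in> fst c"
  shows "exp (2 * conf_exp \<iota> c q) = r (snd c q)" "exp (conf_exp \<iota> c q) = sqrt (r (snd c q))"
proof -
  have "r (snd c q) > 0" using q r_pos by blast
  then show "exp (2 * conf_exp \<iota> c q) = r (snd c q)"
    unfolding conf_exp_chart(1)[OF q] by simp
  have "ln (r (snd c q)) / 2 = ln (sqrt (r (snd c q)))" using \<open>r (snd c q) > 0\<close> by (simp add: ln_sqrt)
  then show "exp (conf_exp \<iota> c q) = sqrt (r (snd c q))"
    unfolding conf_exp_chart(1)[OF q] using \<open>r (snd c q) > 0\<close> by simp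
qed

lemma coeff_chart:
  assumes q: "q \<in> fst c"
  shows "coeff_l A oE \<iota> c q = l (snd c q)" "coeff_m A oE \<iota> c q = m (snd c q)"
proof -
  let ?x = "snd c q"
  have x: "?x \<in> snd c ` fst c" using q by blast
  have "n ?x \<noteq> 0" using n_gram(1)[OF x] by (auto simp: h3_def)
  then show "coeff_l A oE \<iota> c q = l ?x" "coeff_m A oE \<iota> c q = m ?x"
    unfolding coeff_l_def coeff_m_def pd_pd_immersion[OF q] pd_immersion[OF q] conf_exp_chart(2,3)[OF q]
      unit_normal_chart[OF q] second_fundamental[OF x]
    by (auto intro!: the_equality)
qed

text \<open>\<open>w\<^sup>2\<close> is the conformal factor \<open>- K * r\<close> of the metric
  induced by \<open>F\<close>, which explains the normalisation of the tangent vectors.\<close>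

lemma local_frame:
  assumes q: "q \<in> fst c" and K: "K (snd c q) < 0"
  defines "w \<equiv> sqrt (- curvature A \<iota> q) * exp (conf_exp \<iota> c q)"
  shows "w > 0" "w\<^sup>2 = ((l (snd c q))\<^sup>2 - (m (snd c q))\<^sup>2) / r (snd c q)"
    "frame_e1 A oE \<iota> c q = (1 / (r (snd c q) * w)) *\<^sub>R (m (snd c q) *\<^sub>R W (snd c q) - l (snd c q) *\<^sub>R V (snd c q))"
    "frame_e3 A oE \<iota> c q = (1 / (r (snd c q) * w)) *\<^sub>R (l (snd c q) *\<^sub>R W (snd c q) - m (snd c q) *\<^sub>R V (snd c q))"
    "frame_e2 A oE \<iota> q = (1 / sqrt 2) *\<^sub>R (infinity_pt - Y (snd c q))"
    "frame_e4 A oE \<iota> q = (1 / sqrt 2) *\<^sub>R (infinity_pt + Y (snd c q))"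
proof -
  let ?x = "snd c q"
  have x: "?x \<in> snd c ` fst c" using q by blast
  note r = r_pos[OF x]
  have w: "w = sqrt (- K ?x) * sqrt (r ?x)"
    by (simp add: w_def exp_conf_exp[OF q] curvature_chart[OF q])
  show "w > 0" using K r by (simp add: w)
  have "w\<^sup>2 = - K ?x * r ?x" using K r by (simp add: w power_mult_distrib)
  also have "\<dots> = ((l ?x)\<^sup>2 - (m ?x)\<^sup>2) / r ?x"
    using r by (simp add: K_def power2_eq_square divide_simps)
  finally show "w\<^sup>2 = ((l ?x)\<^sup>2 - (m ?x)\<^sup>2) / r ?x" .
  have "pd c i (gauss_map A oE \<iota>) q = partial i F ?x" for i by (rule deriv_gauss_map[OF q])
  then show "frame_e1 A oE \<iota> c q = (1 / (r ?x * w)) *\<^sub>R (m ?x *\<^sub>R W ?x - l ?x *\<^sub>R V ?x)"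
    "frame_e3 A oE \<iota> c q = (1 / (r ?x * w)) *\<^sub>R (l ?x *\<^sub>R W ?x - m ?x *\<^sub>R V ?x)"
    by (simp_all add: frame_e1_def frame_e3_def w_def partial_FY[OF x] mult.commute)
  show "frame_e2 A oE \<iota> q = (1 / sqrt 2) *\<^sub>R (infinity_pt - Y ?x)"
    "frame_e4 A oE \<iota> q = (1 / sqrt 2) *\<^sub>R (infinity_pt + Y ?x)"
    using K by (simp_all add: frame_e2_def frame_e4_def nu_chart[OF q] emb_chart[OF q])
qed

text \<open>For negative curvature the tangent and the normal minors are both negative, so the frame
  is oriented like \<open>F\<close>, \<open>V\<close>, \<open>Y\<close>, \<open>W\<close>,
  \<open>infinity_pt\<close>, whose determinant has the sign opposite to \<open>oE\<close>.\<close>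

lemma local_frame_pos:
  assumes q: "q \<in> fst c" and K: "K (snd c q) < 0" and oS: "oS \<in> {1, -1}"
    and pos: "pos_oriented oS (gauss_map A oE \<iota> q) (frame_e1 A oE \<iota> c q) (frame_e2 A oE \<iota> q)
      (frame_e3 A oE \<iota> c q) (frame_e4 A oE \<iota> q)"
  shows "oS = - oE"
    "pos_frame oS (gauss_map A oE \<iota> q) (frame_e1 A oE \<iota> c q) (frame_e2 A oE \<iota> q)
      (frame_e3 A oE \<iota> c q) (frame_e4 A oE \<iota> q)"
proof -
  let ?x = "snd c q"
  interpret nf: null_frame "F ?x" "V ?x" "W ?x" "Y ?x" infinity_pt "r ?x" oE by (rule null_frame_chart[OF q])
  define w where "w = sqrt (- curvature A \<iota> q) * exp (conf_exp \<iota> c q)"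
  note fr = local_frame[OF q K, folded w_def]
  define u where "u = 1 / (r ?x * w)"
  have u: "u * u * (r ?x * ((l ?x)\<^sup>2 - (m ?x)\<^sup>2)) = 1"
  proof -
    have "(l ?x)\<^sup>2 - (m ?x)\<^sup>2 = r ?x * w\<^sup>2" using fr(2) nf.r_pos by (simp add: field_simps)
    then show ?thesis using fr(1) nf.r_pos by (simp add: u_def power2_eq_square)
  qed
  have e: "frame_e1 A oE \<iota> c q = (- u * l ?x) *\<^sub>R V ?x + (u * m ?x) *\<^sub>R W ?x"
    "frame_e3 A oE \<iota> c q = (- u * m ?x) *\<^sub>R V ?x + (u * l ?x) *\<^sub>R W ?x"
    "frame_e2 A oE \<iota> q = (- (1 / sqrt 2)) *\<^sub>R Y ?x + (1 / sqrt 2) *\<^sub>R infinity_pt"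
    "frame_e4 A oE \<iota> q = (1 / sqrt 2) *\<^sub>R Y ?x + (1 / sqrt 2) *\<^sub>R infinity_pt"
    unfolding fr(3-6) u_def[symmetric] by (simp_all add: algebra_simps)
  have or: "oS * (((- u * l ?x) * (u * l ?x) - (u * m ?x) * (- u * m ?x)) *
      ((- (1 / sqrt 2)) * (1 / sqrt 2) - (1 / sqrt 2) * (1 / sqrt 2)) *
      det (vector [F ?x, V ?x, Y ?x, W ?x, infinity_pt] :: real^5^5)) > 0"
    using pos unfolding pos_oriented_def gauss_map_chart[OF q] e nf.det_frame .
  have uu: "((- u * l ?x) * (u * l ?x) - (u * m ?x) * (- u * m ?x)) *
      ((- (1 / sqrt 2)) * (1 / sqrt 2) - (1 / sqrt 2) * (1 / sqrt 2)) = u * u * ((l ?x)\<^sup>2 - (m ?x)\<^sup>2)"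
    by (simp add: power2_eq_square algebra_simps)
  have uu_pos: "u * u * ((l ?x)\<^sup>2 - (m ?x)\<^sup>2) > 0"
  proof -
    have "r ?x * (u * u * ((l ?x)\<^sup>2 - (m ?x)\<^sup>2)) > 0" using u by (simp add: algebra_simps)
    then show ?thesis using nf.r_pos by (simp add: zero_less_mult_iff)
  qed
  have "(u * u * ((l ?x)\<^sup>2 - (m ?x)\<^sup>2)) * (oS * det (vector [F ?x, V ?x, Y ?x, W ?x, infinity_pt] :: real^5^5)) > 0"
    using or unfolding uu by (simp only: mult_ac)
  from zero_less_mult_pos[OF this uu_pos]
  have "oS * det (vector [F ?x, V ?x, Y ?x, W ?x, infinity_pt] :: real^5^5) > 0" .
  then show "oS = - oE"
    using nf.det_neg oS oE by auto
  have "u * u * (l ?x * l ?x * r ?x) = 1 + u * u * (m ?x * m ?x * r ?x)"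
    using u by (simp add: power2_eq_square algebra_simps)
  then show "pos_frame oS (gauss_map A oE \<iota> q) (frame_e1 A oE \<iota> c q) (frame_e2 A oE \<iota> q)
      (frame_e3 A oE \<iota> c q) (frame_e4 A oE \<iota> q)"
    using pos unfolding pos_frame_def gauss_map_chart[OF q] e
    by (simp add: tangent_S42_def h5_simps nf.gram nf.gram' algebra_simps)
qed

text \<open>Negative curvature gives the lift the factor \<open>- 1 / sqrt 2\<close>, which cancels
  the factor \<open>- sqrt 2\<close> between bivector and structure.\<close>

lemma para_structure_chart:
  assumes q: "q \<in> fst c" and K: "K (snd c q) < 0" and oS: "oS \<in> {1, -1}"
    and y: "y \<in> tangent_S42 (gauss_map A oE \<iota> q)"
  shows "para_structure oS \<epsilon> (gauss_map A oE \<iota> q) (twistor_lift A oS (gauss_map A oE \<iota>) \<epsilon> q) y =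
    T (\<epsilon> * oE * oS) (snd c q) *v lower5 y"
proof -
  have K0: "K (snd c q) \<noteq> 0" using K by simp
  obtain e1 e2 e3 e4 where e: "pos_frame oS (gauss_map A oE \<iota> q) e1 e2 e3 e4"
    "twistor_lift A oS (gauss_map A oE \<iota>) \<epsilon> q = Omega2 \<epsilon> e1 e2 e3 e4"
    using twistor_lift_chart(2)[OF q K0 oS] by blast
  have "twistor_lift A oS (gauss_map A oE \<iota>) \<epsilon> q = (- 1 / sqrt 2) *\<^sub>R T (\<epsilon> * oE * oS) (snd c q)"
    by (simp only: twistor_lift_chart(1)[OF q K0 oS] sgn_neg[OF K])
  then show ?thesis
    unfolding para_structure_eq[OF e y] by (simp only: scaleR_matrix_vector_assoc[symmetric]) simp
qed

text \<open>By the Leibniz rule the terms with the derivative of \<open>X\<close> cancel, because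
  \<open>T\<close> does not see the projection in \<open>nabla\<close>. The projected derivative of
  \<open>T\<close> applied to \<open>X\<close> remains.\<close>

lemma nabla_para_structure:
  assumes q: "q \<in> fst c" and K: "K (snd c q) < 0" and oS: "oS \<in> {1, -1}" and \<epsilon>: "\<epsilon> \<in> {1, -1}"
    and X: "\<And>q'. q' \<in> fst c \<Longrightarrow> q' \<in> Reg A \<iota> \<Longrightarrow> X q' \<in> tangent_S42 (gauss_map A oE \<iota> q')"
    and Xd: "differentiable_in c X q"
  defines "G \<equiv> gauss_map A oE \<iota>" and "\<kappa> \<equiv> \<epsilon> * oE * oS"
  defines "J \<equiv> \<lambda>q. para_structure oS \<epsilon> (G q) (twistor_lift A oS G \<epsilon> q)"
  shows "differentiable_in c (\<lambda>q. J q (X q)) q"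
    "nabla G c a (\<lambda>q. J q (X q)) q - J q (nabla G c a X q) =
      (a$1 - \<kappa> * a$2) *\<^sub>R (h5 (W (snd c q) - \<kappa> *\<^sub>R V (snd c q)) (X q) *\<^sub>R infinity_pt
        - h5 infinity_pt (X q) *\<^sub>R (W (snd c q) - \<kappa> *\<^sub>R V (snd c q)))"
proof -
  let ?x = "snd c q"
  have x: "?x \<in> snd c ` fst c" using q by blast
  have \<kappa>: "\<kappa> \<in> {1, -1}" using oE oS \<epsilon> by (auto simp: \<kappa>_def)
  have Gq: "G q = F ?x" using gauss_map_chart[OF q] by (simp add: G_def)
  have reg: "q' \<in> Reg A \<iota>" if "q' \<in> fst c" "K (snd c q') < 0" for q'
    using that curvature_chart by (simp add: Reg_def)
  have K0: "K ?x \<noteq> 0" using K by simp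
  \<comment> \<open>\<open>X\<close> is known to be a section only over
    \<open>Reg A \<iota>\<close>. As \<open>K\<close> keeps its sign on \<open>N\<close>, this
    covers a neighbourhood, which suffices for the derivative.\<close>
  obtain N where N: "open N" "?x \<in> N" "N \<subseteq> snd c ` fst c" "\<And>y. y \<in> N \<Longrightarrow> sgn (K y) = sgn (K ?x)"
    using K_sgn_open[OF q K0] by blast
  define B where "B = (\<lambda>(M :: real^5^5) v. M *v lower5 v)"
  have bb: "bounded_bilinear B" unfolding B_def by (rule bounded_bilinear_lower5)
  have loc: "((\<lambda>q. J q (X q)) \<circ> param c) y = B (T \<kappa> y) ((X \<circ> param c) y)" if y: "y \<in> N" for y
  proof -
    have yU: "y \<in> snd c ` fst c" using y N by blast
    have "K y < 0" using N(4)[OF y] K by (simp add: sgn_if split: if_splits)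
    then show ?thesis
      using para_structure_chart[OF param(5)[OF yU] _ oS X[OF param(5)[OF yU] reg[OF param(5)[OF yU]]]] param(6)[OF yU]
      by (simp add: J_def G_def B_def \<kappa>_def)
  qed
  have Td: "T \<kappa> differentiable (at ?x)" by (rule T_derivative(1)[OF x])
  have Xd': "(X \<circ> param c) differentiable (at ?x)" using Xd by (simp add: differentiable_in_def)
  have "(\<lambda>y. B (T \<kappa> y) ((X \<circ> param c) y)) differentiable (at ?x)"
    by (rule differentiable_bilinear[OF bb Td Xd'])
  then show "differentiable_in c (\<lambda>q. J q (X q)) q"
    unfolding differentiable_in_def
    using differentiable_cong_open[OF N(1,2), of "(\<lambda>q. J q (X q)) \<circ> param c" "\<lambda>y. B (T \<kappa> y) ((X \<circ> param c) y)"] loc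
    by blast
  have "frechet_derivative ((\<lambda>q. J q (X q)) \<circ> param c) (at ?x) = frechet_derivative (\<lambda>y. B (T \<kappa> y) ((X \<circ> param c) y)) (at ?x)"
    by (rule frechet_derivative_cong_open[OF N(1,2) loc])
  then have D: "deriv_along c a (\<lambda>q. J q (X q)) q =
      B (T \<kappa> ?x) (deriv_along c a X q) + B (frechet_derivative (T \<kappa>) (at ?x) a) (X q)"
    unfolding deriv_along_def using frechet_derivative_bilinear[OF bb Td Xd', of a] param(4)[OF q] by simp
  interpret nf: null_frame "F ?x" "V ?x" "W ?x" "Y ?x" infinity_pt "r ?x" oE by (rule null_frame_chart[OF q])
  have XF: "h5 (F ?x) (X q) = 0"
    using X[OF q reg[OF q K]] gauss_map_chart[OF q] by (simp add: tangent_S42_def)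
  have Jn: "J q (nabla G c a X q) = B (T \<kappa> ?x) (nabla G c a X q)"
  proof -
    have "nabla G c a X q \<in> tangent_S42 (gauss_map A oE \<iota> q)"
      using gauss_map_chart[OF q] by (simp add: nabla_def Gq proj_S42_def tangent_S42_def h5_simps nf.gram)
    from para_structure_chart[OF q K oS this, of \<epsilon>] show ?thesis
      by (simp add: J_def G_def B_def \<kappa>_def)
  qed
  have "B (T \<kappa> ?x) (nabla G c a X q) = B (T \<kappa> ?x) (deriv_along c a X q)"
    using T_lower5(1)[OF x, of \<kappa>]
    by (simp add: nabla_def Gq proj_S42_def bounded_bilinear.diff_right[OF bb] bounded_bilinear.scaleR_right[OF bb])
      (simp add: B_def)
  moreover have "proj_S42 (F ?x) (B (T \<kappa> ?x) v) = B (T \<kappa> ?x) v" for v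
    using T_lower5(2)[OF x, of \<kappa>] by (simp add: proj_S42_def B_def)
  ultimately have "nabla G c a (\<lambda>q. J q (X q)) q - J q (nabla G c a X q) =
      proj_S42 (F ?x) (B (frechet_derivative (T \<kappa>) (at ?x) a) (X q))"
    by (simp add: nabla_def[of G c a "\<lambda>q. J q (X q)"] Gq D Jn linear_add[OF proj_S42_linear])
  then show "nabla G c a (\<lambda>q. J q (X q)) q - J q (nabla G c a X q) =
      (a$1 - \<kappa> * a$2) *\<^sub>R (h5 (W ?x - \<kappa> *\<^sub>R V ?x) (X q) *\<^sub>R infinity_pt
        - h5 infinity_pt (X q) *\<^sub>R (W ?x - \<kappa> *\<^sub>R V ?x))"
    unfolding B_def proj_T_derivative_lower5[OF x \<kappa> XF] .
qed

end

lemma (in surface_chart) has_nabla_endo_chart: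
  assumes q: "q \<in> fst c" and K: "K (snd c q) < 0" and oS: "oS \<in> {1, -1}" and \<epsilon>: "\<epsilon> \<in> {1, -1}"
    and pos: "pos_oriented oS (gauss_map A oE \<iota> q) (frame_e1 A oE \<iota> c q) (frame_e2 A oE \<iota> q)
      (frame_e3 A oE \<iota> c q) (frame_e4 A oE \<iota> q)"
  defines "G \<equiv> gauss_map A oE \<iota>"
    and "e1 \<equiv> frame_e1 A oE \<iota> c q" and "e2 \<equiv> frame_e2 A oE \<iota> q"
    and "e3 \<equiv> frame_e3 A oE \<iota> c q" and "e4 \<equiv> frame_e4 A oE \<iota> q"
    and "s1 \<equiv> surf_e1 A \<iota> c q" and "s3 \<equiv> surf_e3 A \<iota> c q"
  shows "has_nabla_endo G c (Reg A \<iota>) (\<lambda>q. para_structure oS \<epsilon> (G q) (twistor_lift A oS G \<epsilon> q)) q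
    (\<lambda>a x. (- (\<epsilon> * l_tilde A oE \<iota> c q + m_tilde A oE \<iota> c q) *
         (representation {s1, s3} a s1 + \<epsilon> * representation {s1, s3} a s3)) *\<^sub>R
       ((representation {e1, e2, e3, e4} x e1 + \<epsilon> * representation {e1, e2, e3, e4} x e3) *\<^sub>R (e2 + e4) -
        (representation {e1, e2, e3, e4} x e2 - representation {e1, e2, e3, e4} x e4) *\<^sub>R (e1 - \<epsilon> *\<^sub>R e3)))"
  unfolding has_nabla_endo_def
proof (intro allI impI, elim conjE, intro conjI allI)
  fix X a
  assume X: "\<forall>q\<in>fst c \<inter> Reg A \<iota>. X q \<in> tangent_S42 (G q)" and Xd: "differentiable_in c X q"
  let ?x = "snd c q"
  have x: "?x \<in> snd c ` fst c" using q by blast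
  note r = r_pos[OF x]
  define w where "w = sqrt (- curvature A \<iota> q) * exp (conf_exp \<iota> c q)"
  note fr = local_frame[OF q K, folded w_def]
  note nJ = nabla_para_structure[OF q K oS \<epsilon> _ Xd, folded G_def]
  note op = local_frame_pos[OF q K oS pos]
  have "\<epsilon> * oE * oS = - \<epsilon>" using oE op(1) by auto
  note nJ = nJ[unfolded this]
  show "differentiable_in c (\<lambda>q. para_structure oS \<epsilon> (G q) (twistor_lift A oS G \<epsilon> q) (X q)) q"
    using nJ(1) X by blast
  define Q where "Q = W ?x + \<epsilon> *\<^sub>R V ?x"
  define z where "z = h5 Q (X q) *\<^sub>R infinity_pt - h5 infinity_pt (X q) *\<^sub>R Q"
  have lhs: "nabla G c a (\<lambda>q. para_structure oS \<epsilon> (G q) (twistor_lift A oS G \<epsilon> q) (X q)) q -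
      para_structure oS \<epsilon> (G q) (twistor_lift A oS G \<epsilon> q) (nabla G c a X q) = (a$1 + \<epsilon> * a$2) *\<^sub>R z"
    using nJ(2) X by (simp add: z_def Q_def)
  \<comment> \<open>The common coefficient in \<open>e1 - \<epsilon> *\<^sub>R e3\<close>: since
    \<open>\<epsilon>\<close> squares to 1, the components along \<open>V\<close> and
    \<open>W\<close> combine to a multiple of \<open>Q\<close>.\<close>
  define u where "u = \<epsilon> * (l ?x - \<epsilon> * m ?x) / (r ?x * w)"
  have \<xi>1: "e1 - \<epsilon> *\<^sub>R e3 = - (u *\<^sub>R Q)"
    using \<epsilon> unfolding e1_def e3_def fr(3,4) u_def Q_def
    by (auto simp: algebra_simps diff_divide_distrib add_divide_distrib)
  have \<xi>2: "e2 + e4 = sqrt 2 *\<^sub>R infinity_pt"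
  proof -
    have alg: "(v - y) + (v + y) = v + v" for v y :: "real^5" by simp
    have "e2 + e4 = (1 / sqrt 2 + 1 / sqrt 2) *\<^sub>R infinity_pt"
      unfolding e2_def e4_def fr(5,6) by (simp only: scaleR_diff_right scaleR_add_right scaleR_add_left alg)
    also have "1 / sqrt 2 + 1 / sqrt 2 = sqrt 2" by (simp add: field_simps)
    finally show ?thesis .
  qed
  have Xt: "X q \<in> tangent_S42 (gauss_map A oE \<iota> q)"
    using X q K curvature_chart[OF q] by (simp add: Reg_def G_def)
  note rep = pos_frame_representation[OF op(2) Xt, folded e1_def e2_def e3_def e4_def]
  have \<theta>1: "representation {e1, e2, e3, e4} (X q) e1 + \<epsilon> * representation {e1, e2, e3, e4} (X q) e3 = - u * h5 Q (X q)"
  proof -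
    \<comment> \<open>The minus sign of the time-like dual vector turns the plus in
      \<open>\<theta>1\<close> into the minus in \<open>\<xi>1\<close>.\<close>
    have "h5 e1 (X q) + \<epsilon> * - h5 e3 (X q) = h5 (e1 - \<epsilon> *\<^sub>R e3) (X q)" by (simp add: h5_simps)
    then show ?thesis by (simp add: rep \<xi>1 h5_simps)
  qed
  have \<theta>2: "representation {e1, e2, e3, e4} (X q) e2 - representation {e1, e2, e3, e4} (X q) e4 =
      sqrt 2 * h5 infinity_pt (X q)"
  proof -
    have "h5 e2 (X q) - - h5 e4 (X q) = h5 (e2 + e4) (X q)" by (simp add: h5_simps)
    then show ?thesis by (simp add: rep \<xi>2 h5_simps)
  qed
  have \<alpha>: "representation {s1, s3} a s1 + \<epsilon> * representation {s1, s3} a s3 = w * (a$1 + \<epsilon> * a$2)"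
    unfolding s1_def s3_def surf_e1_def surf_e3_def w_def[symmetric]
    using representation_axes[of "1 / w" a] fr(1) by (simp add: algebra_simps)
  have N: "(- u * h5 Q (X q)) *\<^sub>R (sqrt 2 *\<^sub>R infinity_pt) - (sqrt 2 * h5 infinity_pt (X q)) *\<^sub>R (- (u *\<^sub>R Q)) =
      (- (sqrt 2 * u)) *\<^sub>R z"
    by (simp add: z_def algebra_simps)
  have D: "(l ?x)\<^sup>2 - (m ?x)\<^sup>2 \<noteq> 0"
    using fr(1,2) r by (auto simp: field_simps)
  have lt: "\<epsilon> * l_tilde A oE \<iota> c q + m_tilde A oE \<iota> c q =
      (\<epsilon> * l ?x + m ?x) * r ?x / (sqrt 2 * ((l ?x)\<^sup>2 - (m ?x)\<^sup>2))"
    by (simp add: l_tilde_def m_tilde_def coeff_chart[OF q] exp_conf_exp[OF q] add_divide_distrib algebra_simps)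
  \<comment> \<open>Conjugate factors: the first is the numerator of \<alpha>, the second comes from
    \<open>u\<close>. Their product cancels the denominator of \<open>l_tilde\<close> and
    \<open>m_tilde\<close>, so all normalising constants multiply to 1.\<close>
  have lm: "(\<epsilon> * l ?x + m ?x) * (\<epsilon> * (l ?x - \<epsilon> * m ?x)) = (l ?x)\<^sup>2 - (m ?x)\<^sup>2"
    using \<epsilon> by (auto simp: power2_eq_square algebra_simps)
  have "- (\<epsilon> * l_tilde A oE \<iota> c q + m_tilde A oE \<iota> c q) * (w * t) * (- (sqrt 2 * u)) =
      ((\<epsilon> * l ?x + m ?x) * (\<epsilon> * (l ?x - \<epsilon> * m ?x))) / ((l ?x)\<^sup>2 - (m ?x)\<^sup>2) * t" for t
    unfolding lt u_def using r fr(1) by simp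
  then have coef: "- (\<epsilon> * l_tilde A oE \<iota> c q + m_tilde A oE \<iota> c q) * (w * t) * (- (sqrt 2 * u)) = t" for t
    unfolding lm using D by simp
  show "nabla G c a (\<lambda>q. para_structure oS \<epsilon> (G q) (twistor_lift A oS G \<epsilon> q) (X q)) q -
      para_structure oS \<epsilon> (G q) (twistor_lift A oS G \<epsilon> q) (nabla G c a X q) =
    (- (\<epsilon> * l_tilde A oE \<iota> c q + m_tilde A oE \<iota> c q) *
         (representation {s1, s3} a s1 + \<epsilon> * representation {s1, s3} a s3)) *\<^sub>R
       ((representation {e1, e2, e3, e4} (X q) e1 + \<epsilon> * representation {e1, e2, e3, e4} (X q) e3) *\<^sub>R (e2 + e4) -
        (representation {e1, e2, e3, e4} (X q) e2 - representation {e1, e2, e3, e4} (X q) e4) *\<^sub>R (e1 - \<epsilon> *\<^sub>R e3))"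
    unfolding lhs \<theta>1 \<theta>2 \<alpha> \<xi>1 \<xi>2
    unfolding N unfolding scaleR_scaleR coef ..
qed

theorem theorem5p2:
  fixes A :: "'a::{t2_space, second_countable_topology} chart set"
    and \<iota> :: "'a \<Rightarrow> real^3"
    and oE oS :: real
  assumes "lorentz_surface A"
    and "timelike_conformal_immersion A \<iota>"
    and "oE \<in> {1, -1}"
    and "minimal A oE \<iota>"
    and "oS \<in> {1, -1}"
    and "frames_positive A oE oS \<iota>"
  shows "let F = gauss_map A oE \<iota>; W = Reg A \<iota> in
    fully_light_like A oS F W 1 (twistor_lift A oS F 1) \<and>
    fully_light_like A oS F W (-1) (twistor_lift A oS F (-1)) \<and>
    (\<forall>\<epsilon>\<in>{1, -1}. \<forall>c\<in>A. \<forall>p\<in>fst c. curvature A \<iota> p < 0 \<longrightarrow>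
      (let e1 = frame_e1 A oE \<iota> c p; e2 = frame_e2 A oE \<iota> p;
           e3 = frame_e3 A oE \<iota> c p; e4 = frame_e4 A oE \<iota> p;
           s1 = surf_e1 A \<iota> c p; s3 = surf_e3 A \<iota> c p;
           J = (\<lambda>q. para_structure oS \<epsilon> (F q) (twistor_lift A oS F \<epsilon> q));
           dual = representation {e1, e2, e3, e4};
           \<xi>1 = e1 - \<epsilon> *\<^sub>R e3;
           \<xi>2 = e2 + e4;
           \<theta>1 = (\<lambda>x. dual x e1 + \<epsilon> * dual x e3);
           \<theta>2 = (\<lambda>x. dual x e2 - dual x e4);
           \<theta>1_surf = (\<lambda>a. representation {s1, s3} a s1 + \<epsilon> * representation {s1, s3} a s3);
           \<alpha> = (\<lambda>a. - (\<epsilon> * l_tilde A oE \<iota> c p + m_tilde A oE \<iota> c p) * \<theta>1_surf a);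
           N = (\<lambda>x. \<theta>1 x *\<^sub>R \<xi>2 - \<theta>2 x *\<^sub>R \<xi>1)
       in has_nabla_endo F c W J p (\<lambda>a x. \<alpha> a *\<^sub>R N x)))"
proof -
  interpret timelike_minimal_surface A \<iota> oE
    using assms(1-4) by unfold_locales
  have "has_nabla_endo (gauss_map A oE \<iota>) c (Reg A \<iota>)
      (\<lambda>q. para_structure oS \<epsilon> (gauss_map A oE \<iota> q) (twistor_lift A oS (gauss_map A oE \<iota>) \<epsilon> q)) p
      (\<lambda>a x. (- (\<epsilon> * l_tilde A oE \<iota> c p + m_tilde A oE \<iota> c p) *
         (representation {surf_e1 A \<iota> c p, surf_e3 A \<iota> c p} a (surf_e1 A \<iota> c p) +
          \<epsilon> * representation {surf_e1 A \<iota> c p, surf_e3 A \<iota> c p} a (surf_e3 A \<iota> c p))) *\<^sub>R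
       ((representation {frame_e1 A oE \<iota> c p, frame_e2 A oE \<iota> p, frame_e3 A oE \<iota> c p, frame_e4 A oE \<iota> p} x (frame_e1 A oE \<iota> c p) +
          \<epsilon> * representation {frame_e1 A oE \<iota> c p, frame_e2 A oE \<iota> p, frame_e3 A oE \<iota> c p, frame_e4 A oE \<iota> p} x (frame_e3 A oE \<iota> c p)) *\<^sub>R
          (frame_e2 A oE \<iota> p + frame_e4 A oE \<iota> p) -
        (representation {frame_e1 A oE \<iota> c p, frame_e2 A oE \<iota> p, frame_e3 A oE \<iota> c p, frame_e4 A oE \<iota> p} x (frame_e2 A oE \<iota> p) -
          representation {frame_e1 A oE \<iota> c p, frame_e2 A oE \<iota> p, frame_e3 A oE \<iota> c p, frame_e4 A oE \<iota> p} x (frame_e4 A oE \<iota> p)) *\<^sub>R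
          (frame_e1 A oE \<iota> c p - \<epsilon> *\<^sub>R frame_e3 A oE \<iota> c p)))"
    if p: "\<epsilon> \<in> {1, -1}" "c \<in> A" "p \<in> fst c" "curvature A \<iota> p < 0" for \<epsilon> c p
  proof -
    interpret surface_chart A \<iota> oE c by unfold_locales (rule p)
    have "K (snd c p) < 0" using p curvature_chart by simp
    moreover have "pos_oriented oS (gauss_map A oE \<iota> p)
       (frame_e1 A oE \<iota> c p) (frame_e2 A oE \<iota> p) (frame_e3 A oE \<iota> c p) (frame_e4 A oE \<iota> p)"
      using assms(6) p by (simp add: frames_positive_def)
    ultimately show ?thesis
      using has_nabla_endo_chart[OF p(3) _ assms(5) p(1)] by blast
  qed
  then show ?thesis
    unfolding Let_def using fully_light_like_lift[OF assms(5)] by blast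
qed

end
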